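(* Let $\{x_{kl} : k,l=1,2,\ldots\}$ be a collection of independent, identically distributed complex random variables on a probability space, with $\mathbb{E}[x_{kl}]=0$, $\mathbb{E}[x_{kl}^2]=0$, $\mathbb{E}[|x_{kl}|^2]=1$ and $\mathbb{E}[|x_{11}|^4]<\infty$. Let $c\in(0,\infty)$ and let $p(n)$, $n\ge 1$, be positive integers with $\lim_{n\to\infty}p(n)/n=c$. Let $X_n=(x_{kl})_{1\le k\le p(n),\,1\le l\le n}$ and $\rho_n=X_nX_n^\dagger/\mathrm{Tr}(X_nX_n^\dagger)$. Then the following relations hold with probability one: $$\lim_{n\to\infty}\big(H(\rho_n)-\log n\big)=\log c-\frac{1}{2\pi c}\int_{x_-}^{x_+}\log x\cdot\sqrt{(x_+-x)(x-x_-)}\;dx,$$ where $x_\pm=(1\pm\sqrt{c})^2$, and, as a consequence, $$\lim_{n\to\infty}\frac{H(\rho_n)}{\log n}=1.$$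
   Context: $X^\dagger$ denotes the conjugate transpose of $X$. For a Hermitian matrix $A$, $\lambda_j(A)$ denotes its $j$-th largest eigenvalue (counted with multiplicity). The matrix $\rho_n$ is a random $p(n)\times p(n)$ density matrix (positive semidefinite with trace 1); it is defined whenever $\mathrm{Tr}(X_nX_n^\dagger)\neq0$, which holds almost surely for all large $n$. The von Neumann entropy of a density matrix $\rho$ is $H(\rho)=-\mathrm{Tr}(\rho\log\rho)=-\sum_j\lambda_j(\rho)\log\lambda_j(\rho)$, with the natural logarithm and the convention $0\log 0:=0$. *)

theory Defs
  imports
    "HOL-Probability.Probability"
    "Jordan_Normal_Form.Schur_Decomposition"
begin

definition mat_trace :: "complex mat \<Rightarrow> complex" where
  "mat_trace A = (\<Sum>i<dim_row A. A $$ (i, i))"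

text \<open>
  The \<open>j\<close>-th largest eigenvalue, \<open>1 \<le> j \<le> dim_row A\<close>, counted with multiplicity. Only meaningful for
  Hermitian \<open>A\<close>, whose eigenvalues (the roots of the characteristic polynomial) are all real.
\<close>

definition eigval :: "complex mat \<Rightarrow> nat \<Rightarrow> real" where
  "eigval A j = rev (sorted_list_of_multiset (image_mset Re (proots (char_poly A)))) ! (j - 1)"

text \<open>The convention \<open>0 log 0 = 0\<close> holds automatically because of the factor \<open>0\<close>.\<close>

definition von_neumann_entropy :: "complex mat \<Rightarrow> real" where
  "von_neumann_entropy \<rho> = - (\<Sum>j = 1..dim_row \<rho>. eigval \<rho> j * ln (eigval \<rho> j))"

text \<open>
  The array \<open>x\<close> is indexed from \<open>1\<close>, whereas matrix entries in the library are indexed from \<open>0\<close>.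
\<close>

definition sample_mat :: "(nat \<Rightarrow> nat \<Rightarrow> 'a \<Rightarrow> complex) \<Rightarrow> nat \<Rightarrow> nat \<Rightarrow> 'a \<Rightarrow> complex mat" where
  "sample_mat x p n \<omega> = Matrix.mat p n (\<lambda>(k, l). x (k + 1) (l + 1) \<omega>)"

text \<open>
  If the trace vanishes, the quotient is undefined in the usual reading; here it is then the zero
  matrix.
\<close>

definition normalized_gram :: "complex mat \<Rightarrow> complex mat" where
  "normalized_gram X =
     (1 / mat_trace (X * mat_adjoint X)) \<cdot>\<^sub>m (X * mat_adjoint X)"

end

theory Submission
  imports
    Defs
    "HOL-Real_Asymp.Real_Asymp"
    "HOL-Library.Discrete_Functions"
begin

text \<open>
  Let \<open>A = X X\<^sup>\<dagger>\<close> and let \<open>\<mu>\<close> range over the eigenvalues of \<open>A / n\<close>. Since \<open>Tr A / n\<^sup>2\<close> tends to \<open>c\<close>, the claim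
  reduces to the limit of \<open>(1 / n) \<Sum> \<mu> ln \<mu>\<close>, and
  \<open>\<mu> ln \<mu> = \<integral>\<^sub>0\<^sup>\<infinity> (\<mu> / (1 + t) - \<mu> / (\<mu> + t)) dt\<close> expresses it by the traces
  \<open>g\<^sub>n(t) = Tr (A + n t)\<^sup>-\<^sup>1\<close> at real \<open>t > 0\<close>; the integrals are dominated because
  \<open>Tr A\<^sup>2 / n\<^sup>3\<close> stays bounded.

  Removing one column \<open>y\<close> of \<open>X\<close> at a time gives the deterministic identity
  \<open>p - n t g\<^sub>n = \<Sum> q / (1 + q)\<close> with \<open>q = y\<^sup>\<dagger> R y\<close>, where the resolvent \<open>R\<close> of the remaining columns is
  independent of \<open>y\<close>. As \<open>q\<close> differs from \<open>Tr R\<close>, hence from \<open>g\<^sub>n\<close>, by an error with second moment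
  \<open>O(1 / n)\<close>, the random \<open>g\<^sub>n(t)\<close> itself nearly solves \<open>t g + g / (1 + g) = c\<close>, whose left-hand side is
  increasing in \<open>g\<close>; no concentration of \<open>g\<^sub>n\<close> around its mean is needed. The fourth moment gives almost
  sure convergence only along the squares \<open>n = k\<^sup>2\<close>; in between, adding a row or a column moves the
  trace by at most \<open>1 / (n t)\<close>.
\<close>

section \<open>Resolvents of positive semidefinite matrices\<close>

text \<open>Two difficulties shape the proof. The spectrum of \<open>A / n\<close> contains 0
  whenever \<open>p n > n\<close>, and its largest point is not controlled, while the logarithm is
  singular at one end and \<open>x ln x\<close> is unbounded at the other. The integral over t meets
  both at once: its integrand is at most \<open>(x + 1)^2 / (1 + t)^2\<close>, so a bound on second
  moments of the spectrum suffices and extreme eigenvalues never enter. Secondly, with four moments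
  the available tool is the second moment of a quadratic form around its trace. For the resolvents
  and for \<open>Tr A^2\<close> the relative errors are O(1 / n) in mean square, which is summable
  along squares; for the trace it is O(1 / n^2), summable over all n. So the trace needs no
  interpolation, resolvent traces are interpolated by perturbation, and \<open>Tr A^2\<close> by
  monotonicity in both dimensions. Matrices are functions on all pairs of indices, with the size as
  a separate argument: every \<open>X n\<close> is a corner of one infinite array, and rows or
  columns can be added or deleted without renumbering.\<close>

definition quad_form :: "nat \<Rightarrow> (nat \<Rightarrow> nat \<Rightarrow> complex) \<Rightarrow> (nat \<Rightarrow> complex) \<Rightarrow> complex" where
  "quad_form P A v = (\<Sum>i<P. \<Sum>j<P. cnj (v i) * A i j * v j)"

abbreviation frobenius :: "nat \<Rightarrow> (nat \<Rightarrow> nat \<Rightarrow> complex) \<Rightarrow> real" where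
  "frobenius P A \<equiv> (\<Sum>i<P. \<Sum>j<P. (cmod (A i j))^2)"

abbreviation quad_dev :: "nat \<Rightarrow> (nat \<Rightarrow> nat \<Rightarrow> complex) \<Rightarrow> (nat \<Rightarrow> complex) \<Rightarrow> real" where
  "quad_dev P A v \<equiv> cmod (quad_form P A v - (\<Sum>i<P. A i i))"

definition psd :: "nat \<Rightarrow> (nat \<Rightarrow> nat \<Rightarrow> complex) \<Rightarrow> bool" where
  "psd P A \<longleftrightarrow> (\<forall>i<P. \<forall>j<P. A j i = cnj (A i j)) \<and> (\<forall>v. 0 \<le> Re (quad_form P A v))"

definition shifted :: "(nat \<Rightarrow> nat \<Rightarrow> complex) \<Rightarrow> real \<Rightarrow> nat \<Rightarrow> nat \<Rightarrow> complex" where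
  "shifted A s i j = A i j + (if i = j then of_real s else 0)"

definition shift_mat :: "nat \<Rightarrow> (nat \<Rightarrow> nat \<Rightarrow> complex) \<Rightarrow> real \<Rightarrow> complex mat" where
  "shift_mat P A s = Matrix.mat P P (\<lambda>(i, j). shifted A s i j)"

text \<open>This is \<open>(A + s)^-1\<close>, written as adjugate over determinant: the entries are
  then visibly rational functions of the entries of \<open>A\<close>, which makes them measurable in
  the random array.\<close>

definition resolvent :: "nat \<Rightarrow> (nat \<Rightarrow> nat \<Rightarrow> complex) \<Rightarrow> real \<Rightarrow> nat \<Rightarrow> nat \<Rightarrow> complex" where
  "resolvent P A s i j = adj_mat (shift_mat P A s) $$ (i, j) / Determinant.det (shift_mat P A s)"

definition res_trace :: "nat \<Rightarrow> (nat \<Rightarrow> nat \<Rightarrow> complex) \<Rightarrow> real \<Rightarrow> real" where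
  "res_trace P A s = (\<Sum>i<P. Re (resolvent P A s i i))"

lemma sum_mult_delta_add:
  fixes f g :: "nat \<Rightarrow> 'a::comm_ring_1"
  shows "(\<Sum>j<P. f j * ((if j = k then 1 else 0) + g j)) = (if k < P then f k else 0) + (\<Sum>j<P. f j * g j)"
proof -
  have "(\<Sum>j<P. f j * ((if j = k then 1 else 0) + g j)) = (\<Sum>j<P. (if j = k then f j else 0) + f j * g j)"
    by (intro sum.cong refl) (simp add: distrib_left)
  then show ?thesis by (simp add: sum.distrib)
qed

lemma psdD: "psd P A \<Longrightarrow> i < P \<Longrightarrow> j < P \<Longrightarrow> A j i = cnj (A i j)"
  unfolding psd_def by blast

lemma psd_quad_form: "psd P A \<Longrightarrow> 0 \<le> Re (quad_form P A v)"
  unfolding psd_def by blast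

lemma quad_form_real:
  assumes "psd P A"
  shows "Im (quad_form P A v) = 0"
proof -
  have "cnj (quad_form P A v) = (\<Sum>i<P. \<Sum>j<P. v i * cnj (A i j) * cnj (v j))"
    by (simp add: quad_form_def)
  also have "\<dots> = (\<Sum>i<P. \<Sum>j<P. cnj (v j) * A j i * v i)"
    using psdD[OF assms] by (intro sum.cong refl) (metis (no_types) lessThan_iff mult.commute mult.left_commute)
  also have "\<dots> = quad_form P A v" unfolding quad_form_def by (rule sum.swap)
  finally show ?thesis by (simp add: complex_eq_iff)
qed

lemma quad_form_shift:
  "quad_form P (shifted A s) v = quad_form P A v + of_real (s * (\<Sum>i<P. (cmod (v i))^2))"
proof -
  have "quad_form P (shifted A s) v =
      (\<Sum>i<P. \<Sum>j<P. cnj (v i) * A i j * v j + (if i = j then s * (cnj (v i) * v j) else 0))"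
    unfolding quad_form_def shifted_def by (intro sum.cong refl) (auto simp: algebra_simps)
  also have "\<dots> = quad_form P A v + (\<Sum>i<P. s * (cnj (v i) * v i))"
    unfolding quad_form_def by (simp add: sum.distrib sum.delta)
  also have "(\<Sum>i<P. s * (cnj (v i) * v i)) = of_real (s * (\<Sum>i<P. (cmod (v i))^2))"
    unfolding of_real_mult of_real_sum complex_norm_square sum_distrib_left by (simp add: mult.commute)
  finally show ?thesis .
qed

lemma psd_shift:
  assumes "psd P A" "0 \<le> s"
  shows "psd P (shifted A s)"
  unfolding psd_def
proof (intro conjI allI impI)
  fix i j assume "i < P" "j < P"
  then have *: "A j i = cnj (A i j)" by (rule psdD[OF assms(1)])
  show "shifted A s j i = cnj (shifted A s i j)" unfolding shifted_def * by simp
next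
  fix v
  have "0 \<le> s * (\<Sum>i<P. (cmod (v i))^2)" using assms(2) by (simp add: sum_nonneg)
  then show "0 \<le> Re (quad_form P (shifted A s) v)"
    using psd_quad_form[OF assms(1), of v] by (simp add: quad_form_shift del: of_real_mult)
qed

lemma quad_form_shift_ge:
  assumes "psd P A"
  shows "s * (\<Sum>i<P. (cmod (v i))^2) \<le> Re (quad_form P (shifted A s) v)"
  using psd_quad_form[OF assms, of v] by (simp add: quad_form_shift del: of_real_mult)

lemma shift_mat_carrier: "shift_mat P A s \<in> carrier_mat P P"
  by (simp add: shift_mat_def)

lemma det_shift_mat:
  assumes "psd P A" "0 < s"
  shows "Determinant.det (shift_mat P A s) \<noteq> 0"
proof
  assume "Determinant.det (shift_mat P A s) = 0"
  then obtain v where v: "v \<in> carrier_vec P" "v \<noteq> 0\<^sub>v P" "shift_mat P A s *\<^sub>v v = 0\<^sub>v P"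
    using det_0_iff_vec_prod_zero[OF shift_mat_carrier] by blast
  have *: "(\<Sum>j<P. shifted A s i j * v $ j) = 0" if "i < P" for i
  proof -
    have "(shift_mat P A s *\<^sub>v v) $ i = (\<Sum>j<P. shifted A s i j * v $ j)"
      using v(1) that by (simp add: shift_mat_def scalar_prod_def atLeast0LessThan)
    then show ?thesis using v(3) that by simp
  qed
  have "quad_form P (shifted A s) (($) v) = (\<Sum>i<P. cnj (v $ i) * (\<Sum>j<P. shifted A s i j * v $ j))"
    by (simp add: quad_form_def sum_distrib_left mult.assoc)
  also have "\<dots> = 0" using * by simp
  finally have "s * (\<Sum>i<P. (cmod (v $ i))^2) \<le> 0"
    using quad_form_shift_ge[OF assms(1), of s "($) v"] by simp
  then have "(\<Sum>i<P. (cmod (v $ i))^2) \<le> 0" using assms(2) by (simp add: mult_le_0_iff)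
  then have "(\<Sum>i<P. (cmod (v $ i))^2) = 0" by (simp add: antisym sum_nonneg)
  then have "v $ i = 0" if "i < P" for i using that by (simp add: sum_nonneg_eq_0_iff)
  then have "v = 0\<^sub>v P" using v(1) by (intro eq_vecI) auto
  with v(2) show False by simp
qed

lemma resolvent_inverse:
  assumes "psd P A" "0 < s" "i < P" "k < P"
  shows resolvent_right: "(\<Sum>j<P. shifted A s i j * resolvent P A s j k) = (if i = k then 1 else 0)"
    and resolvent_left: "(\<Sum>j<P. resolvent P A s i j * shifted A s j k) = (if i = k then 1 else 0)"
proof -
  let ?K = "shift_mat P A s"
  have "(?K * adj_mat ?K) $$ (i, k) = (\<Sum>j<P. shifted A s i j * adj_mat ?K $$ (j, k))"
    "(adj_mat ?K * ?K) $$ (i, k) = (\<Sum>j<P. adj_mat ?K $$ (i, j) * shifted A s j k)"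
    using assms(3,4) adj_mat(1)[OF shift_mat_carrier, of P A s]
    by (auto simp: scalar_prod_def atLeast0LessThan shift_mat_def intro!: sum.cong)
  moreover have "(?K * adj_mat ?K) $$ (i, k) = (if i = k then Determinant.det ?K else 0)"
    "(adj_mat ?K * ?K) $$ (i, k) = (if i = k then Determinant.det ?K else 0)"
    using assms(3,4) by (simp_all add: adj_mat(2,3)[OF shift_mat_carrier])
  ultimately show "(\<Sum>j<P. shifted A s i j * resolvent P A s j k) = (if i = k then 1 else 0)"
    "(\<Sum>j<P. resolvent P A s i j * shifted A s j k) = (if i = k then 1 else 0)"
    using det_shift_mat[OF assms(1,2)]
    by (simp_all add: resolvent_def sum_divide_distrib[symmetric] split: if_splits)
qed

text \<open>Uniqueness of the solution of \<open>(A + s) z = y\<close>. The perturbation formulas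
  below are all obtained by exhibiting a solution of such a system and reading off its entries
  here.\<close>

lemma resolvent_solve:
  assumes "psd P A" "0 < s" "i < P"
    and "\<And>i. i < P \<Longrightarrow> (\<Sum>j<P. shifted A s i j * z j) = y i"
  shows "z i = (\<Sum>j<P. resolvent P A s i j * y j)"
proof -
  have "(\<Sum>j<P. resolvent P A s i j * y j) =
      (\<Sum>j<P. \<Sum>k<P. resolvent P A s i j * shifted A s j k * z k)"
    by (intro sum.cong refl) (simp add: assms(4)[symmetric] sum_distrib_left mult.assoc)
  also have "\<dots> = (\<Sum>k<P. (\<Sum>j<P. resolvent P A s i j * shifted A s j k) * z k)"
    by (subst sum.swap) (simp add: sum_distrib_right)
  also have "\<dots> = (\<Sum>k<P. if i = k then z k else 0)"
    by (intro sum.cong refl) (simp add: resolvent_left[OF assms(1-3)])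
  also have "\<dots> = z i" using assms(3) by simp
  finally show ?thesis by simp
qed

lemma resolvent_apply:
  assumes "psd P A" "0 < s" "i < P"
  shows "(\<Sum>j<P. shifted A s i j * (\<Sum>k<P. resolvent P A s j k * y k)) = y i"
proof -
  have "(\<Sum>j<P. shifted A s i j * (\<Sum>k<P. resolvent P A s j k * y k)) =
      (\<Sum>j<P. \<Sum>k<P. shifted A s i j * resolvent P A s j k * y k)"
    by (simp add: sum_distrib_left mult.assoc)
  also have "\<dots> = (\<Sum>k<P. (\<Sum>j<P. shifted A s i j * resolvent P A s j k) * y k)"
    by (subst sum.swap) (simp add: sum_distrib_right)
  also have "\<dots> = (\<Sum>k<P. if i = k then y k else 0)"
    by (intro sum.cong refl) (simp add: resolvent_right[OF assms])
  finally show ?thesis using assms(3) by simp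
qed

lemma resolvent_hermitian:
  assumes "psd P A" "0 < s" "i < P" "k < P"
  shows "resolvent P A s k i = cnj (resolvent P A s i k)"
proof -
  \<comment> \<open>Conjugating the left inverse identity shows that the conjugated row
    \<open>i\<close> of the resolvent solves the system whose solution is column
    \<open>i\<close>.\<close>
  have "(\<Sum>j<P. shifted A s l j * cnj (resolvent P A s i j)) = (if l = i then 1 else 0)" if "l < P" for l
  proof -
    have "(\<Sum>j<P. shifted A s l j * cnj (resolvent P A s i j)) =
        cnj (\<Sum>j<P. resolvent P A s i j * shifted A s j l)"
      using that psdD[OF psd_shift[OF assms(1), of s], of _ l] assms(2) by (simp add: mult.commute)
    then show ?thesis using resolvent_left[OF assms(1,2,3) that] by simp
  qed
  then have "cnj (resolvent P A s i k) = (\<Sum>j<P. resolvent P A s k j * (if j = i then 1 else 0))"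
    by (intro resolvent_solve[OF assms(1,2,4), of "\<lambda>j. cnj (resolvent P A s i j)"])
  then show ?thesis using assms(3) by (simp add: if_distrib cong: if_cong)
qed

lemma resolvent_diag_real:
  assumes "psd P A" "0 < s" "i < P"
  shows "resolvent P A s i i = of_real (Re (resolvent P A s i i))"
  using resolvent_hermitian[OF assms assms(3)] by (simp add: complex_eq_iff)

text \<open>Here \<open>y = (A + s) z\<close>, so the pairing of \<open>y\<close> with
  \<open>z\<close> is the conjugate of the quadratic form of \<open>A + s\<close> at
  \<open>z\<close>, which is real and at least \<open>s\<close> times the squared norm of
  \<open>z\<close>. All norm bounds on resolvents come from this inequality.\<close>

lemma resolvent_quad_form:
  assumes "psd P A" "0 < s" and z: "\<And>i. i < P \<Longrightarrow> z i = (\<Sum>j<P. resolvent P A s i j * y j)"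
  shows "(\<Sum>i<P. cnj (y i) * z i) = of_real (Re (\<Sum>i<P. cnj (y i) * z i))"
    and "s * (\<Sum>i<P. (cmod (z i))^2) \<le> Re (\<Sum>i<P. cnj (y i) * z i)"
proof -
  have y: "y i = (\<Sum>j<P. shifted A s i j * z j)" if "i < P" for i
    using resolvent_apply[OF assms(1,2) that, of y] by (simp add: z)
  have "cnj (\<Sum>i<P. cnj (y i) * z i) = (\<Sum>i<P. cnj (z i) * (\<Sum>j<P. shifted A s i j * z j))"
    by (simp add: y mult.commute)
  also have "\<dots> = quad_form P (shifted A s) z" by (simp add: quad_form_def sum_distrib_left mult.assoc)
  finally have eq: "(\<Sum>i<P. cnj (y i) * z i) = cnj (quad_form P (shifted A s) z)"
    by (metis complex_cnj_cnj)
  show "(\<Sum>i<P. cnj (y i) * z i) = of_real (Re (\<Sum>i<P. cnj (y i) * z i))"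
    using quad_form_real[OF psd_shift[OF assms(1)], of s z] assms(2) by (simp add: eq complex_eq_iff)
  show "s * (\<Sum>i<P. (cmod (z i))^2) \<le> Re (\<Sum>i<P. cnj (y i) * z i)"
    using quad_form_shift_ge[OF assms(1), of s z] by (simp add: eq)
qed

lemma resolvent_column_norm:
  assumes "psd P A" "0 < s" "k < P"
  shows "s * (\<Sum>i<P. (cmod (resolvent P A s i k))^2) \<le> Re (resolvent P A s k k)"
  using resolvent_quad_form(2)[OF assms(1,2), of "\<lambda>i. resolvent P A s i k" "\<lambda>j. if j = k then 1 else 0"] assms(3)
  by (simp add: if_distrib if_distribR cong: if_cong)

lemma resolvent_diag_bounds:
  assumes "psd P A" "0 < s" "k < P"
  shows "0 \<le> Re (resolvent P A s k k)" and "Re (resolvent P A s k k) \<le> 1 / s"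
proof -
  let ?r = "Re (resolvent P A s k k)"
  have "?r^2 \<le> (cmod (resolvent P A s k k))^2" by (simp add: cmod_power2)
  also have "\<dots> \<le> (\<Sum>i<P. (cmod (resolvent P A s i k))^2)"
    using assms(3) by (intro member_le_sum) auto
  finally have "s * ?r^2 \<le> s * (\<Sum>i<P. (cmod (resolvent P A s i k))^2)"
    using assms(2) by (intro mult_left_mono) auto
  then have *: "s * ?r^2 \<le> ?r" using resolvent_column_norm[OF assms] by linarith
  moreover have "0 \<le> s * ?r^2" using assms(2) by simp
  ultimately show "0 \<le> ?r" by linarith
  show "?r \<le> 1 / s"
    using * \<open>0 \<le> ?r\<close> assms(2) by (cases "?r = 0") (auto simp: power2_eq_square field_simps)
qed

text \<open>The source of the small errors: with \<open>s = n t\<close> and \<open>P\<close> of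
  order n, the whole resolvent has squared Frobenius norm O(1 / n).\<close>

lemma resolvent_frobenius:
  assumes "psd P A" "0 < s"
  shows "(\<Sum>k<P. \<Sum>i<P. (cmod (resolvent P A s i k))^2) \<le> P / s^2"
proof -
  have "(\<Sum>i<P. (cmod (resolvent P A s i k))^2) \<le> 1 / s^2" if "k < P" for k
  proof -
    have "s * (\<Sum>i<P. (cmod (resolvent P A s i k))^2) \<le> 1 / s"
      using resolvent_column_norm[OF assms that] resolvent_diag_bounds(2)[OF assms that] by linarith
    then show ?thesis using assms(2) by (simp add: field_simps power2_eq_square)
  qed
  then have "(\<Sum>k<P. \<Sum>i<P. (cmod (resolvent P A s i k))^2) \<le> (\<Sum>k<P. 1 / s^2)"
    by (intro sum_mono) auto
  then show ?thesis by simp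
qed

lemma res_trace_bounds:
  assumes "psd P A" "0 < s"
  shows "0 \<le> res_trace P A s" "res_trace P A s \<le> P / s"
proof -
  show "0 \<le> res_trace P A s"
    unfolding res_trace_def using resolvent_diag_bounds(1)[OF assms] by (intro sum_nonneg) auto
  have "res_trace P A s \<le> (\<Sum>i<P. 1 / s)"
    unfolding res_trace_def using resolvent_diag_bounds(2)[OF assms] by (intro sum_mono) auto
  then show "res_trace P A s \<le> P / s" by simp
qed

lemma res_trace_complex:
  assumes "psd P A" "0 < s"
  shows "(\<Sum>i<P. resolvent P A s i i) = of_real (res_trace P A s)"
proof -
  have "resolvent P A s i i = of_real (Re (resolvent P A s i i))" if "i < P" for i
    using resolvent_diag_real[OF assms that] .
  then have "(\<Sum>i<P. resolvent P A s i i) = (\<Sum>i<P. of_real (Re (resolvent P A s i i)))"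
    by (intro sum.cong) auto
  then show ?thesis by (simp add: res_trace_def)
qed

lemma quad_form_resolvent:
  assumes "psd P A" "0 < s"
  shows "quad_form P (resolvent P A s) y = of_real (Re (quad_form P (resolvent P A s) y))"
    and "0 \<le> Re (quad_form P (resolvent P A s) y)"
    and "s * (\<Sum>i<P. (cmod (\<Sum>j<P. resolvent P A s i j * y j))^2) \<le> Re (quad_form P (resolvent P A s) y)"
proof -
  define z where "z i = (\<Sum>j<P. resolvent P A s i j * y j)" for i
  have q: "quad_form P (resolvent P A s) y = (\<Sum>i<P. cnj (y i) * z i)"
    by (simp add: quad_form_def z_def sum_distrib_left mult.assoc)
  note rq = resolvent_quad_form[OF assms z_def]
  show "quad_form P (resolvent P A s) y = of_real (Re (quad_form P (resolvent P A s) y))"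
    unfolding q by (rule rq(1))
  show *: "s * (\<Sum>i<P. (cmod (\<Sum>j<P. resolvent P A s i j * y j))^2) \<le> Re (quad_form P (resolvent P A s) y)"
    unfolding q using rq(2) by (simp add: z_def)
  show "0 \<le> Re (quad_form P (resolvent P A s) y)"
    using assms(2) by (intro order_trans[OF _ *] mult_nonneg_nonneg sum_nonneg) auto
qed

text \<open>The Sherman--Morrison formula.\<close>

lemma resolvent_rank_one:
  assumes "psd P A" "psd P A'" "0 < s"
    and A': "\<And>i j. i < P \<Longrightarrow> j < P \<Longrightarrow> A' i j = A i j + y i * cnj (y j)"
  shows "quad_form P (resolvent P A' s) y =
      of_real (Re (quad_form P (resolvent P A s) y) / (1 + Re (quad_form P (resolvent P A s) y)))"
    and "res_trace P A' s \<le> res_trace P A s"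
    and "res_trace P A s \<le> res_trace P A' s + 1 / s"
proof -
  define z where "z i = (\<Sum>j<P. resolvent P A s i j * y j)" for i
  define z' where "z' i = (\<Sum>j<P. resolvent P A' s i j * y j)" for i
  define q where "q = Re (quad_form P (resolvent P A s) y)"
  have qf: "quad_form P (resolvent P A s) y = (\<Sum>i<P. cnj (y i) * z i)"
    by (simp add: quad_form_def z_def sum_distrib_left mult.assoc)
  have qf': "quad_form P (resolvent P A' s) y = (\<Sum>i<P. cnj (y i) * z' i)"
    by (simp add: quad_form_def z'_def sum_distrib_left mult.assoc)
  have q: "(\<Sum>i<P. cnj (y i) * z i) = of_real q"
    unfolding q_def qf[symmetric] by (rule quad_form_resolvent(1)[OF assms(1,3)])
  have q0: "0 \<le> q" unfolding q_def by (rule quad_form_resolvent(2)[OF assms(1,3)])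
  have zz: "s * (\<Sum>i<P. (cmod (z i))^2) \<le> q"
    unfolding q_def z_def by (rule quad_form_resolvent(3)[OF assms(1,3)])
  have shifted': "shifted A' s i j = shifted A s i j + y i * cnj (y j)" if "i < P" "j < P" for i j
    using that by (simp add: shifted_def A')
  \<comment> \<open>The resolvent of \<open>A\<close> applied to \<open>y\<close> is almost a
    solution for \<open>A'\<close> as well: the rank one term only adds \<open>q * y\<close> to the
    right-hand side, so the two solutions are proportional.\<close>
  have z_eq: "z i = (1 + q) * z' i" if "i < P" for i
  proof -
    have *: "(\<Sum>j<P. shifted A' s i j * z j) = y i + of_real q * y i" if "i < P" for i
    proof -
      have "(\<Sum>j<P. shifted A' s i j * z j) =
          (\<Sum>j<P. shifted A s i j * z j) + y i * (\<Sum>j<P. cnj (y j) * z j)"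
        using that by (simp add: shifted' sum.distrib algebra_simps sum_distrib_left)
      moreover have "(\<Sum>j<P. shifted A s i j * z j) = y i"
        unfolding z_def by (rule resolvent_apply[OF assms(1,3) that])
      ultimately show ?thesis by (simp add: q)
    qed
    have "z i = (\<Sum>j<P. resolvent P A' s i j * (y j + of_real q * y j))"
      by (rule resolvent_solve[OF assms(2,3) that *])
    then show ?thesis by (simp add: z'_def algebra_simps sum.distrib sum_distrib_left)
  qed
  have z'_eq: "z' i = z i / (1 + q)" if "i < P" for i
    using z_eq[OF that] q0 by (simp add: field_simps complex_eq_iff)
  have "(\<Sum>i<P. cnj (y i) * z' i) = (\<Sum>i<P. cnj (y i) * z i) / (1 + q)"
    by (simp add: z'_eq sum_divide_distrib)
  then show "quad_form P (resolvent P A' s) y = 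
      of_real (Re (quad_form P (resolvent P A s) y) / (1 + Re (quad_form P (resolvent P A s) y)))"
    unfolding qf' q q_def[symmetric] by simp
  \<comment> \<open>The same device for column \<open>k\<close> of the old resolvent: inserted into
    the system of \<open>A'\<close> it gives the unit vector plus a multiple of
    \<open>y\<close>.\<close>
  have diag: "resolvent P A s k k = resolvent P A' s k k + z' k * cnj (z k)" if "k < P" for k
  proof -
    let ?r = "\<lambda>i. resolvent P A s i k"
    have w: "(\<Sum>j<P. cnj (y j) * ?r j) = cnj (z k)"
      unfolding z_def using resolvent_hermitian[OF assms(1,3) that] by (simp add: mult.commute)
    have *: "(\<Sum>j<P. shifted A' s i j * ?r j) = (if i = k then 1 else 0) + y i * cnj (z k)" if "i < P" for i
    proof -
      have "(\<Sum>j<P. shifted A' s i j * ?r j) = 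
          (\<Sum>j<P. shifted A s i j * ?r j) + y i * (\<Sum>j<P. cnj (y j) * ?r j)"
        using that by (simp add: shifted' sum.distrib algebra_simps sum_distrib_left)
      then show ?thesis using resolvent_right[OF assms(1,3) that \<open>k < P\<close>] w by simp
    qed
    have "?r k = (\<Sum>j<P. resolvent P A' s k j * ((if j = k then 1 else 0) + y j * cnj (z k)))"
      by (rule resolvent_solve[OF assms(2,3) that *])
    also have "\<dots> = resolvent P A' s k k + z' k * cnj (z k)"
      using that unfolding sum_mult_delta_add by (simp add: z'_def sum_distrib_right mult.assoc)
    finally show ?thesis .
  qed
  have "Re (z' k * cnj (z k)) = (cmod (z k))^2 / (1 + q)" if "k < P" for k
  proof -
    have "z' k * cnj (z k) = of_real ((cmod (z k))^2 / (1 + q))"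
      using that by (simp add: z'_eq complex_norm_square[symmetric] del: of_real_power) 
    then show ?thesis by (simp only: Re_complex_of_real)
  qed
  then have tr: "res_trace P A s = res_trace P A' s + (\<Sum>k<P. (cmod (z k))^2) / (1 + q)"
    by (simp add: res_trace_def diag sum.distrib sum_divide_distrib)
  show "res_trace P A' s \<le> res_trace P A s" using q0 by (simp add: tr sum_nonneg)
  \<comment> \<open>The traces differ by the squared norm of \<open>z\<close> over
    \<open>1 + q\<close>. As that norm is itself at most \<open>q / s\<close>, the bound
    \<open>1 / s\<close> does not depend on the length of \<open>y\<close>.\<close>
  have "(\<Sum>k<P. (cmod (z k))^2) \<le> (1 + q) / s" using zz assms(3) by (simp add: field_simps)
  then show "res_trace P A s \<le> res_trace P A' s + 1 / s" using q0 assms(3) by (simp add: tr field_simps)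
qed

text \<open>A Schur complement argument.\<close>

lemma res_trace_Suc:
  assumes "psd P A" "psd (Suc P) A" "0 < s"
  shows "res_trace P A s \<le> res_trace (Suc P) A s"
    and "res_trace (Suc P) A s \<le> res_trace P A s + 1 / s"
proof -
  let ?R = "resolvent P A s" and ?R' = "resolvent (Suc P) A s"
  define z where "z i = (\<Sum>j<P. ?R i j * A j P)" for i
  define a where "a = Re (?R' P P)"
  have a: "?R' P P = of_real a" unfolding a_def by (rule resolvent_diag_real[OF assms(2,3)]) simp
  have a0: "0 \<le> a" unfolding a_def by (rule resolvent_diag_bounds(1)[OF assms(2,3)]) simp
  \<comment> \<open>The first \<open>P\<close> entries of a column of the large resolvent solve the
    small system once the term from the last index is moved to the right-hand side.\<close>
  have eq: "?R' i k = (if k = P then 0 else ?R i k) - z i * ?R' P k" if "i < P" "k \<le> P" for i k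
  proof -
    have *: "(\<Sum>j<P. shifted A s l j * ?R' j k) = (if l = k then 1 else 0) - A l P * ?R' P k" if "l < P" for l
      using resolvent_right[OF assms(2,3), of l k] \<open>l < P\<close> \<open>k \<le> P\<close>
      by (simp add: shifted_def[of A s l P] algebra_simps)
    have "?R' i k = (\<Sum>j<P. ?R i j * ((if j = k then 1 else 0) + - A j P * ?R' P k))"
      by (rule resolvent_solve[OF assms(1,3) \<open>i < P\<close>]) (simp add: *)
    also have "\<dots> = (if k < P then ?R i k else 0) - z i * ?R' P k"
      unfolding sum_mult_delta_add by (simp add: z_def sum_distrib_right mult.assoc sum_negf)
    finally show ?thesis using that by auto
  qed
  have col: "?R' i P = - z i * of_real a" if "i < P" for i using eq[OF that, of P] by (simp add: a)
  have row: "?R' P k = - cnj (z k) * of_real a" if "k < P" for k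
    using resolvent_hermitian[OF assms(2,3), of k P] that by (simp add: col)
  have diag: "Re (?R' i i) = Re (?R i i) + a * (cmod (z i))^2" if "i < P" for i
  proof -
    have "?R' i i = ?R i i + of_real a * (z i * cnj (z i))"
      using eq[OF that, of i] that by (simp add: row mult.commute mult.left_commute)
    also have "z i * cnj (z i) = of_real ((cmod (z i))^2)" by (simp only: complex_norm_square)
    finally show ?thesis by (simp del: of_real_power)
  qed
  have tr: "res_trace (Suc P) A s = res_trace P A s + a * (1 + (\<Sum>i<P. (cmod (z i))^2))"
    by (simp add: res_trace_def diag sum.distrib a_def[symmetric] sum_distrib_left algebra_simps)
  show "res_trace P A s \<le> res_trace (Suc P) A s" using a0 by (simp add: tr sum_nonneg)
  \<comment> \<open>The last column of the large resolvent is \<open>a\<close> times the vector with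
    entries \<open>- z i\<close> and last entry 1. Its squared norm is therefore \<open>a\<close>
    times the increment of the trace, and the column bound turns this into an increment of at most
    \<open>1 / s\<close>.\<close>
  have "s * (\<Sum>i<Suc P. (cmod (?R' i P))^2) \<le> a"
    unfolding a_def by (rule resolvent_column_norm[OF assms(2,3)]) simp
  also have "(\<Sum>i<Suc P. (cmod (?R' i P))^2) = a^2 * (1 + (\<Sum>i<P. (cmod (z i))^2))"
    by (simp add: col a norm_mult power_mult_distrib sum_distrib_left algebra_simps)
  finally have le: "s * (a^2 * (1 + (\<Sum>i<P. (cmod (z i))^2))) \<le> a" .
  have "a * (1 + (\<Sum>i<P. (cmod (z i))^2)) \<le> 1 / s"
  proof (cases "a = 0")
    case False
    with a0 have "0 < a" by simp
    moreover have "a * (s * (a * (1 + (\<Sum>i<P. (cmod (z i))^2)))) \<le> a * 1"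
      using le by (simp add: power2_eq_square mult_ac)
    ultimately have "s * (a * (1 + (\<Sum>i<P. (cmod (z i))^2))) \<le> 1"
      by (simp only: mult_le_cancel_left_pos)
    then show ?thesis using assms(3) by (simp add: pos_le_divide_eq mult.commute)
  qed (use assms(3) in simp)
  then show "res_trace (Suc P) A s \<le> res_trace P A s + 1 / s" by (simp add: tr)
qed

section \<open>Gram matrices and the leave-one-out identity\<close>

text \<open>Columns are taken from an arbitrary set, so that one of them can be removed; the number
  of rows is fixed only where the matrix is used.\<close>

definition gram :: "('i \<Rightarrow> 'j \<Rightarrow> complex) \<Rightarrow> 'j set \<Rightarrow> 'i \<Rightarrow> 'i \<Rightarrow> complex" where
  "gram Y S i j = (\<Sum>m\<in>S. Y i m * cnj (Y j m))"

lemma gram_insert: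
  "finite S \<Longrightarrow> m \<notin> S \<Longrightarrow> gram Y (insert m S) i j = gram Y S i j + Y i m * cnj (Y j m)"
  by (simp add: gram_def)

lemma gram_remove:
  "finite S \<Longrightarrow> m \<in> S \<Longrightarrow> gram Y S i j = gram Y (S - {m}) i j + Y i m * cnj (Y j m)"
  using gram_insert[of "S - {m}" m Y i j] by (simp add: insert_absorb)

lemma gram_cnj: "gram Y S j i = cnj (gram Y S i j)"
  by (simp add: gram_def mult.commute)

lemma quad_form_gram:
  "quad_form P (gram Y S) v = of_real (\<Sum>m\<in>S. (cmod (\<Sum>i<P. cnj (v i) * Y i m))^2)"
proof -
  have "quad_form P (gram Y S) v = (\<Sum>i<P. \<Sum>j<P. \<Sum>m\<in>S. (cnj (v i) * Y i m) * cnj (cnj (v j) * Y j m))"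
    unfolding quad_form_def gram_def
    by (intro sum.cong refl) (simp add: sum_distrib_left sum_distrib_right mult_ac)
  also have "\<dots> = (\<Sum>i<P. \<Sum>m\<in>S. \<Sum>j<P. (cnj (v i) * Y i m) * cnj (cnj (v j) * Y j m))"
    by (intro sum.cong refl sum.swap)
  also have "\<dots> = (\<Sum>m\<in>S. \<Sum>i<P. \<Sum>j<P. (cnj (v i) * Y i m) * cnj (cnj (v j) * Y j m))"
    by (rule sum.swap)
  also have "\<dots> = (\<Sum>m\<in>S. (\<Sum>i<P. cnj (v i) * Y i m) * cnj (\<Sum>i<P. cnj (v i) * Y i m))"
    unfolding cnj_sum sum_product ..
  also have "\<dots> = (\<Sum>m\<in>S. of_real ((cmod (\<Sum>i<P. cnj (v i) * Y i m))^2))"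
    by (simp only: complex_norm_square)
  finally show ?thesis by (simp only: of_real_sum)
qed

lemma psd_gram: "psd P (gram Y S)"
  unfolding psd_def
proof (intro conjI allI impI)
  show "gram Y S j i = cnj (gram Y S i j)" for i j by (rule gram_cnj)
  show "0 \<le> Re (quad_form P (gram Y S) v)" for v
    unfolding quad_form_gram Re_complex_of_real by (intro sum_nonneg) simp
qed

lemma resolvent_gram_remove:
  fixes Y :: "nat \<Rightarrow> 'j \<Rightarrow> complex"
  assumes "finite S" "l \<in> S" "0 < s"
  defines "q \<equiv> \<lambda>P. Re (quad_form P (resolvent P (gram Y (S - {l})) s) (\<lambda>i. Y i l))"
  shows "quad_form P (resolvent P (gram Y S) s) (\<lambda>i. Y i l) = of_real (q P / (1 + q P))"
    and "res_trace P (gram Y S) s \<le> res_trace P (gram Y (S - {l})) s"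
    and "res_trace P (gram Y (S - {l})) s \<le> res_trace P (gram Y S) s + 1 / s"
  using resolvent_rank_one[OF psd_gram psd_gram assms(3), of P Y S Y "S - {l}" "\<lambda>i. Y i l"]
  unfolding q_def by (simp_all add: gram_remove[OF assms(1,2)])

text \<open>Summing over the columns gives \<open>Tr (R A)\<close>, where \<open>A\<close> is
  \<open>(A + s) - s\<close> and \<open>R (A + s)\<close> is the identity.\<close>

lemma res_trace_gram:
  assumes "0 < s"
  shows "(\<Sum>l\<in>S. quad_form P (resolvent P (gram Y S) s) (\<lambda>i. Y i l)) =
      of_real (P - s * res_trace P (gram Y S) s)"
proof -
  let ?A = "gram Y S" and ?R = "resolvent P (gram Y S) s"
  have "(\<Sum>l\<in>S. quad_form P ?R (\<lambda>i. Y i l)) = 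
      (\<Sum>i<P. \<Sum>l\<in>S. \<Sum>j<P. cnj (Y i l) * ?R i j * Y j l)"
    unfolding quad_form_def by (rule sum.swap)
  also have "\<dots> = (\<Sum>i<P. \<Sum>j<P. \<Sum>l\<in>S. cnj (Y i l) * ?R i j * Y j l)"
    by (intro sum.cong refl sum.swap)
  also have "\<dots> = (\<Sum>i<P. \<Sum>j<P. ?R i j * ?A j i)"
    unfolding gram_def[of Y S "j :: nat" for j] by (intro sum.cong refl) (simp add: sum_distrib_left sum_distrib_right mult_ac)
  also have "\<dots> = (\<Sum>i<P. (\<Sum>j<P. ?R i j * shifted ?A s j i) - s * ?R i i)"
  proof (intro sum.cong refl)
    fix i assume "i \<in> {..<P}"
    moreover have "(\<Sum>j<P. ?R i j * shifted ?A s j i) = (\<Sum>j<P. ?R i j * ?A j i + (if j = i then s * ?R i i else 0))"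
      by (intro sum.cong refl) (simp add: shifted_def distrib_left)
    ultimately show "(\<Sum>j<P. ?R i j * ?A j i) = (\<Sum>j<P. ?R i j * shifted ?A s j i) - s * ?R i i"
      by (simp add: sum.distrib)
  qed
  also have "\<dots> = (\<Sum>i<P. 1 - s * ?R i i)"
    by (intro sum.cong refl) (simp add: resolvent_left[OF psd_gram assms])
  also have "\<dots> = of_real (P - s * res_trace P ?A s)"
    by (simp add: sum_subtractf sum_distrib_left[symmetric] res_trace_complex[OF psd_gram assms])
  finally show ?thesis .
qed

lemma frac_lipschitz:
  fixes a b :: real
  assumes "0 \<le> a" "0 \<le> b"
  shows "\<bar>a / (1 + a) - b / (1 + b)\<bar> \<le> \<bar>a - b\<bar>"
proof -
  have "a / (1 + a) - b / (1 + b) = (a - b) / ((1 + a) * (1 + b))" using assms by (simp add: field_simps)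
  then have "\<bar>a / (1 + a) - b / (1 + b)\<bar> = \<bar>a - b\<bar> / ((1 + a) * (1 + b))"
    using assms by (simp add: abs_mult)
  also have "\<dots> \<le> \<bar>a - b\<bar> / 1"
  proof (rule divide_left_mono)
    show "1 \<le> (1 + a) * (1 + b)" using mult_mono[of 1 "1 + a" 1 "1 + b"] assms by simp
  qed (use assms in auto)
  finally show ?thesis by simp
qed

text \<open>By the rank one formula \<open>P - s * G\<close> is exactly the sum of the terms
  \<open>q / (1 + q)\<close>. Since \<open>a / (1 + a)\<close> has Lipschitz constant 1 on
  nonnegative arguments, replacing each \<open>q\<close> by \<open>G\<close> costs the deviation of
  \<open>q\<close> from the trace of its own resolvent, plus at most \<open>1 / s\<close> for the
  missing column. All randomness is thereby confined to \<open>quad_dev\<close>.\<close>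

lemma leave_one_out:
  fixes Y :: "nat \<Rightarrow> 'j \<Rightarrow> complex"
  assumes "finite S" "0 < s"
  assumes G_def: "G = res_trace P (gram Y S) s"
  shows "\<bar>P - s * G - card S * (G / (1 + G))\<bar> \<le>
      (\<Sum>l\<in>S. quad_dev P (resolvent P (gram Y (S - {l})) s) (\<lambda>i. Y i l)) + card S / s"
proof -
  define q where "q l = Re (quad_form P (resolvent P (gram Y (S - {l})) s) (\<lambda>i. Y i l))" for l
  define d where "d l = quad_dev P (resolvent P (gram Y (S - {l})) s) (\<lambda>i. Y i l)" for l
  have G0: "0 \<le> G" unfolding G_def by (rule res_trace_bounds(1)[OF psd_gram assms(2)])
  have "of_real (P - s * G) = (\<Sum>l\<in>S. complex_of_real (q l / (1 + q l)))"
    unfolding G_def res_trace_gram[OF assms(2), symmetric] q_def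
    by (intro sum.cong refl resolvent_gram_remove(1)[OF assms(1) _ assms(2)])
  then have "P - s * G = (\<Sum>l\<in>S. q l / (1 + q l))"
    unfolding of_real_sum[symmetric] of_real_eq_iff .
  then have "\<bar>P - s * G - card S * (G / (1 + G))\<bar> = \<bar>\<Sum>l\<in>S. q l / (1 + q l) - G / (1 + G)\<bar>"
    by (simp add: sum_subtractf)
  also have "\<dots> \<le> (\<Sum>l\<in>S. \<bar>q l / (1 + q l) - G / (1 + G)\<bar>)" by (rule sum_abs)
  also have "\<dots> \<le> (\<Sum>l\<in>S. d l + 1 / s)"
  proof (rule sum_mono)
    fix l assume l: "l \<in> S"
    let ?G = "res_trace P (gram Y (S - {l})) s"
    have "\<bar>q l / (1 + q l) - G / (1 + G)\<bar> \<le> \<bar>q l - G\<bar>"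
      using G0 quad_form_resolvent(2)[OF psd_gram assms(2)] unfolding q_def by (intro frac_lipschitz) auto
    also have "\<dots> \<le> \<bar>q l - ?G\<bar> + 1 / s"
      using resolvent_gram_remove(2,3)[OF assms(1) l assms(2), of P Y] unfolding G_def by linarith
    also have "\<bar>q l - ?G\<bar> = d l"
      unfolding d_def res_trace_complex[OF psd_gram assms(2)] q_def
      by (subst quad_form_resolvent(1)[OF psd_gram assms(2)])
        (simp only: of_real_diff[symmetric] norm_of_real Re_complex_of_real)
    finally show "\<bar>q l / (1 + q l) - G / (1 + G)\<bar> \<le> d l + 1 / s" by simp
  qed
  finally show ?thesis by (simp add: sum.distrib d_def)
qed

lemma res_trace_gram_column:
  fixes N k :: nat
  assumes "0 < s"
  shows "\<bar>res_trace P (gram Y {..<N + k}) s - res_trace P (gram Y {..<N}) s\<bar> \<le> k / s"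
proof (induction k)
  case (Suc k)
  have "\<bar>res_trace P (gram Y {..<Suc (N + k)}) s - res_trace P (gram Y {..<N + k}) s\<bar> \<le> 1 / s"
    using resolvent_gram_remove(2,3)[OF _ _ assms, of "{..<Suc (N + k)}" "N + k" P Y] assms
    by (simp add: lessThan_Suc)
  with Suc.IH show ?case
    by (simp add: add_divide_distrib abs_le_iff)
qed simp

lemma res_trace_gram_row:
  fixes P k :: nat
  assumes "0 < s"
  shows "\<bar>res_trace (P + k) (gram Y S) s - res_trace P (gram Y S) s\<bar> \<le> k / s"
proof (induction k)
  case (Suc k)
  have "\<bar>res_trace (Suc (P + k)) (gram Y S) s - res_trace (P + k) (gram Y S) s\<bar> \<le> 1 / s"
    using res_trace_Suc[OF psd_gram psd_gram assms, of "P + k" Y S] assms by simp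
  with Suc.IH show ?case
    by (simp add: add_divide_distrib abs_le_iff)
qed simp

section \<open>Spectrum and resolvent traces\<close>

abbreviation to_mat :: "nat \<Rightarrow> (nat \<Rightarrow> nat \<Rightarrow> complex) \<Rightarrow> complex mat" where
  "to_mat P A \<equiv> Matrix.mat P P (\<lambda>(i, j). A i j)"

lemma mat_trace_mult_commute:
  assumes "A \<in> carrier_mat n n" "B \<in> carrier_mat n n"
  shows "mat_trace (A * B) = mat_trace (B * A)"
proof -
  have "mat_trace (A * B) = (\<Sum>i<n. \<Sum>j<n. A $$ (i, j) * B $$ (j, i))"
    using assms by (simp add: mat_trace_def scalar_prod_def atLeast0LessThan)
  also have "\<dots> = (\<Sum>i<n. \<Sum>j<n. B $$ (i, j) * A $$ (j, i))"
    by (subst sum.swap) (simp add: mult.commute)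
  also have "\<dots> = mat_trace (B * A)"
    using assms by (simp add: mat_trace_def scalar_prod_def atLeast0LessThan)
  finally show ?thesis .
qed

lemma mat_trace_similar:
  assumes "similar_mat_wit A B P Q"
  shows "mat_trace A = mat_trace B"
proof -
  note w = similar_mat_witD[OF refl assms]
  have "mat_trace A = mat_trace ((P * B) * Q)" by (rule arg_cong[OF w(3)])
  also have "\<dots> = mat_trace (Q * (P * B))"
    using w(5-7) by (intro mat_trace_mult_commute[of _ "dim_row A"]) auto
  also have "Q * (P * B) = (Q * P) * B" using w(5-7) by simp
  also have "\<dots> = B" unfolding w(2) using w(5) by simp
  finally show ?thesis .
qed

text \<open>\<open>C\<close> is not assumed triangular: going through row \<open>i\<close> from the
  left, the equations force the entries before the diagonal to vanish one after the other, and the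
  equation at the diagonal gives the value.\<close>

lemma upper_triangular_left_inverse:
  fixes B C :: "complex mat"
  assumes "B \<in> carrier_mat n n" "C \<in> carrier_mat n n" "upper_triangular B" "C * B = 1\<^sub>m n"
    and nz: "\<And>i. i < n \<Longrightarrow> B $$ (i, i) \<noteq> 0" and "i < n"
  shows "C $$ (i, i) = 1 / B $$ (i, i)"
proof -
  have eq: "(\<Sum>k<n. C $$ (i, k) * B $$ (k, j)) = (if i = j then 1 else 0)" if "j < n" for j
  proof -
    have "(C * B) $$ (i, j) = (\<Sum>k<n. C $$ (i, k) * B $$ (k, j))"
      using assms(1,2,6) that by (simp add: scalar_prod_def atLeast0LessThan)
    then show ?thesis using assms(4,6) that by simp
  qed
  have B0: "B $$ (k, j) = 0" if "j < k" "k < n" for j k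
    using upper_triangularD[OF assms(3)] assms(1) that by auto
  have reduce: "C $$ (i, j) * B $$ (j, j) = (if i = j then 1 else 0)"
    if "j \<le> i" "\<And>k. k < j \<Longrightarrow> C $$ (i, k) = 0" for j
  proof -
    have "(\<Sum>k<n. C $$ (i, k) * B $$ (k, j)) = (\<Sum>k<n. if k = j then C $$ (i, j) * B $$ (j, j) else 0)"
    proof (intro sum.cong refl)
      fix k assume "k \<in> {..<n}"
      then show "C $$ (i, k) * B $$ (k, j) = (if k = j then C $$ (i, j) * B $$ (j, j) else 0)"
        using that(2)[of k] B0[of j k] by (cases k j rule: linorder_cases) auto
    qed
    then show ?thesis using eq[of j] that(1) assms(6) by simp
  qed
  have "C $$ (i, j) = 0" if "j < i" for j
    using that
  proof (induction j rule: less_induct)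
    case (less j)
    then have "C $$ (i, j) * B $$ (j, j) = 0" using reduce[of j] by simp
    then show ?case using nz[of j] less.prems assms(6) by simp
  qed
  then have "C $$ (i, i) * B $$ (i, i) = 1" using reduce[of i] by simp
  then show ?thesis using nz[OF assms(6)] by (simp add: field_simps)
qed

lemma psd_eigenvalue_nonneg:
  assumes "psd P A" and "eigenvalue (to_mat P A) e"
  shows "e = of_real (Re e)" "0 \<le> Re e"
proof -
  let ?A = "to_mat P A"
  obtain v where v: "v \<in> carrier_vec P" "v \<noteq> 0\<^sub>v P" "?A *\<^sub>v v = e \<cdot>\<^sub>v v"
    using assms(2) unfolding eigenvalue_def eigenvector_def by auto
  have *: "(\<Sum>j<P. A i j * v $ j) = e * v $ i" if "i < P" for i
  proof -
    have "(?A *\<^sub>v v) $ i = (\<Sum>j<P. A i j * v $ j)"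
      using v(1) that by (simp add: scalar_prod_def atLeast0LessThan)
    then show ?thesis using v that by simp
  qed
  define n where "n = (\<Sum>i<P. (cmod (v $ i))^2)"
  have "quad_form P A (($) v) = (\<Sum>i<P. cnj (v $ i) * (\<Sum>j<P. A i j * v $ j))"
    by (simp add: quad_form_def sum_distrib_left mult.assoc)
  also have "\<dots> = (\<Sum>i<P. e * (v $ i * cnj (v $ i)))"
    using * by (intro sum.cong refl) (simp add: mult_ac)
  also have "\<dots> = e * of_real n"
    unfolding n_def of_real_sum complex_norm_square sum_distrib_left ..
  finally have q: "quad_form P A (($) v) = e * of_real n" .
  have "n \<noteq> 0"
  proof
    assume "n = 0"
    then have "v $ i = 0" if "i < P" for i using that unfolding n_def by (simp add: sum_nonneg_eq_0_iff)
    then have "v = 0\<^sub>v P" using v(1) by (intro eq_vecI) auto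
    with v(2) show False by simp
  qed
  then have "n > 0" unfolding n_def by (simp add: order_less_le sum_nonneg)
  then show "0 \<le> Re e" using psd_quad_form[OF assms(1), of "($) v"] by (simp add: q zero_le_mult_iff)
  have "Im e = 0" using quad_form_real[OF assms(1), of "($) v"] \<open>n > 0\<close> by (simp add: q)
  then show "e = of_real (Re e)" by (simp add: complex_eq_iff)
qed

text \<open>One list has to serve several purposes at once. The characteristic polynomial is
  demanded for all multiples \<open>k\<close> because \<open>eigval\<close> is defined through it
  and the density matrix is a random multiple of \<open>A\<close>.\<close>

definition eigenvalue_list :: "nat \<Rightarrow> (nat \<Rightarrow> nat \<Rightarrow> complex) \<Rightarrow> real list \<Rightarrow> bool" where
  "eigenvalue_list P A es \<longleftrightarrow> length es = P \<and> (\<forall>e\<in>set es. 0 \<le> e) \<and>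
    (\<forall>k. char_poly (k \<cdot>\<^sub>m to_mat P A) = (\<Prod>e\<leftarrow>es. [:- (k * of_real e), 1:])) \<and>
    (\<forall>s>0. res_trace P A s = (\<Sum>e\<leftarrow>es. 1 / (e + s))) \<and>
    (\<Sum>i<P. A i i) = of_real (\<Sum>e\<leftarrow>es. e) \<and> frobenius P A = (\<Sum>e\<leftarrow>es. e^2)"

lemma eigenvalue_listD:
  assumes "eigenvalue_list P A es"
  shows "length es = P" "\<And>e. e \<in> set es \<Longrightarrow> 0 \<le> e"
    "\<And>k. char_poly (k \<cdot>\<^sub>m to_mat P A) = (\<Prod>e\<leftarrow>es. [:- (k * of_real e), 1:])"
    "\<And>s. 0 < s \<Longrightarrow> res_trace P A s = (\<Sum>e\<leftarrow>es. 1 / (e + s))"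
    "(\<Sum>i<P. A i i) = of_real (\<Sum>e\<leftarrow>es. e)"
    "frobenius P A = (\<Sum>e\<leftarrow>es. e^2)"
  using assms unfolding eigenvalue_list_def by blast+

text \<open>A Schur form is enough, without diagonalisation: the characteristic polynomial and the
  traces of \<open>A\<close>, of its square and of its resolvent are all determined by the diagonal
  of the triangular factor \<open>B\<close>.\<close>

lemma psd_spectrum:
  assumes "psd P A"
  shows "\<exists>es. eigenvalue_list P A es"
proof -
  let ?A = "to_mat P A"
  have A: "?A \<in> carrier_mat P P" by simp
  obtain as where as: "char_poly ?A = (\<Prod>a\<leftarrow>as. [:- a, 1:])" "length as = P"
    using char_poly_factorized[OF A] by blast
  obtain B U V where "schur_decomposition ?A as = (B, U, V)"
    by (cases "schur_decomposition ?A as") auto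
  then have sim: "similar_mat_wit ?A B U V" and ut: "upper_triangular B" and dg: "diag_mat B = as"
    using schur_decomposition[OF A as(1)] by blast+
  note w = similar_mat_witD2[OF A sim]
  define es where "es = map Re as"
  have real: "a = of_real (Re a)" "0 \<le> Re a" if "a \<in> set as" for a
  proof -
    have "poly (char_poly ?A) a = 0" using that by (auto simp: as(1) poly_prod_list prod_list_zero_iff)
    then have "eigenvalue ?A a" using eigenvalue_root_char_poly[OF A] by simp
    from psd_eigenvalue_nonneg[OF assms this] show "a = of_real (Re a)" "0 \<le> Re a" by auto
  qed
  have as_eq: "as = map of_real es"
    unfolding es_def map_map by (rule map_idI[symmetric]) (simp add: real(1)[symmetric])
  have len: "length es = P" using as(2) by (simp add: es_def)
  have Bii: "B $$ (i, i) = of_real (es ! i)" if "i < P" for i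
  proof -
    have "diag_mat B ! i = B $$ (i, i)" using w(5) that by (simp add: diag_mat_def)
    then show ?thesis using that len by (simp add: dg as_eq)
  qed
  have sum_es: "(\<Sum>i<P. f (es ! i)) = (\<Sum>e\<leftarrow>es. f e)" for f :: "real \<Rightarrow> real"
    using len by (simp add: sum_list_sum_nth atLeast0LessThan)
  have nonneg: "0 \<le> e" if "e \<in> set es" for e using that real(2) by (auto simp: es_def)
  have cp: "char_poly (k \<cdot>\<^sub>m ?A) = (\<Prod>e\<leftarrow>es. [:- (k * of_real e), 1:])" for k
  proof -
    have "similar_mat_wit (k \<cdot>\<^sub>m ?A) (k \<cdot>\<^sub>m B) U V"
      by (rule similar_mat_wit_smult[OF sim])
    then have "char_poly (k \<cdot>\<^sub>m ?A) = char_poly (k \<cdot>\<^sub>m B)"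
      by (intro char_poly_similar) (auto simp: similar_mat_def)
    also have "\<dots> = (\<Prod>a\<leftarrow>diag_mat (k \<cdot>\<^sub>m B). [:- a, 1:])"
    proof (rule char_poly_upper_triangular)
      show "k \<cdot>\<^sub>m B \<in> carrier_mat P P" using w(5) by simp
      show "upper_triangular (k \<cdot>\<^sub>m B)"
        using w(5) upper_triangularD[OF ut] by (intro upper_triangularI) auto
    qed
    also have "diag_mat (k \<cdot>\<^sub>m B) = map (\<lambda>e. k * of_real e) es"
      using w(5) len by (auto simp: diag_mat_def Bii intro!: nth_equalityI)
    finally show ?thesis by (simp add: o_def)
  qed
  have tr1: "(\<Sum>i<P. A i i) = of_real (\<Sum>e\<leftarrow>es. e)"
  proof -
    have "mat_trace ?A = (\<Sum>i<P. B $$ (i, i))"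
      using mat_trace_similar[OF sim] w(5) by (simp add: mat_trace_def)
    then show ?thesis unfolding sum_es[of "\<lambda>e. e", symmetric] by (simp add: mat_trace_def Bii)
  qed
  \<comment> \<open>Both sides equal \<open>Tr A^2\<close>: on the left because \<open>A\<close> is
    Hermitian, on the right because the square of a triangular matrix has the squared
    diagonal.\<close>
  have tr2: "frobenius P A = (\<Sum>e\<leftarrow>es. e^2)"
  proof -
    have sq: "C ^\<^sub>m 2 = C * C" if "C \<in> carrier_mat P P" for C :: "complex mat"
      using that by (simp add: numeral_2_eq_2)
    have "similar_mat_wit (?A * ?A) (B * B) U V"
      using similar_mat_wit_pow[OF sim, of 2] unfolding sq[OF A] sq[OF w(5)] .
    then have "mat_trace (?A * ?A) = mat_trace (B * B)" by (rule mat_trace_similar)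
    also have "\<dots> = (\<Sum>i<P. \<Sum>j<P. B $$ (i, j) * B $$ (j, i))"
      using w(5) by (simp add: mat_trace_def scalar_prod_def atLeast0LessThan)
    also have "\<dots> = (\<Sum>i<P. \<Sum>j<P. if j = i then B $$ (i, i) * B $$ (i, i) else 0)"
    proof (intro sum.cong refl)
      fix i j assume "i \<in> {..<P}" "j \<in> {..<P}"
      then show "B $$ (i, j) * B $$ (j, i) = (if j = i then B $$ (i, i) * B $$ (i, i) else 0)"
        using upper_triangularD[OF ut, of i j] upper_triangularD[OF ut, of j i] w(5)
        by (cases i j rule: linorder_cases) auto
    qed
    also have "\<dots> = of_real (\<Sum>e\<leftarrow>es. e^2)"
      unfolding sum_es[of "\<lambda>e. e^2", symmetric] by (simp add: Bii power2_eq_square)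
    finally have "mat_trace (?A * ?A) = of_real (\<Sum>e\<leftarrow>es. e^2)" .
    moreover have "mat_trace (?A * ?A) = (\<Sum>i<P. \<Sum>j<P. A i j * A j i)"
      by (simp add: mat_trace_def scalar_prod_def atLeast0LessThan)
    moreover have "(\<Sum>i<P. \<Sum>j<P. A i j * A j i) = of_real (frobenius P A)"
      unfolding of_real_sum complex_norm_square
      using psdD[OF assms] by (intro sum.cong refl) (metis lessThan_iff)
    ultimately have "of_real (frobenius P A) = complex_of_real (\<Sum>e\<leftarrow>es. e^2)" by metis
    then show ?thesis
      unfolding of_real_eq_iff .
  qed
  \<comment> \<open>Conjugation by the Schur basis turns \<open>A + s\<close> into the triangular
    matrix \<open>B + s\<close> and the resolvent into a left inverse \<open>C\<close> of it with
    the same trace.\<close>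
  have res: "res_trace P A s = (\<Sum>e\<leftarrow>es. 1 / (e + s))" if s: "0 < s" for s
  proof -
    let ?K = "shift_mat P A s"
    define R where "R = to_mat P (resolvent P A s)"
    define B' where "B' = V * ?K * U"
    define C where "C = V * R * U"
    have K: "?K \<in> carrier_mat P P" and R: "R \<in> carrier_mat P P" by (simp_all add: shift_mat_def R_def)
    have "?K = ?A + of_real s \<cdot>\<^sub>m 1\<^sub>m P"
      by (intro eq_matI) (auto simp: shift_mat_def shifted_def)
    then have "B' = V * (U * B * V + of_real s \<cdot>\<^sub>m 1\<^sub>m P) * U"
      unfolding B'_def using w(3) by (simp only:)
    also have "\<dots> = V * (U * B * V) * U + V * (of_real s \<cdot>\<^sub>m 1\<^sub>m P) * U"
      using w(5-7) by (subst mult_add_distrib_mat[of V P P _ P], auto intro!: add_mult_distrib_mat[of _ P P _ _ P])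
    also have "V * (U * B * V) * U = (V * U) * B * (V * U)"
      using w(5-7) by (simp add: assoc_mult_mat[of _ P P _ P _ P])
    also have "\<dots> = B" using w(2,5) by simp
    also have "V * (of_real s \<cdot>\<^sub>m 1\<^sub>m P) * U = of_real s \<cdot>\<^sub>m (V * U)"
      using w(5-7) by (simp add: mult_smult_distrib[of _ P P _ P] mult_smult_assoc_mat[of _ P P _ P])
    finally have B': "B' = B + of_real s \<cdot>\<^sub>m 1\<^sub>m P" using w(2) by simp
    have RK: "R * ?K = 1\<^sub>m P" by (intro eq_matI)
        (auto simp: R_def shift_mat_def scalar_prod_def atLeast0LessThan resolvent_left[OF assms s])
    have "C * B' = V * R * (U * V) * ?K * U"
      unfolding C_def B'_def using w(6,7) K R by (simp add: assoc_mult_mat[of _ P P _ P _ P])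
    also have "\<dots> = V * (R * ?K) * U" using w(1,6,7) K R by (simp add: assoc_mult_mat[of _ P P _ P _ P])
    also have "\<dots> = 1\<^sub>m P" using w(2,6,7) by (simp add: RK)
    finally have CB: "C * B' = 1\<^sub>m P" .
    have Cii: "C $$ (i, i) = of_real (1 / (es ! i + s))" if "i < P" for i
    proof -
      have B'ii: "B' $$ (i, i) = of_real (es ! i + s)" if "i < P" for i using that w(5) by (simp add: B' Bii)
      have "es ! i + s \<noteq> 0" if "i < P" for i
        using nonneg[of "es ! i"] that len s by (simp add: add_nonneg_pos order_less_imp_not_eq2)
      moreover have "upper_triangular B'"
        using w(5) upper_triangularD[OF ut] by (intro upper_triangularI) (auto simp: B')
      moreover have "B' \<in> carrier_mat P P" "C \<in> carrier_mat P P"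
        using w(5-7) R by (auto simp: B' C_def)
      ultimately have "C $$ (i, i) = 1 / B' $$ (i, i)"
        using CB that by (intro upper_triangular_left_inverse[of B' P C]) (auto simp: B'ii simp del: of_real_add)
      then show ?thesis by (simp add: B'ii[OF that])
    qed
    have "mat_trace R = mat_trace ((U * V) * R)" using w(1) R by simp
    also have "\<dots> = mat_trace (U * (V * R))"
      using w(6,7) R by (simp add: assoc_mult_mat[of _ P P _ P _ P])
    also have "\<dots> = mat_trace C"
      unfolding C_def using w(6,7) R by (intro mat_trace_mult_commute[of _ P]) auto
    also have "\<dots> = (\<Sum>i<P. of_real (1 / (es ! i + s)))"
    proof -
      have "dim_row C = P" using w(7) by (simp add: C_def)
      then show ?thesis by (simp add: mat_trace_def Cii)
    qed
    also have "\<dots> = of_real (\<Sum>e\<leftarrow>es. 1 / (e + s))"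
      unfolding sum_es[of "\<lambda>e. 1 / (e + s)", symmetric] by simp
    finally have "mat_trace R = of_real (\<Sum>e\<leftarrow>es. 1 / (e + s))" .
    moreover have "mat_trace R = of_real (res_trace P A s)"
      unfolding res_trace_complex[OF assms s, symmetric] by (simp add: mat_trace_def R_def)
    ultimately show ?thesis by (simp only: of_real_eq_iff)
  qed
  show ?thesis unfolding eigenvalue_list_def using len nonneg cp res tr1 tr2 by blast
qed

lemma proots_linear_factors:
  fixes f :: "'b \<Rightarrow> 'a::idom"
  shows "proots (\<Prod>e\<leftarrow>es. [:- f e, 1:]) = image_mset f (mset es)"
proof (induction es)
  case (Cons a es)
  have "(\<Prod>e\<leftarrow>es. [:- f e, 1:]) \<noteq> 0" by (auto simp: prod_list_zero_iff)
  then have "proots ([:- f a, 1:] * (\<Prod>e\<leftarrow>es. [:- f e, 1:])) = add_mset (f a) (image_mset f (mset es))"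
    by (subst proots_mult) (simp_all add: Cons.IH)
  then show ?case by simp
qed simp

text \<open>The sorting inside \<open>eigval\<close> is invisible to a symmetric sum, so any
  enumeration of the roots can be used instead.\<close>

lemma sum_eigval:
  assumes "A \<in> carrier_mat P P" "length es = P"
    and "char_poly A = (\<Prod>e\<leftarrow>es. [:- of_real (f e), 1:])"
  shows "(\<Sum>j = 1..P. g (eigval A j)) = (\<Sum>e\<leftarrow>es. g (f e))"
proof -
  define xs where "xs = rev (sorted_list_of_multiset (image_mset Re (proots (char_poly A))))"
  have xs: "mset xs = image_mset f (mset es)"
    unfolding xs_def assms(3) proots_linear_factors by (simp add: image_mset.compositionality o_def)
  then have "length xs = P" using assms(2) by (metis size_image_mset size_mset)
  have "(\<Sum>j = 1..P. g (eigval A j)) = (\<Sum>j<P. g (xs ! j))"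
    by (rule sum.reindex_bij_witness[of _ Suc "\<lambda>j. j - 1"]) (auto simp: eigval_def xs_def)
  also have "\<dots> = sum_list (map g xs)"
    using \<open>length xs = P\<close> by (simp add: sum_list_sum_nth atLeast0LessThan)
  also have "\<dots> = sum_mset (image_mset g (mset xs))" by (simp flip: sum_mset_sum_list)
  also have "\<dots> = (\<Sum>e\<leftarrow>es. g (f e))"
    unfolding xs by (simp add: image_mset.compositionality o_def flip: sum_mset_sum_list)
  finally show ?thesis .
qed

section \<open>The Marchenko--Pastur integral\<close>

text \<open>The antiderivatives used below contain arcsin terms, for which differentiability is
  checked only inside the interval; continuity up to the ends suffices, and the sign of
  \<open>f\<close> provides integrability.\<close>

lemma FTC_open_interval:
  fixes F f :: "real \<Rightarrow> real"
  assumes "a < b" "continuous_on {a..b} F"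
    and "\<And>x. a < x \<Longrightarrow> x < b \<Longrightarrow> (F has_real_derivative f x) (at x)"
    and "\<And>x. a < x \<Longrightarrow> x < b \<Longrightarrow> isCont f x"
    and "\<And>x. a < x \<Longrightarrow> x < b \<Longrightarrow> 0 \<le> f x"
  shows "set_integrable lborel {a<..<b} f" and "(LBINT x:{a<..<b}. f x) = F b - F a"
proof -
  have "(F \<longlongrightarrow> F a) (at_right a)" "(F \<longlongrightarrow> F b) (at_left b)"
    using assms(1,2) by (auto simp: continuous_on_Icc_at_rightD continuous_on_Icc_at_leftD)
  then have lim: "((F \<circ> real_of_ereal) \<longlongrightarrow> F a) (at_right (ereal a))"
      "((F \<circ> real_of_ereal) \<longlongrightarrow> F b) (at_left (ereal b))"
    by (simp_all add: ereal_tendsto_simps)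
  have nn: "AE x in lborel. ereal a < ereal x \<longrightarrow> ereal x < ereal b \<longrightarrow> 0 \<le> f x"
    using assms(5) by simp
  have e: "einterval (ereal a) (ereal b) = {a<..<b}" by (auto simp: einterval_def)
  have ab: "ereal a < ereal b" using assms(1) by simp
  note ftc = interval_integral_FTC_nonneg[of "ereal a" "ereal b" F f, OF ab _ _ nn lim]
  show "set_integrable lborel {a<..<b} f" using ftc(1) assms(3,4) by (simp add: e)
  show "(LBINT x:{a<..<b}. f x) = F b - F a"
    using ftc(2) assms(1,3,4) by (simp add: interval_lebesgue_integral_def e)
qed

lemma FTC_half_line:
  fixes F f :: "real \<Rightarrow> real"
  assumes "(F \<longlongrightarrow> A) (at_right 0)" "(F \<longlongrightarrow> B) at_top"
    and "\<And>x. 0 < x \<Longrightarrow> (F has_real_derivative f x) (at x)"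
    and "\<And>x. 0 < x \<Longrightarrow> isCont f x"
    and "\<And>x. 0 < x \<Longrightarrow> 0 \<le> f x"
  shows "set_integrable lborel {0<..} f" and "(LBINT x:{0<..}. f x) = B - A"
proof -
  have lim: "((F \<circ> real_of_ereal) \<longlongrightarrow> A) (at_right (ereal 0))"
      "((F \<circ> real_of_ereal) \<longlongrightarrow> B) (at_left \<infinity>)"
    using assms(1,2) by (simp_all only: ereal_tendsto_simps)
  have nn: "AE x in lborel. ereal 0 < ereal x \<longrightarrow> ereal x < \<infinity> \<longrightarrow> 0 \<le> f x"
    using assms(5) by simp
  have e: "einterval (ereal 0) \<infinity> = {0<..}" by (auto simp: einterval_def)
  have ab: "ereal 0 < \<infinity>" by simp
  note ftc = interval_integral_FTC_nonneg[of "ereal 0" \<infinity> F f, OF ab _ _ nn lim]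
  show "set_integrable lborel {0<..} f" using ftc(1) assms(3,4) by (simp add: e)
  show "(LBINT x:{0<..}. f x) = B - A" using ftc(2) assms(3,4) by (simp add: interval_lebesgue_integral_def e)
qed

lemma ln_integral:
  fixes x :: real
  assumes "0 < x"
  shows "set_integrable lborel {0<..} (\<lambda>t. 1 / (1 + t) - 1 / (x + t))"
    and "(LBINT t:{0<..}. 1 / (1 + t) - 1 / (x + t)) = ln x"
    and "(LBINT t:{0<..}. \<bar>1 / (1 + t) - 1 / (x + t)\<bar>) = \<bar>ln x\<bar>"
proof -
  \<comment> \<open>The integrand has the constant sign of \<open>x - 1\<close>. Multiplied by
    \<open>\<sigma>\<close> it becomes nonnegative, which yields integrability and also the integral
    of its absolute value that Fubini requires.\<close>
  define \<sigma> :: real where "\<sigma> = (if 1 \<le> x then 1 else -1)"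
  have \<sigma>: "\<sigma> * (\<sigma> * y) = y" "\<sigma> * ln x = \<bar>ln x\<bar>" for y
    using assms by (auto simp: \<sigma>_def)
  let ?F = "\<lambda>t. ln (1 + t) - ln (x + t)" and ?f = "\<lambda>t. 1 / (1 + t) - 1 / (x + t)"
  have "(?F \<longlongrightarrow> - ln x) (at_right 0)" using assms by (auto intro!: tendsto_eq_intros)
  then have lim0: "((\<lambda>t. \<sigma> * ?F t) \<longlongrightarrow> \<sigma> * - ln x) (at_right 0)"
    by (rule tendsto_mult_left)
  have "(?F \<longlongrightarrow> 0) at_top" by real_asymp
  then have lim1: "((\<lambda>t. \<sigma> * ?F t) \<longlongrightarrow> 0) at_top"
    by (rule tendsto_mult_right_zero)
  have d: "((\<lambda>t. \<sigma> * ?F t) has_real_derivative \<sigma> * ?f t) (at t)" if "0 < t" for t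
    using that assms by (intro DERIV_cmult) (auto intro!: derivative_eq_intros)
  have c: "isCont (\<lambda>t. \<sigma> * ?f t) t" if "0 < t" for t
    using that assms by (auto intro!: continuous_intros)
  have nn: "0 \<le> \<sigma> * ?f t" if "0 < t" for t using that assms by (auto simp: \<sigma>_def frac_le)
  note ftc = FTC_half_line[OF lim0 lim1 d c nn]
  have "(LBINT t:{0<..}. \<sigma> * ?f t) = 0 - \<sigma> * - ln x" by (rule ftc(2))
  then have val: "(LBINT t:{0<..}. \<sigma> * ?f t) = \<sigma> * ln x"
    by (simp only: mult_minus_right diff_minus_eq_add add_0)
  have "\<bar>?f t\<bar> = \<sigma> * ?f t" if "0 < t" for t
    using nn[OF that] by (auto simp: \<sigma>_def split: if_splits)
  then have "(LBINT t:{0<..}. \<bar>?f t\<bar>) = (LBINT t:{0<..}. \<sigma> * ?f t)"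
    by (intro set_lebesgue_integral_cong) auto
  then show "(LBINT t:{0<..}. \<bar>?f t\<bar>) = \<bar>ln x\<bar>"
    unfolding val \<sigma> .
  have "set_integrable lborel {0<..} (\<lambda>t. \<sigma> * (\<sigma> * ?f t))"
    by (intro set_integrable_mult_right ftc(1))
  then show "set_integrable lborel {0<..} ?f"
    unfolding \<sigma>(1) .
  have "(LBINT t:{0<..}. \<sigma> * (\<sigma> * ?f t)) = \<sigma> * (LBINT t:{0<..}. \<sigma> * ?f t)"
    by (rule set_integral_mult_right)
  then show "(LBINT t:{0<..}. ?f t) = ln x"
    unfolding val \<sigma>(1) .
qed

lemma integral_inverse_square:
  "set_integrable lborel {0<..} (\<lambda>t::real. 1 / (1 + t)^2)"
proof (rule FTC_half_line(1))
  show "((\<lambda>t::real. - 1 / (1 + t)) \<longlongrightarrow> -1) (at_right 0)"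
    by (auto intro!: tendsto_eq_intros)
  show "((\<lambda>t::real. - 1 / (1 + t)) \<longlongrightarrow> 0) at_top" by real_asymp
qed (auto intro!: derivative_eq_intros continuous_intros simp: power2_eq_square)

section \<open>Integrals against the half circle over an interval\<close>

definition semicircle :: "real \<Rightarrow> real \<Rightarrow> real \<Rightarrow> real" where
  "semicircle a b x = sqrt ((b - x) * (x - a))"

lemma DERIV_arcsin_comp:
  assumes "(f has_real_derivative f') (at x)" "\<bar>f x\<bar> < 1"
  shows "((\<lambda>x. arcsin (f x)) has_real_derivative f' / sqrt (1 - (f x)^2)) (at x)"
  using DERIV_chain2[OF DERIV_arcsin assms(1)] assms(2) by (simp add: field_simps abs_less_iff)

lemma semicircle_pos: "a < x \<Longrightarrow> x < b \<Longrightarrow> 0 < semicircle a b x"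
  by (simp add: semicircle_def)

lemma DERIV_semicircle:
  assumes "a < x" "x < b"
  shows "(semicircle a b has_real_derivative ((a + b) / 2 - x) / semicircle a b x) (at x)"
proof -
  have pos: "0 < (b - x) * (x - a)" using assms by simp
  have "((\<lambda>x. (b - x) * (x - a)) has_real_derivative (a + b - 2 * x)) (at x)"
    by (auto intro!: derivative_eq_intros)
  from DERIV_chain2[OF DERIV_real_sqrt[OF pos] this]
  have "((\<lambda>x. sqrt ((b - x) * (x - a))) has_real_derivative ((a + b) / 2 - x) / sqrt ((b - x) * (x - a))) (at x)"
    by (simp add: field_simps)
  then show ?thesis unfolding semicircle_def by simp
qed

lemma semicircle_sq:
  assumes "a < x" "x < b"
  shows "(semicircle a b x)^2 = (b - x) * (x - a)"
  using assms by (simp add: semicircle_def)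

lemma DERIV_arcsin_affine:
  assumes "a < x" "x < b"
  shows "((\<lambda>x. arcsin ((x - (a + b) / 2) / ((b - a) / 2))) has_real_derivative 1 / semicircle a b x) (at x)"
proof -
  define m r where "m = (a + b) / 2" and "r = (b - a) / 2"
  have r: "0 < r" using assms by (simp add: r_def)
  let ?w = "semicircle a b"
  have "(?w x)^2 = r^2 - (x - m)^2"
    unfolding semicircle_sq[OF assms] by (simp add: r_def m_def power2_eq_square field_simps)
  then have "1 - ((x - m) / r)^2 = (?w x / r)^2" using r by (simp add: power_divide field_simps)
  then have "sqrt (1 - ((x - m) / r)^2) = ?w x / r" using semicircle_pos[OF assms] r by simp
  moreover have "\<bar>(x - m) / r\<bar> < 1" using assms by (auto simp: m_def r_def field_simps abs_less_iff)
  moreover have "((\<lambda>x. (x - m) / r) has_real_derivative 1 / r) (at x)"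
    using r by (auto intro!: derivative_eq_intros)
  ultimately have "((\<lambda>x. arcsin ((x - m) / r)) has_real_derivative (1 / r) / (?w x / r)) (at x)"
    using DERIV_arcsin_comp by metis
  also have "(1 / r) / (?w x / r) = 1 / ?w x" using r by simp
  finally show ?thesis
    unfolding m_def r_def .
qed

lemma continuous_semicircle: "continuous_on S (semicircle a b)"
  unfolding semicircle_def by (intro continuous_intros)

text \<open>Geometrically the area of a half disc of radius \<open>(b - a) / 2\<close>.\<close>

lemma integral_semicircle:
  assumes "a < b"
  shows "(LBINT x:{a<..<b}. semicircle a b x) = pi * (b - a)^2 / 8"
    and "set_integrable lborel {a<..<b} (semicircle a b)"
proof -
  define m r where "m = (a + b) / 2" and "r = (b - a) / 2"
  have r: "0 < r" using assms by (simp add: r_def)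
  let ?w = "semicircle a b"
  let ?F = "\<lambda>x. ((x - m) * ?w x + r^2 * arcsin ((x - m) / r)) / 2"
  have bd: "-1 \<le> (x - m) / r \<and> (x - m) / r \<le> 1" if "x \<in> {a..b}" for x
    using that assms by (auto simp: m_def r_def field_simps)
  have cont: "continuous_on {a..b} ?F" using bd r by (intro continuous_intros continuous_semicircle) auto
  have d: "(?F has_real_derivative ?w x) (at x)" if x: "a < x" "x < b" for x
  proof -
    have w: "0 < ?w x" using semicircle_pos[OF x] .
    have w2: "(?w x)^2 = r^2 - (x - m)^2"
      unfolding semicircle_sq[OF x] by (simp add: r_def m_def power2_eq_square field_simps)
    have das: "((\<lambda>x. arcsin ((x - m) / r)) has_real_derivative 1 / ?w x) (at x)"
      unfolding m_def r_def by (rule DERIV_arcsin_affine[OF x])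
    have dw: "(?w has_real_derivative (m - x) / ?w x) (at x)"
      using DERIV_semicircle[OF x] by (simp add: m_def)
    have "((\<lambda>x. (x - m) * ?w x + r^2 * arcsin ((x - m) / r)) has_real_derivative
        (?w x + (x - m) * ((m - x) / ?w x)) + r^2 * (1 / ?w x)) (at x)"
      by (rule das dw derivative_eq_intros refl)+ (simp add: mult.commute)
    from DERIV_cdivide[OF this, of 2]
    have "(?F has_real_derivative ((?w x + (x - m) * ((m - x) / ?w x)) + r^2 * (1 / ?w x)) / 2) (at x)" .
    also have "((?w x + (x - m) * ((m - x) / ?w x)) + r^2 * (1 / ?w x)) / 2 = ?w x"
    proof -
      have "(x - m) * ((m - x) / ?w x) + r^2 * (1 / ?w x) = ((x - m) * (m - x) + r^2) / ?w x"
        by (simp add: add_divide_distrib)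
      also have "(x - m) * (m - x) + r^2 = (?w x)^2"
        unfolding w2 by (simp add: power2_eq_square algebra_simps)
      finally have "(x - m) * ((m - x) / ?w x) + r^2 * (1 / ?w x) = (?w x)^2 / ?w x" .
      then show ?thesis using w by (simp add: power2_eq_square)
    qed
    finally show ?thesis .
  qed
  have c: "isCont ?w x" for x
    using continuous_semicircle[of UNIV a b] by (simp add: continuous_on_eq_continuous_at)
  have nn: "0 \<le> ?w x" if "a < x" "x < b" for x using semicircle_pos[OF that] by simp
  note ftc = FTC_open_interval[OF assms cont d c nn]
  show "set_integrable lborel {a<..<b} ?w" by (rule ftc(1))
  have "(b - m) / r = 1" "(a - m) / r = -1" using assms by (auto simp: m_def r_def field_simps)
  then have "(LBINT x:{a<..<b}. ?w x) = pi * r^2 / 2" using ftc(2) by (simp add: semicircle_def)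
  then show "(LBINT x:{a<..<b}. ?w x) = pi * (b - a)^2 / 8" by (simp add: r_def power2_eq_square)
qed

text \<open>Write \<open>w\<close> for the half circle. Division with remainder of
  \<open>w^2\<close> by \<open>x + t\<close> gives
  \<open>w / (x + t) = ((m - x) + (m + t)) / w - A / ((x + t) w)\<close>, with \<open>m\<close> the
  midpoint and \<open>A = (a + t) (b + t)\<close>. The three terms are the derivatives of
  \<open>w\<close>, of an arcsin in \<open>x\<close>, and of an arcsin of a fractional linear
  function of \<open>x\<close>.\<close>

lemma integral_semicircle_resolvent:
  assumes "a < b" "0 < a + t"
  shows "(LBINT x:{a<..<b}. semicircle a b x / (x + t)) = pi * ((a + b) / 2 + t - sqrt ((a + t) * (b + t)))"
    and "set_integrable lborel {a<..<b} (\<lambda>x. semicircle a b x / (x + t))"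
proof -
  define m r where "m = (a + b) / 2" and "r = (b - a) / 2"
  define A where "A = (a + t) * (b + t)"
  have r: "0 < r" using assms by (simp add: r_def)
  have A: "0 < A" using assms by (simp add: A_def)
  let ?w = "semicircle a b"
  \<comment> \<open>The fractional linear map with pole at \<open>-t\<close> that sends
    \<open>a\<close> to -1 and \<open>b\<close> to 1.\<close>
  let ?g = "\<lambda>x. ((m + t) - A / (x + t)) / r"
  let ?F = "\<lambda>x. ?w x + (m + t) * arcsin ((x - m) / r) - sqrt A * arcsin (?g x)"
  have bd: "-1 \<le> (x - m) / r \<and> (x - m) / r \<le> 1" if "x \<in> {a..b}" for x
    using that assms by (auto simp: m_def r_def field_simps)
  have g2: "1 - (?g x)^2 = A * (b - x) * (x - a) / (r^2 * (x + t)^2)" if "0 < x + t" for x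
  proof -
    have "r^2 = (m + t)^2 - A" by (simp add: r_def m_def A_def power2_eq_square field_simps)
    then have "(r * (x + t))^2 - ((m + t) * (x + t) - A)^2 = A * (2 * (m + t) * (x + t) - (x + t)^2 - A)"
      by (simp add: power_mult_distrib) (simp add: power2_eq_square algebra_simps)
    also have "2 * (m + t) * (x + t) - (x + t)^2 - A = (b - x) * (x - a)"
      by (simp add: m_def A_def power2_eq_square field_simps)
    finally have *: "(r * (x + t))^2 - ((m + t) * (x + t) - A)^2 = A * ((b - x) * (x - a))" .
    have g: "?g x = ((m + t) * (x + t) - A) / (r * (x + t))" using that r by (simp add: field_simps)
    have "1 - (?g x)^2 = ((r * (x + t))^2 - ((m + t) * (x + t) - A)^2) / (r * (x + t))^2"
      unfolding g power_divide using that r by (simp add: diff_divide_distrib)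
    then show ?thesis unfolding * by (simp add: power_mult_distrib)
  qed
  have bd2: "-1 \<le> ?g x \<and> ?g x \<le> 1" if "x \<in> {a..b}" for x
  proof -
    have "0 \<le> 1 - (?g x)^2" using that assms A g2[of x] by simp
    then have "(?g x)^2 \<le> 1" by linarith
    then have "\<bar>?g x\<bar> \<le> 1" by (simp only: abs_square_le_1)
    then show ?thesis by (auto simp only: abs_le_iff)
  qed
  have cont: "continuous_on {a..b} ?F"
    using bd bd2 r assms by (intro continuous_intros continuous_semicircle) auto
  have d: "(?F has_real_derivative ?w x / (x + t)) (at x)" if x: "a < x" "x < b" for x
  proof -
    have xt: "0 < x + t" using x assms by simp
    have w: "0 < ?w x" using semicircle_pos[OF x] .
    note w2 = semicircle_sq[OF x]
    have das: "((\<lambda>x. arcsin ((x - m) / r)) has_real_derivative 1 / ?w x) (at x)"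
      unfolding m_def r_def by (rule DERIV_arcsin_affine[OF x])
    have g2': "1 - (?g x)^2 = (sqrt A * ?w x / (r * (x + t)))^2"
      unfolding g2[OF xt] using A by (simp add: power_divide power_mult_distrib w2)
    have "0 < 1 - (?g x)^2" unfolding g2[OF xt] using A x r xt by simp
    then have "\<bar>?g x\<bar> < 1" by (simp add: abs_square_less_1)
    moreover have "(?g has_real_derivative A / (r * (x + t)^2)) (at x)"
      using r xt by (auto intro!: derivative_eq_intros simp: power2_eq_square)
    ultimately have "((\<lambda>x. arcsin (?g x)) has_real_derivative (A / (r * (x + t)^2)) / sqrt (1 - (?g x)^2)) (at x)"
      using DERIV_arcsin_comp by blast
    also have "sqrt (1 - (?g x)^2) = sqrt A * ?w x / (r * (x + t))" unfolding g2' using A w r xt by simp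
    also have "A / (r * (x + t)^2) / (sqrt A * ?w x / (r * (x + t))) = sqrt A / ((x + t) * ?w x)"
    proof -
      have "s * s / (r * y^2) / (s * v / (r * y)) = s / (y * v)" if "0 < s" "0 < v" "0 < y" for s v y
        using that r by (simp add: field_simps power2_eq_square)
      from this[of "sqrt A" "?w x" "x + t"] show ?thesis
        using A w xt by simp
    qed
    finally have dag: "((\<lambda>x. arcsin (?g x)) has_real_derivative sqrt A / ((x + t) * ?w x)) (at x)" .
    have dw: "(?w has_real_derivative (m - x) / ?w x) (at x)"
      using DERIV_semicircle[OF x] by (simp add: m_def)
    have "(?F has_real_derivative ((m - x) / ?w x + (m + t) * (1 / ?w x) - sqrt A * (sqrt A / ((x + t) * ?w x)))) (at x)"
      by (rule das dw dag derivative_eq_intros refl)+ (simp add: algebra_simps)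
    also have "(m - x) / ?w x + (m + t) * (1 / ?w x) - sqrt A * (sqrt A / ((x + t) * ?w x)) = ?w x / (x + t)"
    proof -
      have "(m - x) / ?w x + (m + t) * (1 / ?w x) - sqrt A * (sqrt A / ((x + t) * ?w x)) =
          ((2 * m + t - x) * (x + t) - A) / ((x + t) * ?w x)"
      proof -
        have "p / v + q * (1 / v) - s * (s / (y * v)) = ((p + q) * y - s * s) / (y * v)"
          if "0 < y" "0 < v" for p q s v y :: real
          using that by (simp add: field_simps)
        from this[of "x + t" "?w x" "m - x" "m + t" "sqrt A"] show ?thesis
          using A w xt by (simp add: algebra_simps)
      qed
      also have "(2 * m + t - x) * (x + t) - A = ?w x * ?w x"
        unfolding power2_eq_square[symmetric] w2 by (simp add: m_def A_def power2_eq_square field_simps)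
      finally show ?thesis using w xt by simp
    qed
    finally show ?thesis .
  qed
  have c: "isCont (\<lambda>x. ?w x / (x + t)) x" if "a < x" "x < b" for x
    using continuous_semicircle[of UNIV a b] that assms
    by (intro continuous_intros) (auto simp: continuous_on_eq_continuous_at)
  have nn: "0 \<le> ?w x / (x + t)" if "a < x" "x < b" for x using semicircle_pos[OF that] that assms by simp
  note ftc = FTC_open_interval[OF assms(1) cont d c nn]
  show "set_integrable lborel {a<..<b} (\<lambda>x. ?w x / (x + t))" by (rule ftc(1))
  have *: "(b - m) / r = 1" "(a - m) / r = -1" using assms by (auto simp: m_def r_def field_simps)
  have "A / (b + t) = a + t" "A / (a + t) = b + t" using assms by (auto simp: A_def)
  moreover have "((m + t) - (a + t)) / r = 1" "((m + t) - (b + t)) / r = -1"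
    using assms(1) by (auto simp: m_def r_def field_simps)
  ultimately have gb: "?g b = 1" and ga: "?g a = -1" by (simp_all only:)
  have w: "?w a = 0" "?w b = 0" by (simp_all add: semicircle_def)
  have "?F b = (m + t) * (pi / 2) - sqrt A * (pi / 2)" unfolding w *(1) gb by simp
  moreover have "?F a = sqrt A * (pi / 2) - (m + t) * (pi / 2)" unfolding w *(2) ga by simp
  moreover have "(LBINT x:{a<..<b}. ?w x / (x + t)) = ?F b - ?F a" by (rule ftc(2))
  ultimately have "(LBINT x:{a<..<b}. ?w x / (x + t)) = pi * (m + t - sqrt A)"
    by (simp only:) (simp add: algebra_simps)
  then show "(LBINT x:{a<..<b}. ?w x / (x + t)) = pi * ((a + b) / 2 + t - sqrt ((a + t) * (b + t)))"
    by (simp add: m_def A_def)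
qed

text \<open>The closed form of the integral of
  \<open>semicircle a b x * (1 / (1 + t) - 1 / (x + t))\<close> over x between \<open>a\<close> and
  \<open>b\<close>.\<close>

abbreviation semicircle_kernel :: "real \<Rightarrow> real \<Rightarrow> real \<Rightarrow> real" where
  "semicircle_kernel a b t \<equiv> pi * (b - a)^2 / 8 / (1 + t) - pi * ((a + b) / 2 + t - sqrt ((a + t) * (b + t)))"

text \<open>Gives the integrability needed for Fubini. The critical case is \<open>a = 0\<close>,
  which occurs for \<open>c = 1\<close>: the half circle is at most \<open>sqrt (b * x)\<close>, and
  \<open>sqrt x * \<bar>ln x\<bar>\<close> is at most 2 below 1 and at most
  \<open>b * sqrt b\<close> above.\<close>

lemma semicircle_ln_bounded:
  assumes "0 \<le> a" "a < x" "x < b"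
  shows "semicircle a b x * \<bar>ln x\<bar> \<le> sqrt b * (2 + b * sqrt b)"
proof -
  have x: "0 < x" using assms by simp
  have "semicircle a b x \<le> sqrt (b * x)"
    unfolding semicircle_def using assms by (intro real_sqrt_le_mono mult_mono) auto
  also have "\<dots> = sqrt b * sqrt x" by (rule real_sqrt_mult)
  finally have w: "semicircle a b x \<le> sqrt b * sqrt x" .
  have "sqrt x * \<bar>ln x\<bar> \<le> 2 + b * sqrt b"
  proof (cases "x \<le> 1")
    case True
    have "ln (1 / sqrt x) \<le> 1 / sqrt x - 1" using x by (intro ln_le_minus_one) simp
    then have "- ln x \<le> 2 * (1 / sqrt x)" using x by (simp add: ln_div ln_sqrt)
    then have "sqrt x * - ln x \<le> sqrt x * (2 * (1 / sqrt x))" using x by (intro mult_left_mono) auto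
    moreover have "ln x \<le> 0" using True x by simp
    moreover have "0 \<le> b * sqrt b" using assms by simp
    ultimately show ?thesis using x by simp
  next
    case False
    have "\<bar>ln x\<bar> \<le> b" using False ln_le_minus_one[OF x] ln_ge_zero[of x] assms by linarith
    then have "sqrt x * \<bar>ln x\<bar> \<le> sqrt b * b" using assms x by (intro mult_mono) auto
    then show ?thesis by (simp add: mult.commute)
  qed
  then have "sqrt b * sqrt x * \<bar>ln x\<bar> \<le> sqrt b * (2 + b * sqrt b)"
    using assms x unfolding mult.assoc by (intro mult_left_mono) auto
  moreover have "semicircle a b x * \<bar>ln x\<bar> \<le> sqrt b * sqrt x * \<bar>ln x\<bar>"
    by (rule mult_right_mono[OF w]) simp
  ultimately show ?thesis by linarith
qed

text \<open>Fubini's theorem applied to \<open>ln x = \<integral>\<^sub>0\<^sup>\<infinity> (1 / (1 + t) - 1 / (x + t)) dt\<close>.\<close>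

lemma semicircle_ln_integral:
  assumes "0 \<le> a" "a < b"
  shows "(LBINT t:{0<..}. semicircle_kernel a b t) =
      (LBINT x:{a<..<b}. semicircle a b x * ln x)"
proof -
  let ?w = "semicircle a b"
  define F where "F x t = indicator {a<..<b} x * indicator {0<..} t * (?w x * (1 / (1 + t) - 1 / (x + t)))"
    for x t :: real
  have w_meas[measurable]: "?w \<in> borel_measurable borel" unfolding semicircle_def by measurable
  have F_in: "F x t = ?w x * (indicator {0<..} t *\<^sub>R (1 / (1 + t) - 1 / (x + t)))" if "a < x" "x < b" for x t
    using that by (simp add: F_def)
  have F_out: "F x t = 0" if "\<not> (a < x \<and> x < b)" for x t using that by (auto simp: F_def)
  have int1: "integrable lborel (\<lambda>t. F x t)" for x
  proof (cases "a < x \<and> x < b")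
    case True
    then show ?thesis
      using ln_integral(1)[of x] assms unfolding set_integrable_def
      by (simp only: F_in) (intro integrable_mult_right, auto)
  qed (simp add: F_out)
  have val: "(LBINT t. F x t) = indicator {a<..<b} x *\<^sub>R (?w x * ln x)" for x
  proof (cases "a < x \<and> x < b")
    case True
    then have "(LBINT t. F x t) = ?w x * (LBINT t:{0<..}. 1 / (1 + t) - 1 / (x + t))"
      unfolding set_lebesgue_integral_def by (simp only: F_in integral_mult_right_zero)
    then show ?thesis using ln_integral(2)[of x] True assms by simp
  qed (auto simp: F_out)
  have aval: "(LBINT t. norm (F x t)) = indicator {a<..<b} x *\<^sub>R (?w x * \<bar>ln x\<bar>)" for x
  proof (cases "a < x \<and> x < b")
    case True
    then have "norm (F x t) = ?w x * (indicator {0<..} t *\<^sub>R \<bar>1 / (1 + t) - 1 / (x + t)\<bar>)" for t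
      using semicircle_pos[of a x b] by (auto simp: F_in abs_mult indicator_def)
    note eq = this
    then have "(LBINT t. norm (F x t)) = ?w x * (LBINT t:{0<..}. \<bar>1 / (1 + t) - 1 / (x + t)\<bar>)"
      unfolding set_lebesgue_integral_def eq by (simp only: integral_mult_right_zero)
    then show ?thesis using ln_integral(3)[of x] True assms by simp
  qed (auto simp: F_out)
  have abs_int: "integrable lborel (\<lambda>x. indicator {a<..<b} x *\<^sub>R (?w x * \<bar>ln x\<bar>))"
  proof (rule Bochner_Integration.integrable_bound)
    show "integrable lborel (\<lambda>x. indicator {a<..<b} x * (sqrt b * (2 + b * sqrt b)))"
      using assms by (intro integrable_mult_left integrable_real_indicator) auto
    show "AE x in lborel. norm (indicator {a<..<b} x *\<^sub>R (?w x * \<bar>ln x\<bar>)) \<le>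
        norm (indicator {a<..<b} x * (sqrt b * (2 + b * sqrt b)))"
    proof (rule AE_I2)
      fix x
      show "norm (indicator {a<..<b} x *\<^sub>R (?w x * \<bar>ln x\<bar>)) \<le>
        norm (indicator {a<..<b} x * (sqrt b * (2 + b * sqrt b)))"
      proof (cases "a < x \<and> x < b")
        case True
        then show ?thesis
          using semicircle_ln_bounded[of a x b] semicircle_pos[of a x b] assms by (simp add: abs_mult)
      qed auto
    qed
  qed simp
  have "integrable (lborel \<Otimes>\<^sub>M lborel) (\<lambda>(x, t). F x t)"
  proof (rule lborel_pair.Fubini_integrable)
    show "(\<lambda>(x, t). F x t) \<in> borel_measurable (lborel \<Otimes>\<^sub>M lborel)"
      unfolding F_def by measurable
    show "integrable lborel (\<lambda>x. LBINT y. norm (case (x, y) of (x, t) \<Rightarrow> F x t))"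
      using abs_int by (simp add: aval[simplified])
    show "AE x in lborel. integrable lborel (\<lambda>y. case (x, y) of (x, t) \<Rightarrow> F x t)"
      using int1 by simp
  qed
  then have "(LBINT t. LBINT x. F x t) = (LBINT x. LBINT t. F x t)" by (rule lborel_pair.Fubini_integral)
  also have "(LBINT x. LBINT t. F x t) = (LBINT x:{a<..<b}. ?w x * ln x)"
    unfolding set_lebesgue_integral_def val ..
  also have "(LBINT t. LBINT x. F x t) = (LBINT t:{0<..}. semicircle_kernel a b t)"
    unfolding set_lebesgue_integral_def[of lborel "{0<..}"]
  proof (rule Bochner_Integration.integral_cong[OF refl])
    fix t :: real
    show "(LBINT x. F x t) = indicator {0<..} t *\<^sub>R (semicircle_kernel a b t)"
    proof (cases "0 < t")
      case True
      then have at: "0 < a + t" using assms by simp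
      note i1 = integral_semicircle[OF assms(2)] and i2 = integral_semicircle_resolvent[OF assms(2) at]
      have "(LBINT x. F x t) = (LBINT x:{a<..<b}. 1 / (1 + t) * ?w x - ?w x / (x + t))"
        unfolding set_lebesgue_integral_def using True
        by (intro Bochner_Integration.integral_cong refl) (simp add: F_def algebra_simps)
      also have "\<dots> = (LBINT x:{a<..<b}. 1 / (1 + t) * ?w x) - (LBINT x:{a<..<b}. ?w x / (x + t))"
        by (intro set_integral_diff set_integrable_mult_right i1 i2)
      also have "(LBINT x:{a<..<b}. 1 / (1 + t) * ?w x) = 1 / (1 + t) * (LBINT x:{a<..<b}. ?w x)"
        by (rule set_integral_mult_right)
      finally show ?thesis using True by (simp add: i1 i2)
    qed (simp add: F_def)
  qed
  finally show ?thesis .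
qed

text \<open>The Stieltjes transform at \<open>-t\<close> of \<open>c\<close> times the Marchenko--Pastur law of ratio \<open>c\<close>.\<close>

definition mp_stieltjes :: "real \<Rightarrow> real \<Rightarrow> real" where
  "mp_stieltjes c t = (c - (1 + c + t - sqrt ((1 + c + t)^2 - 4 * c)) / 2) / t"

text \<open>In the variable \<open>u = g / (1 + g)\<close> the equation becomes the quadratic
  \<open>(c - u) (1 - u) = t u\<close>. The smaller root is the right one: \<open>u \<le> c\<close>
  makes \<open>g\<close> nonnegative, and \<open>u < 1\<close> allows solving for
  \<open>g\<close>.\<close>

lemma mp_stieltjes:
  assumes "0 < c" "0 < t"
  shows "0 \<le> mp_stieltjes c t"
    and "t * mp_stieltjes c t + mp_stieltjes c t / (1 + mp_stieltjes c t) = c"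
proof -
  define D where "D = (1 + c + t)^2 - 4 * c"
  define u where "u = (1 + c + t - sqrt D) / 2"
  define g where "g = mp_stieltjes c t"
  have g: "g = (c - u) / t" by (simp add: g_def mp_stieltjes_def u_def D_def)
  \<comment> \<open>Two ways to complete the square: the first gives \<open>u \<le> c\<close>, the
    second \<open>u < 1\<close>.\<close>
  have D1: "D = (1 + t - c)^2 + 4 * c * t" and D2: "D = (c + t - 1)^2 + 4 * t"
    by (simp_all add: D_def power2_eq_square algebra_simps)
  have D: "0 \<le> D" unfolding D2 using assms by simp
  have "\<bar>1 + t - c\<bar> = sqrt ((1 + t - c)^2)" by simp
  also have "\<dots> \<le> sqrt D" unfolding D1 using assms by (intro real_sqrt_le_mono) simp
  finally have uc: "u \<le> c" by (simp add: u_def field_simps abs_le_iff)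
  have "\<bar>c + t - 1\<bar> = sqrt ((c + t - 1)^2)" by simp
  also have "\<dots> < sqrt D" unfolding D2 using assms by (intro real_sqrt_less_mono) simp
  finally have u1: "u < 1" by (simp add: u_def field_simps abs_less_iff)
  have "(sqrt D)^2 = (1 + c + t)^2 - 4 * c" using D by (simp add: D_def)
  moreover have "sqrt D = 1 + c + t - 2 * u" by (simp add: u_def field_simps)
  ultimately have "(1 + c + t - 2 * u)^2 = (1 + c + t)^2 - 4 * c" by simp
  then have "(c - u) * (1 - u) = t * u" by (simp add: power2_eq_square algebra_simps)
  then have "g * (1 - u) = u" unfolding g using assms by (simp add: field_simps)
  moreover have g0: "0 \<le> g" unfolding g using uc assms by simp
  ultimately have gu: "g / (1 + g) = u" by (simp add: nonzero_divide_eq_eq algebra_simps)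
  show "0 \<le> mp_stieltjes c t" using g0 by (simp add: g_def)
  show "t * mp_stieltjes c t + mp_stieltjes c t / (1 + mp_stieltjes c t) = c"
    unfolding g_def[symmetric] gu unfolding g using assms by simp
qed

text \<open>The summand \<open>x / (1 + x)\<close> is increasing, so the map expands distances at
  least by the factor \<open>t\<close>. An approximate solution is therefore close to the exact
  one.\<close>

lemma fixed_point_stability:
  fixes x y t :: real
  assumes "0 \<le> x" "0 \<le> y" "0 < t"
  shows "t * \<bar>x - y\<bar> \<le> \<bar>(t * x + x / (1 + x)) - (t * y + y / (1 + y))\<bar>"
proof -
  have *: "t * (v - u) \<le> (t * v + v / (1 + v)) - (t * u + u / (1 + u))" if "0 \<le> u" "u \<le> v" for u v :: real
  proof -
    have "u / (1 + u) \<le> v / (1 + v)" using that by (simp add: field_simps)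
    then show ?thesis by (simp add: algebra_simps)
  qed
  show ?thesis
  proof (cases "x \<le> y")
    case True
    with *[of x y] assms show ?thesis by simp
  next
    case False
    with *[of y x] assms show ?thesis by simp
  qed
qed

section \<open>From resolvent traces to sums of x ln x\<close>

lemma continuous_mp_stieltjes:
  assumes "0 < c" "0 < t"
  shows "isCont (mp_stieltjes c) t"
  unfolding mp_stieltjes_def using assms by (intro continuous_intros) auto

text \<open>Almost sure convergence is available simultaneously for countably many arguments.
  Monotonicity squeezes \<open>f n t\<close> between its values at two rationals close to
  \<open>t\<close>, and continuity of the limit closes the gap.\<close>

lemma antimono_tendsto:
  fixes f :: "nat \<Rightarrow> real \<Rightarrow> real" and g :: "real \<Rightarrow> real"
  assumes "\<And>n s t. 0 < s \<Longrightarrow> s \<le> t \<Longrightarrow> f n t \<le> f n s"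
    and "\<And>q. q \<in> \<rat> \<Longrightarrow> 0 < q \<Longrightarrow> (\<lambda>n. f n q) \<longlonglongrightarrow> g q"
    and "isCont g t" "0 < t"
  shows "(\<lambda>n. f n t) \<longlonglongrightarrow> g t"
proof (rule LIMSEQ_I)
  fix e :: real assume e: "0 < e"
  obtain d where d: "0 < d" "\<And>s. dist s t < d \<Longrightarrow> dist (g s) (g t) < e / 2"
    using assms(3) e unfolding continuous_at_eps_delta by (metis half_gt_zero)
  obtain q where q: "q \<in> \<rat>" "max (t / 2) (t - d) < q" "q < t"
    using Rats_dense_in_real[of "max (t / 2) (t - d)" t] assms(4) d(1) by auto
  obtain r where r: "r \<in> \<rat>" "t < r" "r < t + d"
    using Rats_dense_in_real[of t "t + d"] d(1) by auto
  have q0: "0 < q" using q(2) assms(4) by simp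
  have r0: "0 < r" using r(2) assms(4) by simp
  have gq: "\<bar>g q - g t\<bar> < e / 2" and gr: "\<bar>g r - g t\<bar> < e / 2"
    using d(2)[of q] d(2)[of r] q r by (auto simp: dist_real_def)
  have "\<forall>\<^sub>F n in sequentially. \<bar>f n q - g q\<bar> < e / 2"
    using tendstoD[OF assms(2)[OF q(1) q0], of "e / 2"] e by (simp add: dist_real_def)
  moreover have "\<forall>\<^sub>F n in sequentially. \<bar>f n r - g r\<bar> < e / 2"
    using tendstoD[OF assms(2)[OF r(1) r0], of "e / 2"] e by (simp add: dist_real_def)
  ultimately have "\<forall>\<^sub>F n in sequentially. norm (f n t - g t) < e"
  proof eventually_elim
    case (elim n)
    have "f n t \<le> f n q" "f n r \<le> f n t"
      using assms(1)[OF q0, of t n] assms(1)[OF assms(4), of r n] q(3) r(2) by auto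
    then show ?case using elim gq gr unfolding real_norm_def by linarith
  qed
  then show "\<exists>N. \<forall>n\<ge>N. norm (f n t - g t) < e" by (simp add: eventually_sequentially)
qed

text \<open>The value 0 must be included, as the Gram matrix is singular when there are more rows
  than columns; integrand and right-hand side then both vanish.\<close>

lemma xlnx_integral:
  fixes x :: real
  assumes "0 \<le> x"
  shows "set_integrable lborel {0<..} (\<lambda>t. x / (1 + t) - x / (x + t))"
    and "(LBINT t:{0<..}. x / (1 + t) - x / (x + t)) = x * ln x"
proof -
  have eq: "x / (1 + t) - x / (x + t) = x * (1 / (1 + t) - 1 / (x + t))" for t
    by (simp add: right_diff_distrib)
  have "set_integrable lborel {0<..} (\<lambda>t. x * (1 / (1 + t) - 1 / (x + t)))"
    using assms ln_integral(1) by (intro set_integrable_mult_right) auto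
  then show "set_integrable lborel {0<..} (\<lambda>t. x / (1 + t) - x / (x + t))" by (simp only: eq)
  have "(LBINT t:{0<..}. x * (1 / (1 + t) - 1 / (x + t))) = x * (LBINT t:{0<..}. 1 / (1 + t) - 1 / (x + t))"
    by (rule set_integral_mult_right)
  then show "(LBINT t:{0<..}. x / (1 + t) - x / (x + t)) = x * ln x"
    using assms ln_integral(2)[of x] by (cases "x = 0") (simp_all only: eq, auto)
qed

lemma sum_xlnx_integral:
  fixes xs :: "real list"
  assumes "\<And>x. x \<in> set xs \<Longrightarrow> 0 \<le> x"
  shows "set_integrable lborel {0<..} (\<lambda>t. \<Sum>x\<leftarrow>xs. x / (1 + t) - x / (x + t))
    \<and> (LBINT t:{0<..}. \<Sum>x\<leftarrow>xs. x / (1 + t) - x / (x + t)) = (\<Sum>x\<leftarrow>xs. x * ln x)"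
  using assms
proof (induction xs)
  case Nil
  then show ?case by (simp add: set_integrable_def)
next
  case (Cons x xs)
  then have IH: "set_integrable lborel {0<..} (\<lambda>t. \<Sum>x\<leftarrow>xs. x / (1 + t) - x / (x + t))"
    "(LBINT t:{0<..}. \<Sum>x\<leftarrow>xs. x / (1 + t) - x / (x + t)) = (\<Sum>x\<leftarrow>xs. x * ln x)" by auto
  have x: "0 \<le> x" using Cons.prems by simp
  show ?case using set_integral_add[OF xlnx_integral(1)[OF x] IH(1)] xlnx_integral(2)[OF x] IH(2) by simp
qed

text \<open>The dominating function: integrable in t down to 0, and only quadratic in
  \<open>x\<close>, so that a bound on the second moment of the spectrum is enough.\<close>

lemma xlnx_integrand_bound:
  fixes x t :: real
  assumes "0 \<le> x" "0 < t"
  shows "\<bar>x / (1 + t) - x / (x + t)\<bar> \<le> (x + 1)^2 / (1 + t)^2"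
proof -
  have xt: "0 < x + t" using assms by simp
  have *: "\<bar>u\<bar> \<le> v" if "v - u = y" "v + u = z" "0 \<le> y" "0 \<le> z" for u v y z :: real
    using that by linarith
  have "\<bar>x * (x - 1) * (1 + t)\<bar> \<le> (x + 1)^2 * (x + t)"
  proof (rule *)
    \<comment> \<open>After clearing denominators, both the difference and the sum of the two sides
      are polynomials in \<open>x\<close> and \<open>t\<close> with nonnegative
      coefficients.\<close>
    show "(x + 1)^2 * (x + t) - x * (x - 1) * (1 + t) = x * x * x + x * x + 2 * x + t * (3 * x + 1)"
      "(x + 1)^2 * (x + t) + x * (x - 1) * (1 + t) = x * x * x + 3 * (x * x) + t * (2 * (x * x) + x + 1)"
      by (simp_all add: power2_eq_square algebra_simps)
  qed (use assms in simp_all)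
  then have "\<bar>x * (x - 1) * (1 + t)\<bar> / ((1 + t)^2 * (x + t)) \<le> (x + 1)^2 * (x + t) / ((1 + t)^2 * (x + t))"
    using xt by (intro divide_right_mono) auto
  moreover have "x / (1 + t) - x / (x + t) = x * (x - 1) / ((1 + t) * (x + t))"
    using assms xt by (simp add: field_simps)
  then have "x / (1 + t) - x / (x + t) = x * (x - 1) * (1 + t) / ((1 + t)^2 * (x + t))"
    using assms by (simp add: power2_eq_square)
  ultimately show ?thesis using xt by (simp add: abs_mult)
qed

lemma sum_xlnx_integrand_bound:
  fixes xs :: "real list"
  assumes "\<And>x. x \<in> set xs \<Longrightarrow> 0 \<le> x" "0 < t"
  shows "\<bar>\<Sum>x\<leftarrow>xs. x / (1 + t) - x / (x + t)\<bar> \<le> (\<Sum>x\<leftarrow>xs. (x + 1)^2) / (1 + t)^2"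
  using assms(1)
proof (induction xs)
  case (Cons x xs)
  then show ?case using xlnx_integrand_bound[of x t] assms(2) by (simp add: add_divide_distrib)
qed simp

text \<open>Integrating \<open>x ln x\<close> against the Marchenko--Pastur law leaves, up to a
  constant, the bare half circle as weight for \<open>ln x\<close>: the factor \<open>x\<close>
  cancels the \<open>1 / x\<close> of the density.\<close>

abbreviation mp_log_integral :: "real \<Rightarrow> real" where
  "mp_log_integral c \<equiv> (LBINT x:{(1 - sqrt c)^2<..<(1 + sqrt c)^2}. semicircle ((1 - sqrt c)^2) ((1 + sqrt c)^2) x * ln x)"

text \<open>The deterministic core, applied later for each fixed sample point. Dimension, first
  moment and resolvent traces give the pointwise limit of the integrand in t; the second moment
  supplies the domination.\<close>

lemma sum_xlnx_tendsto:
  fixes es :: "nat \<Rightarrow> real list" and c K :: real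
  assumes "0 < c"
    and nonneg: "\<And>n e. e \<in> set (es n) \<Longrightarrow> 0 \<le> e"
    and len: "(\<lambda>n. length (es n) / n) \<longlonglongrightarrow> c"
    and first: "(\<lambda>n. (\<Sum>e\<leftarrow>es n. e) / (real n)^2) \<longlonglongrightarrow> c"
    and second: "\<forall>\<^sub>F n in sequentially. (\<Sum>e\<leftarrow>es n. e^2) / (real n) ^ 3 \<le> K"
    and stieltjes: "\<And>q. q \<in> \<rat> \<Longrightarrow> 0 < q \<Longrightarrow> (\<lambda>n. \<Sum>e\<leftarrow>es n. 1 / (e + real n * q)) \<longlonglongrightarrow> mp_stieltjes c q"
  shows "(\<lambda>n. (\<Sum>e\<leftarrow>es n. (e / n) * ln (e / n)) / n) \<longlonglongrightarrow>
    1 / (2 * pi) * mp_log_integral c"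
proof -
  define xs where "xs n = map (\<lambda>e. e / real n) (es n)" for n
  have xs0: "0 \<le> x" if "x \<in> set (xs n)" for x n using that nonneg by (auto simp: xs_def)
  define f where "f n t = (\<Sum>x\<leftarrow>xs n. x / (1 + t) - x / (x + t)) / n" for n t
  define F where "F t = c / (1 + t) - (c - t * mp_stieltjes c t)" for t
  have st: "(\<lambda>n. \<Sum>e\<leftarrow>es n. 1 / (e + real n * t)) \<longlonglongrightarrow> mp_stieltjes c t" if "0 < t" for t
  proof (rule antimono_tendsto[where f = "\<lambda>n t. \<Sum>e\<leftarrow>es n. 1 / (e + real n * t)"])
    show "(\<Sum>e\<leftarrow>es n. 1 / (e + real n * t)) \<le> (\<Sum>e\<leftarrow>es n. 1 / (e + real n * s))" if "0 < s" "s \<le> t" for n s t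
    proof (cases "n = 0")
      case False
      then show ?thesis
        using that nonneg by (intro sum_list_mono divide_left_mono mult_pos_pos add_nonneg_pos add_left_mono mult_left_mono) auto
    qed simp
  qed (use stieltjes continuous_mp_stieltjes[OF assms(1) that] that in auto)
  \<comment> \<open>Uses \<open>x / (x + t) = 1 - t / (x + t)\<close>, which expresses the integrand
    by quantities whose limits are assumed.\<close>
  have f_eq: "f n t = (\<Sum>e\<leftarrow>es n. e) / (real n)^2 / (1 + t) - (length (es n) / n - t * (\<Sum>e\<leftarrow>es n. 1 / (e + real n * t)))"
    if "0 < t" "0 < n" for n t
  proof -
    have "(\<Sum>e\<leftarrow>l. e / n / (1 + t) - e / n / (e / n + t)) =
        (\<Sum>e\<leftarrow>l. e) / n / (1 + t) - (length l - real n * t * (\<Sum>e\<leftarrow>l. 1 / (e + real n * t)))"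
      if "\<And>e. e \<in> set l \<Longrightarrow> 0 \<le> e" for l
      using that
    proof (induction l)
      case (Cons e l)
      have pos: "0 < e + real n * t"
        using Cons.prems[of e] \<open>0 < t\<close> \<open>0 < n\<close> by (simp add: add_nonneg_pos)
      have "e / n / (e / n + t) = e / (e + real n * t)"
        using \<open>0 < n\<close> pos by (simp add: field_simps)
      also have "\<dots> = 1 - real n * t * (1 / (e + real n * t))" using pos by (simp add: field_simps)
      finally show ?case using Cons.IH Cons.prems by (simp add: add_divide_distrib distrib_left)
    qed simp
    from this[of "es n"] nonneg show ?thesis
      using that by (simp add: f_def xs_def o_def power2_eq_square diff_divide_distrib)
  qed
  have f_lim: "(\<lambda>n. f n t) \<longlonglongrightarrow> F t" if "0 < t" for t
  proof -
    have "(\<lambda>n. (\<Sum>e\<leftarrow>es n. e) / (real n)^2 / (1 + t) - (length (es n) / n - t * (\<Sum>e\<leftarrow>es n. 1 / (e + real n * t))))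
        \<longlonglongrightarrow> F t"
      unfolding F_def using that by (intro tendsto_intros first len st) auto
    moreover have "\<forall>\<^sub>F n in sequentially. (\<Sum>e\<leftarrow>es n. e) / (real n)^2 / (1 + t) -
        (length (es n) / n - t * (\<Sum>e\<leftarrow>es n. 1 / (e + real n * t))) = f n t"
      using eventually_gt_at_top[of 0] by eventually_elim (simp add: f_eq that)
    ultimately show ?thesis by (rule Lim_transform_eventually)
  qed
  \<comment> \<open>The three summands bound the three terms of
    \<open>(x + 1)^2 = x^2 + 2 x + 1\<close>, averaged over the spectrum; each limit
    \<open>c\<close> is relaxed to \<open>c + 1\<close>.\<close>
  define B where "B = K + 2 * (c + 1) + (c + 1)"
  have "\<forall>\<^sub>F n in sequentially. (\<Sum>x\<leftarrow>xs n. (x + 1)^2) / n \<le> B"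
  proof -
    have "\<forall>\<^sub>F n in sequentially. length (es n) / n < c + 1"
      by (rule order_tendstoD(2)[OF len]) simp
    moreover have "\<forall>\<^sub>F n in sequentially. (\<Sum>e\<leftarrow>es n. e) / (real n)^2 < c + 1"
      by (rule order_tendstoD(2)[OF first]) simp
    ultimately show ?thesis
      using second eventually_gt_at_top[of 0]
    proof eventually_elim
      case (elim n)
      have "(\<Sum>x\<leftarrow>map (\<lambda>e. e / n) l. (x + 1)^2) =
          (\<Sum>e\<leftarrow>l. e^2) / (real n)^2 + 2 * ((\<Sum>e\<leftarrow>l. e) / n) + length l" for l
        by (induction l) (simp_all add: power2_eq_square add_divide_distrib algebra_simps)
      then have "(\<Sum>x\<leftarrow>xs n. (x + 1)^2) / n =
          (\<Sum>e\<leftarrow>es n. e^2) / (real n) ^ 3 + 2 * ((\<Sum>e\<leftarrow>es n. e) / (real n)^2) + length (es n) / n"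
        unfolding xs_def by (simp add: add_divide_distrib power2_eq_square power3_eq_cube)
      then show ?case using elim by (simp add: B_def)
    qed
  qed
  then obtain N where N: "\<And>n. n \<ge> N \<Longrightarrow> (\<Sum>x\<leftarrow>xs n. (x + 1)^2) / n \<le> B"
    by (auto simp: eventually_sequentially)
  have int: "set_integrable lborel {0<..} (f n)" "(LBINT t:{0<..}. f n t) = (\<Sum>x\<leftarrow>xs n. x * ln x) / n" for n
  proof -
    have "set_integrable lborel {0<..} (\<lambda>t. \<Sum>x\<leftarrow>xs n. x / (1 + t) - x / (x + t))"
      "(LBINT t:{0<..}. \<Sum>x\<leftarrow>xs n. x / (1 + t) - x / (x + t)) = (\<Sum>x\<leftarrow>xs n. x * ln x)"
      using sum_xlnx_integral[of "xs n"] xs0 by blast+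
    then show "set_integrable lborel {0<..} (f n)" "(LBINT t:{0<..}. f n t) = (\<Sum>x\<leftarrow>xs n. x * ln x) / n"
      unfolding f_def by (auto simp: set_integral_divide_zero intro!: set_integrable_divide)
  qed
  \<comment> \<open>The domination holds only from \<open>N\<close> on, hence the shift of the
    sequence.\<close>
  have "(\<lambda>n. LBINT t:{0<..}. f (n + N) t) \<longlonglongrightarrow> (LBINT t:{0<..}. F t)"
    unfolding set_lebesgue_integral_def
  proof (rule integral_dominated_convergence)
    show "integrable lborel (\<lambda>t. indicator {0<..} t *\<^sub>R (B * (1 / (1 + t)^2)))"
      using set_integrable_mult_right[of B lborel "{0<..}" "\<lambda>t. 1 / (1 + t)^2"] integral_inverse_square
      unfolding set_integrable_def by blast
    show "(\<lambda>t. indicat_real {0<..} t *\<^sub>R F t) \<in> borel_measurable lborel"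
      unfolding F_def mp_stieltjes_def by measurable
    show "(\<lambda>t. indicat_real {0<..} t *\<^sub>R f (n + N) t) \<in> borel_measurable lborel" for n
      using int(1)[of "n + N"] unfolding set_integrable_def by (rule borel_measurable_integrable)
    show "AE t in lborel. (\<lambda>n. indicat_real {0<..} t *\<^sub>R f (n + N) t) \<longlonglongrightarrow> indicat_real {0<..} t *\<^sub>R F t"
    proof (rule AE_I2)
      fix t :: real
      show "(\<lambda>n. indicat_real {0<..} t *\<^sub>R f (n + N) t) \<longlonglongrightarrow> indicat_real {0<..} t *\<^sub>R F t"
      proof (cases "0 < t")
        case True
        then show ?thesis using LIMSEQ_ignore_initial_segment[OF f_lim[OF True], of N] by simp
      qed simp
    qed
    show "AE t in lborel. norm (indicat_real {0<..} t *\<^sub>R f (n + N) t) \<le> indicator {0<..} t *\<^sub>R (B * (1 / (1 + t)^2))" for n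
    proof (rule AE_I2)
      fix t :: real
      show "norm (indicat_real {0<..} t *\<^sub>R f (n + N) t) \<le> indicator {0<..} t *\<^sub>R (B * (1 / (1 + t)^2))"
      proof (cases "0 < t")
        case True
        have "\<bar>f (n + N) t\<bar> \<le> (\<Sum>x\<leftarrow>xs (n + N). (x + 1)^2) / (1 + t)^2 / (n + N)"
          unfolding f_def abs_divide abs_of_nat
          using sum_xlnx_integrand_bound[of "xs (n + N)" t] xs0 True by (intro divide_right_mono) auto
        also have "\<dots> = (\<Sum>x\<leftarrow>xs (n + N). (x + 1)^2) / (n + N) * (1 / (1 + t)^2)" by simp
        also have "\<dots> \<le> B * (1 / (1 + t)^2)" using N[of "n + N"] True by (intro mult_right_mono) auto
        finally show ?thesis using True by simp
      qed simp
    qed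
  qed
  then have "(\<lambda>n. LBINT t:{0<..}. f n t) \<longlonglongrightarrow> (LBINT t:{0<..}. F t)"
    by (rule LIMSEQ_offset)
  moreover have "(\<lambda>n. LBINT t:{0<..}. f n t) = (\<lambda>n. (\<Sum>e\<leftarrow>es n. (e / n) * ln (e / n)) / n)"
    by (intro ext) (simp add: int(2) xs_def o_def)
  moreover have "(LBINT t:{0<..}. F t) = 1 / (2 * pi) *
      mp_log_integral c"
  proof -
    let ?a = "(1 - sqrt c)^2" and ?b = "(1 + sqrt c)^2"
    have ab: "?a < ?b" using assms(1) by (simp add: power2_eq_square algebra_simps)
    have 1: "(?b - ?a)^2 = 16 * c" "(?a + ?b) / 2 = 1 + c"
      using assms(1) by (simp_all add: power2_eq_square algebra_simps)
    \<comment> \<open>This identifies the edges: \<open>- ?a\<close> and \<open>- ?b\<close> are the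
      zeros in t of the discriminant inside \<open>mp_stieltjes\<close>.\<close>
    have 2: "(?a + t) * (?b + t) = (1 + c + t)^2 - 4 * c" for t
    proof -
      have "?a = 1 + c - 2 * sqrt c" "?b = 1 + c + 2 * sqrt c"
        using assms(1) by (simp_all add: power2_eq_square algebra_simps)
      then have "(?a + t) * (?b + t) = (1 + c + t)^2 - 4 * (sqrt c * sqrt c)"
        by (simp only:) (simp add: power2_eq_square algebra_simps)
      then show ?thesis using assms(1) by simp
    qed
    have "(LBINT t:{0<..}. F t) = (LBINT t:{0<..}. 1 / (2 * pi) * (semicircle_kernel ?a ?b t))"
    proof (rule set_lebesgue_integral_cong)
      show "\<forall>t. t \<in> {0<..} \<longrightarrow> F t = 1 / (2 * pi) * semicircle_kernel ?a ?b t"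
      proof (intro allI impI)
        fix t :: real assume "t \<in> {0<..}"
        define S where "S = sqrt ((1 + c + t)^2 - 4 * c)"
        have "F t = c / (1 + t) - (1 + c + t - S) / 2"
          using \<open>t \<in> {0<..}\<close> by (simp add: F_def mp_stieltjes_def S_def)
        also have "\<dots> = 1 / (2 * pi) * (pi * (2 * (c / (1 + t)) - (1 + c + t - S)))"
          by (simp add: field_simps)
        also have "pi * (2 * (c / (1 + t)) - (1 + c + t - S)) = pi * (16 * c) / 8 / (1 + t) - pi * (1 + c + t - S)"
          by (simp add: right_diff_distrib)
        finally show "F t = 1 / (2 * pi) * semicircle_kernel ?a ?b t"
          unfolding 1 2 S_def .
      qed
    qed simp
    also have "\<dots> = 1 / (2 * pi) * (LBINT t:{0<..}. semicircle_kernel ?a ?b t)"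
      by (rule set_integral_mult_right)
    also have "\<dots> = 1 / (2 * pi) * (LBINT x:{?a<..<?b}. semicircle ?a ?b x * ln x)"
      by (subst semicircle_ln_integral[OF _ ab]) simp_all
    finally show ?thesis .
  qed
  ultimately show ?thesis by simp
qed

section \<open>Second moments of quadratic forms\<close>

lemma measurable_cnj[measurable]: "cnj \<in> borel_measurable borel"
  by (intro borel_measurable_continuous_onI continuous_intros)

text \<open>Serves the passage from the array indexed from 1 to the one indexed from 0.\<close>

lemma (in prob_space) indep_sets_reindex:
  assumes "indep_sets F I" "inj_on f J" "f ` J \<subseteq> I"
  shows "indep_sets (\<lambda>j. F (f j)) J"
proof (rule indep_setsI)
  show "F (f j) \<subseteq> events" if "j \<in> J" for j using assms that by (auto simp: indep_sets_def)
next
  fix A K assume K: "K \<noteq> {}" "K \<subseteq> J" "finite K" "\<forall>j\<in>K. A j \<in> F (f j)"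
  have inj: "inj_on f K" using assms(2) K(2) by (rule inj_on_subset)
  define A' where "A' i = A (inv_into K f i)" for i
  have A': "A' (f j) = A j" if "j \<in> K" for j using inj that by (simp add: A'_def)
  have "f ` K \<subseteq> I" using K(2) assms(3) by blast
  then have "prob (\<Inter>i\<in>f ` K. A' i) = (\<Prod>i\<in>f ` K. prob (A' i))"
    using K A' by (intro indep_setsD[OF assms(1)]) auto
  then show "prob (\<Inter>j\<in>K. A j) = (\<Prod>j\<in>K. prob (A j))"
    by (simp add: prod.reindex[OF inj] A')
qed

lemma (in prob_space) indep_vars_reindex_inj:
  assumes "indep_vars (\<lambda>_. N) X I" "inj_on f J" "f ` J \<subseteq> I"
  shows "indep_vars (\<lambda>_. N) (\<lambda>j. X (f j)) J"
  using assms indep_sets_reindex[OF _ assms(2,3)] unfolding indep_vars_def2 by auto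

text \<open>Lets fourth moments dominate every product of up to four entries; missing factors are
  filled up with 1.\<close>

lemma norm_prod4_le:
  fixes a b c d :: real
  assumes "0 \<le> a" "0 \<le> b" "0 \<le> c" "0 \<le> d"
  shows "a * b * (c * d) \<le> a ^ 4 + b ^ 4 + c ^ 4 + d ^ 4"
proof -
  have *: "2 * (x * y) \<le> x^2 + y^2" for x y :: real
    using zero_le_power2[of "x - y"] by (simp add: power2_eq_square algebra_simps)
  have "2 * (a * b * (c * d)) \<le> (a * b)^2 + (c * d)^2" by (rule *)
  also have "(a * b)^2 \<le> ((a^2)^2 + (b^2)^2) / 2"
    using *[of "a^2" "b^2"] by (simp add: power_mult_distrib)
  also have "(c * d)^2 \<le> ((c^2)^2 + (d^2)^2) / 2"
    using *[of "c^2" "d^2"] by (simp add: power_mult_distrib)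
  finally have "2 * (a * b * (c * d)) \<le> (a ^ 4 + b ^ 4) / 2 + (c ^ 4 + d ^ 4) / 2"
    by (simp add: power_mult[symmetric])
  moreover have "4 * T \<le> A + B + C + D" if "2 * T \<le> (A + B) / 2 + (C + D) / 2" for T A B C D :: real
    using that by (simp add: field_simps)
  ultimately have "4 * (a * b * (c * d)) \<le> a ^ 4 + b ^ 4 + c ^ 4 + d ^ 4" by blast
  moreover have "0 \<le> a * b * (c * d)" using assms by simp
  ultimately show ?thesis by linarith
qed

text \<open>Means of random errors are taken in the extended nonnegative reals, so that an upper
  bound needs no prior proof of integrability.\<close>

abbreviation (in prob_space) nn_mean :: "('a \<Rightarrow> real) \<Rightarrow> ennreal" where
  "nn_mean f \<equiv> (\<integral>\<^sup>+w. ennreal (f w) \<partial>M)"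

locale iid_entries = prob_space M for M :: "'a measure" +
  fixes X :: "'i \<Rightarrow> 'a \<Rightarrow> complex" and I :: "'i set" and \<kappa> :: real
  assumes indep: "indep_vars (\<lambda>_. borel) X I"
    and mean: "\<And>i. i \<in> I \<Longrightarrow> expectation (X i) = 0"
    and pseudo_var: "\<And>i. i \<in> I \<Longrightarrow> expectation (\<lambda>w. (X i w)^2) = 0"
    and var: "\<And>i. i \<in> I \<Longrightarrow> expectation (\<lambda>w. (cmod (X i w))^2) = 1"
    and fourth: "\<And>i. i \<in> I \<Longrightarrow> integrable M (\<lambda>w. cmod (X i w) ^ 4)"
    and kappa: "\<And>i. i \<in> I \<Longrightarrow> expectation (\<lambda>w. cmod (X i w) ^ 4) \<le> \<kappa>"
begin

lemma meas[measurable]: "i \<in> I \<Longrightarrow> X i \<in> borel_measurable M"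
  using indep by (auto simp: indep_vars_def)

lemma integrable_le4:
  fixes f :: "'a \<Rightarrow> complex"
  assumes "f \<in> borel_measurable M" "i \<in> I" "\<And>w. cmod (f w) \<le> 1 + cmod (X i w) ^ 4"
  shows "integrable M f"
  by (rule Bochner_Integration.integrable_bound[of M "\<lambda>w. 1 + cmod (X i w) ^ 4"])
    (use assms fourth in auto)

abbreviation quad4 :: "'i \<Rightarrow> 'i \<Rightarrow> 'i \<Rightarrow> 'i \<Rightarrow> 'a \<Rightarrow> complex" where
  "quad4 k k' j j' w \<equiv> cnj (X k w) * X k' w * (X j w * cnj (X j' w))"

lemma integrable_prod4:
  assumes "k \<in> I" "k' \<in> I" "j \<in> I" "j' \<in> I"
  shows "integrable M (\<lambda>w. quad4 k k' j j' w)"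
proof (rule Bochner_Integration.integrable_bound)
  show "integrable M (\<lambda>w. cmod (X k w) ^ 4 + cmod (X k' w) ^ 4 + cmod (X j w) ^ 4 + cmod (X j' w) ^ 4)"
    using assms fourth by (intro Bochner_Integration.integrable_add) auto
  show "(\<lambda>w. quad4 k k' j j' w) \<in> borel_measurable M" using assms by measurable
  show "AE w in M. cmod (quad4 k k' j j' w) \<le> 
      norm (cmod (X k w) ^ 4 + cmod (X k' w) ^ 4 + cmod (X j w) ^ 4 + cmod (X j' w) ^ 4)"
    using norm_prod4_le by (intro AE_I2) (simp add: norm_mult)
qed

lemma integrable_prod2:
  assumes "k \<in> I" "k' \<in> I"
  shows "integrable M (\<lambda>w. cnj (X k w) * X k' w)"
proof (rule Bochner_Integration.integrable_bound)
  show "integrable M (\<lambda>w. cmod (X k w) ^ 4 + cmod (X k' w) ^ 4 + 1 ^ 4 + 1 ^ 4)"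
    using assms fourth by (intro Bochner_Integration.integrable_add) auto
  show "(\<lambda>w. cnj (X k w) * X k' w) \<in> borel_measurable M" using assms by measurable
  show "AE w in M. cmod (cnj (X k w) * X k' w) \<le> 
      norm (cmod (X k w) ^ 4 + cmod (X k' w) ^ 4 + 1 ^ 4 + 1 ^ 4)"
    using norm_prod4_le[of _ _ 1 1] by (intro AE_I2) (simp add: norm_mult)
qed

lemma expectation_sq: "i \<in> I \<Longrightarrow> expectation (\<lambda>w. cnj (X i w) * X i w) = 1"
proof -
  assume i: "i \<in> I"
  have "expectation (\<lambda>w. cnj (X i w) * X i w) = expectation (\<lambda>w. complex_of_real ((cmod (X i w))^2))"
    unfolding complex_norm_square by (simp add: mult.commute)
  then show ?thesis using var[OF i] by (simp only: integral_complex_of_real of_real_1)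
qed

lemma expectation_cnj_sq: "i \<in> I \<Longrightarrow> expectation (\<lambda>w. cnj (X i w) * cnj (X i w)) = 0"
  using pseudo_var[of i] by (simp add: power2_eq_square flip: complex_cnj_mult)

lemma expectation_cnj: "i \<in> I \<Longrightarrow> expectation (\<lambda>w. cnj (X i w)) = 0"
  using mean[of i] by simp

lemma kappa_ge_1:
  assumes "i \<in> I"
  shows "1 \<le> \<kappa>"
proof -
  \<comment> \<open>A function that is not integrable has integral 0 by convention, so the value 1
    in \<open>var\<close> forces integrability.\<close>
  have int2: "integrable M (\<lambda>w. (cmod (X i w))^2)"
  proof (rule ccontr)
    assume "\<not> ?thesis"
    then show False using var[OF assms] by (simp add: not_integrable_integral_eq)
  qed
  have "0 \<le> expectation (\<lambda>w. ((cmod (X i w))^2 - 1)^2)" by simp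
  also have "expectation (\<lambda>w. ((cmod (X i w))^2 - 1)^2) =
      expectation (\<lambda>w. cmod (X i w) ^ 4 - 2 * (cmod (X i w))^2 + 1)"
    by (intro Bochner_Integration.integral_cong refl) (simp add: power2_eq_square algebra_simps numeral_eq_Suc)
  also have "\<dots> = expectation (\<lambda>w. cmod (X i w) ^ 4) - 2 * 1 + 1"
    using int2 fourth[OF assms] var[OF assms] by (simp add: prob_space)
  finally show ?thesis using kappa[OF assms] by simp
qed

lemma expectation_prod_single:
  fixes h :: "'i \<Rightarrow> complex \<Rightarrow> complex"
  assumes "finite K" "K \<subseteq> I" "\<And>i. i \<in> K \<Longrightarrow> h i \<in> borel_measurable borel"
    and "\<And>i. i \<in> K \<Longrightarrow> integrable M (\<lambda>w. h i (X i w))"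
  shows "expectation (\<lambda>w. \<Prod>i\<in>K. h i (X i w)) = (\<Prod>i\<in>K. expectation (\<lambda>w. h i (X i w)))"
proof (rule indep_vars_lebesgue_integral)
  show "indep_vars (\<lambda>_. borel) (\<lambda>i w. h i (X i w)) K"
    by (rule indep_vars_compose2[OF indep_vars_subset[OF indep assms(2)]]) (use assms(3) in auto)
qed (use assms in auto)

text \<open>The contribution of index \<open>i\<close> to the fourfold product. Taking the product
  over the set of the four indices treats all coincidences among them uniformly.\<close>

definition quad4_factor :: "'i \<Rightarrow> 'i \<Rightarrow> 'i \<Rightarrow> 'i \<Rightarrow> 'i \<Rightarrow> complex \<Rightarrow> complex" where
  "quad4_factor k k' j j' i z = (if i = k then cnj z else 1) * (if i = k' then z else 1) *
      ((if i = j then z else 1) * (if i = j' then cnj z else 1))"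

lemma expectation_prod4:
  assumes "k \<in> I" "k' \<in> I" "j \<in> I" "j' \<in> I"
  shows "expectation (\<lambda>w. quad4 k k' j j' w) =
    (\<Prod>i\<in>{k, k', j, j'}. expectation (\<lambda>w. quad4_factor k k' j j' i (X i w)))"
proof -
  let ?h = "quad4_factor k k' j j'"
  have "expectation (\<lambda>w. \<Prod>i\<in>{k, k', j, j'}. ?h i (X i w)) = (\<Prod>i\<in>{k, k', j, j'}. expectation (\<lambda>w. ?h i (X i w)))"
  proof (rule expectation_prod_single)
    show "?h i \<in> borel_measurable borel" for i unfolding quad4_factor_def by measurable
    show "integrable M (\<lambda>w. ?h i (X i w))" if "i \<in> {k, k', j, j'}" for i
    proof (rule integrable_le4)
      show i: "i \<in> I" using that assms by auto
      show "(\<lambda>w. ?h i (X i w)) \<in> borel_measurable M"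
        using i unfolding quad4_factor_def by measurable
      show "cmod (?h i (X i w)) \<le> 1 + cmod (X i w) ^ 4" for w
      proof -
        \<comment> \<open>Each of the four factors is 1 or has the modulus of the entry, so it is at
          most \<open>m\<close> whichever indices coincide.\<close>
        define m where "m = max 1 (cmod (X i w))"
        have m: "1 \<le> m" "cmod (X i w) \<le> m" by (auto simp: m_def)
        have m0: "0 \<le> m" using m(1) by simp
        have "cmod (?h i (X i w)) \<le> m * m * (m * m)"
          unfolding quad4_factor_def norm_mult using m m0 by (intro mult_mono mult_nonneg_nonneg) auto
        also have "\<dots> = m ^ 4" by (simp add: numeral_eq_Suc)
        also have "\<dots> \<le> 1 + cmod (X i w) ^ 4" by (auto simp: m_def max_def)
        finally show ?thesis .
      qed
    qed
  qed (use assms in auto)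
  moreover have "(\<Prod>i\<in>{k, k', j, j'}. ?h i (X i w)) = quad4 k k' j j' w" for w
    unfolding quad4_factor_def prod.distrib by (simp add: prod.delta)
  ultimately show ?thesis by simp
qed

lemma expectation_pair_eq:
  assumes "k \<in> I" "k' \<in> I"
  shows "expectation (\<lambda>w. cnj (X k w) * X k' w) = (if k = k' then 1 else 0)"
proof (cases "k = k'")
  case False
  define h where "h i z = (if i = k then cnj z else z)" for i z
  have "integrable M (\<lambda>w. h i (X i w))" if "i \<in> I" for i
  proof (rule integrable_le4[OF _ that])
    show "(\<lambda>w. h i (X i w)) \<in> borel_measurable M" using that unfolding h_def by measurable
    have "r \<le> 1 + r ^ 4" if "0 \<le> r" for r :: real
    proof (cases "r \<le> 1")
      case False
      then show ?thesis using self_le_power[of r 4] by simp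
    qed (use that in \<open>simp add: add_increasing2\<close>)
    then show "cmod (h i (X i w)) \<le> 1 + cmod (X i w) ^ 4" for w by (simp add: h_def)
  qed
  then have "expectation (\<lambda>w. \<Prod>i\<in>{k, k'}. h i (X i w)) = (\<Prod>i\<in>{k, k'}. expectation (\<lambda>w. h i (X i w)))"
    using assms by (intro expectation_prod_single) (auto simp: h_def)
  moreover have "expectation (\<lambda>w. h k (X k w)) = 0" using assms by (simp add: h_def mean)
  ultimately show ?thesis using False by (simp add: h_def)
qed (use assms expectation_sq in simp)

lemma expectation_quadruple:
  assumes "k \<in> I" "k' \<in> I" "j \<in> I" "j' \<in> I" "(k, k') \<noteq> (j, j')"
  shows "expectation (\<lambda>w. quad4 k k' j j' w) =
    (if k = k' \<and> j = j' then 1 else 0)"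
proof (cases "k = k' \<and> j = j'")
  case True
  then have "{k, k', j, j'} = {k, j}" "k \<noteq> j" using assms(5) by auto
  then show ?thesis
    using True expectation_prod4[OF assms(1-4)] expectation_sq[OF assms(1)] expectation_sq[OF assms(3)]
    by (simp add: quad4_factor_def mult.commute)
next
  case False
  have "\<exists>i\<in>{k, k', j, j'}. expectation (\<lambda>w. quad4_factor k k' j j' i (X i w)) = 0"
  proof -
    \<comment> \<open>In four of the cases some index occurs exactly once and its mean vanishes. In
      the third the pairs are crossed, the product is a conjugated square times a square, and the
      vanishing of the pseudo-variance is what removes it.\<close>
    consider "k \<noteq> k'" "k \<noteq> j" "k \<noteq> j'" | "k \<noteq> k'" "k' \<noteq> j" "k' \<noteq> j'" | "k \<noteq> k'" "k = j'" "k' = j" "j \<noteq> j'"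
      | "j \<noteq> j'" "j \<noteq> k" "j \<noteq> k'" | "j \<noteq> j'" "j' \<noteq> k" "j' \<noteq> k'"
      using False assms(5) by auto
    then show ?thesis
    proof cases
      case 1 then show ?thesis using expectation_cnj[OF assms(1)] by (intro bexI[of _ k]) (auto simp: quad4_factor_def)
    next
      case 2 then show ?thesis using mean[OF assms(2)] by (intro bexI[of _ k']) (auto simp: quad4_factor_def)
    next
      case 3 then show ?thesis using expectation_cnj_sq[OF assms(1)] by (intro bexI[of _ k]) (auto simp: quad4_factor_def)
    next
      case 4 then show ?thesis using mean[OF assms(3)] by (intro bexI[of _ j]) (auto simp: quad4_factor_def)
    next
      case 5 then show ?thesis using expectation_cnj[OF assms(4)] by (intro bexI[of _ j']) (auto simp: quad4_factor_def)
    qed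
  qed
  then have "(\<Prod>i\<in>{k, k', j, j'}. expectation (\<lambda>w. quad4_factor k k' j j' i (X i w))) = 0"
    by (intro prod_zero) auto
  then show ?thesis by (simp only: expectation_prod4[OF assms(1-4)] False if_False)
qed

lemma expectation_quadruple_same:
  assumes "k \<in> I" "k' \<in> I"
  shows "cmod (expectation (\<lambda>w. quad4 k k' k k' w)) \<le> \<kappa>"
proof (cases "k = k'")
  case True
  have "quad4 k k k k w = of_real (cmod (X k w) ^ 4)" for w
  proof -
    have "quad4 k k k k w = of_real ((cmod (X k w))^2) * of_real ((cmod (X k w))^2)"
      unfolding complex_norm_square by (simp add: mult_ac)
    then show ?thesis by (simp add: numeral_eq_Suc power2_eq_square mult_ac)
  qed
  then show ?thesis using kappa[OF assms(1)] True by (simp only: integral_complex_of_real norm_of_real) simp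
next
  case False
  moreover have "{k, k', k, k'} = {k, k'}" by auto
  ultimately have "expectation (\<lambda>w. quad4 k k' k k' w) = 1"
    using expectation_prod4[OF assms assms] expectation_sq[OF assms(1)] expectation_sq[OF assms(2)]
    by (simp add: quad4_factor_def mult.commute)
  then show ?thesis using kappa_ge_1[OF assms(1)] by simp
qed

text \<open>The deviation of a quadratic form from its trace is a linear combination of these
  variables. For distinct ordered pairs they are orthogonal.\<close>

definition centered :: "'i \<Rightarrow> 'i \<Rightarrow> 'a \<Rightarrow> complex" where
  "centered k k' w = cnj (X k w) * X k' w - (if k = k' then 1 else 0)"

lemma centered_inner:
  assumes "k \<in> I" "k' \<in> I" "j \<in> I" "j' \<in> I"
  shows "integrable M (\<lambda>w. centered k k' w * cnj (centered j j' w))"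
    and "expectation (\<lambda>w. centered k k' w * cnj (centered j j' w)) =
      expectation (\<lambda>w. quad4 k k' j j' w) - (if k = k' \<and> j = j' then 1 else 0)"
proof -
  define d d' :: complex where "d = (if k = k' then 1 else 0)" and "d' = (if j = j' then 1 else 0)"
  have eq: "centered k k' w * cnj (centered j j' w) =
      quad4 k k' j j' w - d' * (cnj (X k w) * X k' w)
      - d * (cnj (X j' w) * X j w) + d * d'" for w
    unfolding centered_def by (simp add: d_def d'_def algebra_simps)
  note int = integrable_prod4[OF assms] integrable_prod2[OF assms(1,2)] integrable_prod2[OF assms(4,3)]
  show "integrable M (\<lambda>w. centered k k' w * cnj (centered j j' w))"
    unfolding eq by (intro Bochner_Integration.integrable_add Bochner_Integration.integrable_diff int
      integrable_mult_right integrable_const)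
  have "expectation (\<lambda>w. centered k k' w * cnj (centered j j' w)) =
      expectation (\<lambda>w. quad4 k k' j j' w) -
      d' * expectation (\<lambda>w. cnj (X k w) * X k' w)
      - d * expectation (\<lambda>w. cnj (X j' w) * X j w) + d * d'"
    unfolding eq by (simp add: int prob_space)
  then show "expectation (\<lambda>w. centered k k' w * cnj (centered j j' w)) =
      expectation (\<lambda>w. quad4 k k' j j' w) - (if k = k' \<and> j = j' then 1 else 0)"
    unfolding expectation_pair_eq[OF assms(1,2)] expectation_pair_eq[OF assms(4,3)]
    by (auto simp: d_def d'_def)
qed

lemma centered_orthogonal:
  assumes "k \<in> I" "k' \<in> I" "j \<in> I" "j' \<in> I" "(k, k') \<noteq> (j, j')"
  shows "expectation (\<lambda>w. centered k k' w * cnj (centered j j' w)) = 0"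
  unfolding centered_inner(2)[OF assms(1-4)] expectation_quadruple[OF assms] by simp

lemma centered_norm:
  assumes "k \<in> I" "k' \<in> I"
  shows "integrable M (\<lambda>w. (cmod (centered k k' w))^2)"
    and "expectation (\<lambda>w. (cmod (centered k k' w))^2) \<le> \<kappa>"
proof -
  have eq: "(cmod (centered k k' w))^2 = Re (centered k k' w * cnj (centered k k' w))" for w
    by (simp only: complex_norm_square[symmetric] Re_complex_of_real)
  note int = centered_inner(1)[OF assms assms]
  show "integrable M (\<lambda>w. (cmod (centered k k' w))^2)" unfolding eq by (rule integrable_Re[OF int])
  have "expectation (\<lambda>w. (cmod (centered k k' w))^2) = 
      Re (expectation (\<lambda>w. centered k k' w * cnj (centered k k' w)))"
    unfolding eq by (rule integral_Re[OF int])
  also have "\<dots> \<le> Re (expectation (\<lambda>w. quad4 k k' k k' w))"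
    unfolding centered_inner(2)[OF assms assms] by simp
  also have "\<dots> \<le> \<kappa>"
    using expectation_quadruple_same[OF assms] complex_Re_le_cmod order_trans by blast
  finally show "expectation (\<lambda>w. (cmod (centered k k' w))^2) \<le> \<kappa>" .
qed

text \<open>By orthogonality the double sum over pairs collapses to its diagonal, where each squared
  norm is at most \<open>\<kappa>\<close>.\<close>

lemma quad_form_variance:
  fixes b :: "'i \<Rightarrow> 'i \<Rightarrow> complex"
  assumes "finite K" "K \<subseteq> I"
  shows "integrable M (\<lambda>w. (cmod (\<Sum>k\<in>K. \<Sum>k'\<in>K. b k k' * centered k k' w))^2)"
    and "expectation (\<lambda>w. (cmod (\<Sum>k\<in>K. \<Sum>k'\<in>K. b k k' * centered k k' w))^2) \<le>
      \<kappa> * (\<Sum>k\<in>K. \<Sum>k'\<in>K. (cmod (b k k'))^2)"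
proof -
  define \<phi> where "\<phi> a = centered (fst a) (snd a)" for a
  define \<beta> where "\<beta> a = b (fst a) (snd a)" for a
  have K: "fst a \<in> I" "snd a \<in> I" if "a \<in> K \<times> K" for a using that assms(2) by auto
  define Z where "Z w = (\<Sum>k\<in>K. \<Sum>k'\<in>K. b k k' * centered k k' w)" for w
  have Z: "Z w = (\<Sum>a\<in>K \<times> K. \<beta> a * \<phi> a w)" for w
    unfolding sum.cartesian_product Z_def by (intro sum.cong) (auto simp: \<beta>_def \<phi>_def)
  let ?Q = "\<lambda>w. \<Sum>a\<in>K \<times> K. \<Sum>a'\<in>K \<times> K. \<beta> a * cnj (\<beta> a') * (\<phi> a w * cnj (\<phi> a' w))"
  have sq: "(cmod (Z w))^2 = Re (?Q w)" for w
  proof -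
    have "of_real ((cmod (Z w))^2) = Z w * cnj (Z w)" by (rule complex_norm_square)
    also have "\<dots> = (?Q w)" unfolding Z cnj_sum sum_product by (intro sum.cong refl) (simp add: mult_ac)
    finally show ?thesis by (metis Re_complex_of_real)
  qed
  have int: "integrable M (\<lambda>w. \<phi> a w * cnj (\<phi> a' w))" if "a \<in> K \<times> K" "a' \<in> K \<times> K" for a a'
    unfolding \<phi>_def using K[OF that(1)] K[OF that(2)] by (intro centered_inner)
  have int': "integrable M ?Q" using int by (intro Bochner_Integration.integrable_sum integrable_mult_right)
  show "integrable M (\<lambda>w. (cmod (\<Sum>k\<in>K. \<Sum>k'\<in>K. b k k' * centered k k' w))^2)"
    unfolding Z_def[symmetric] sq by (rule integrable_Re[OF int'])
  have "expectation (\<lambda>w. (cmod (Z w))^2) =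
      Re (expectation ?Q)"
    unfolding sq by (rule integral_Re[OF int'])
  also have "\<dots> = Re (\<Sum>a\<in>K \<times> K. \<Sum>a'\<in>K \<times> K. \<beta> a * cnj (\<beta> a') * expectation (\<lambda>w. \<phi> a w * cnj (\<phi> a' w)))"
    using int by (subst Bochner_Integration.integral_sum, intro Bochner_Integration.integrable_sum integrable_mult_right, auto)
  also have "\<dots> = Re (\<Sum>a\<in>K \<times> K. \<beta> a * cnj (\<beta> a) * expectation (\<lambda>w. \<phi> a w * cnj (\<phi> a w)))"
  proof (intro arg_cong[of _ _ Re] sum.cong refl)
    fix a assume a: "a \<in> K \<times> K"
    have "(\<Sum>a'\<in>K \<times> K. \<beta> a * cnj (\<beta> a') * expectation (\<lambda>w. \<phi> a w * cnj (\<phi> a' w))) =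
        (\<Sum>a'\<in>K \<times> K. if a' = a then \<beta> a * cnj (\<beta> a) * expectation (\<lambda>w. \<phi> a w * cnj (\<phi> a w)) else 0)"
    proof (intro sum.cong refl)
      fix a' assume a': "a' \<in> K \<times> K"
      have "expectation (\<lambda>w. \<phi> a w * cnj (\<phi> a' w)) = 0" if "a' \<noteq> a"
        unfolding \<phi>_def using K[OF a] K[OF a'] that
        by (intro centered_orthogonal) (auto simp: prod_eq_iff)
      then show "\<beta> a * cnj (\<beta> a') * expectation (\<lambda>w. \<phi> a w * cnj (\<phi> a' w)) =
        (if a' = a then \<beta> a * cnj (\<beta> a) * expectation (\<lambda>w. \<phi> a w * cnj (\<phi> a w)) else 0)"
        by auto
    qed
    then show "(\<Sum>a'\<in>K \<times> K. \<beta> a * cnj (\<beta> a') * expectation (\<lambda>w. \<phi> a w * cnj (\<phi> a' w))) =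
        \<beta> a * cnj (\<beta> a) * expectation (\<lambda>w. \<phi> a w * cnj (\<phi> a w))"
      using a assms(1) by simp
  qed
  also have "\<dots> = (\<Sum>a\<in>K \<times> K. (cmod (\<beta> a))^2 * expectation (\<lambda>w. (cmod (\<phi> a w))^2))"
  proof -
    have "\<beta> a * cnj (\<beta> a) * expectation (\<lambda>w. \<phi> a w * cnj (\<phi> a w)) =
        of_real ((cmod (\<beta> a))^2 * expectation (\<lambda>w. (cmod (\<phi> a w))^2))" for a
      unfolding complex_norm_square[symmetric] integral_complex_of_real by simp
    then show ?thesis by (simp only: of_real_sum[symmetric] Re_complex_of_real)
  qed
  also have "\<dots> \<le> (\<Sum>a\<in>K \<times> K. (cmod (\<beta> a))^2 * \<kappa>)"
    unfolding \<phi>_def using K by (intro sum_mono mult_left_mono centered_norm) auto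
  also have "\<dots> = \<kappa> * (\<Sum>k\<in>K. \<Sum>k'\<in>K. (cmod (b k k'))^2)"
    unfolding sum.cartesian_product by (simp add: sum_distrib_left \<beta>_def case_prod_beta mult.commute)
  finally show "expectation (\<lambda>w. (cmod (\<Sum>k\<in>K. \<Sum>k'\<in>K. b k k' * centered k k' w))^2) \<le>
      \<kappa> * (\<Sum>k\<in>K. \<Sum>k'\<in>K. (cmod (b k k'))^2)"
    unfolding Z_def .
qed

end

section \<open>Random coefficients that are independent of the column\<close>

lemma borel_measurable_det:
  fixes A :: "'b \<Rightarrow> complex mat"
  assumes "\<And>x. A x \<in> carrier_mat n n"
    and "\<And>i j. i < n \<Longrightarrow> j < n \<Longrightarrow> (\<lambda>x. A x $$ (i, j)) \<in> borel_measurable N"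
  shows "(\<lambda>x. Determinant.det (A x)) \<in> borel_measurable N"
  unfolding det_def'[OF assms(1)]
proof (intro borel_measurable_sum borel_measurable_times borel_measurable_prod borel_measurable_const)
  fix p i assume "p \<in> {p. p permutes {0..<n}}" "i \<in> {0..<n}"
  then show "(\<lambda>x. A x $$ (i, p i)) \<in> borel_measurable N"
    using permutes_in_image[of p "{0..<n}" i] by (intro assms(2)) auto
qed

lemma borel_measurable_resolvent:
  fixes A :: "'b \<Rightarrow> nat \<Rightarrow> nat \<Rightarrow> complex"
  assumes "\<And>i j. i < P \<Longrightarrow> j < P \<Longrightarrow> (\<lambda>x. A x i j) \<in> borel_measurable N" "i < P" "j < P"
  shows "(\<lambda>x. resolvent P (A x) s i j) \<in> borel_measurable N"
proof -
  have entry: "(\<lambda>x. shift_mat P (A x) s $$ (i, j)) \<in> borel_measurable N" if "i < P" "j < P" for i j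
    using assms(1)[OF that] that by (simp add: shift_mat_def shifted_def)
  have det: "(\<lambda>x. Determinant.det (shift_mat P (A x) s)) \<in> borel_measurable N"
    by (rule borel_measurable_det[OF shift_mat_carrier entry])
  have "(\<lambda>x. Determinant.det (mat_delete (shift_mat P (A x) s) j i)) \<in> borel_measurable N"
  proof (rule borel_measurable_det[of _ "P - 1"])
    show "mat_delete (shift_mat P (A x) s) j i \<in> carrier_mat (P - 1) (P - 1)" for x
      by (rule mat_delete_carrier[OF shift_mat_carrier])
    show "(\<lambda>x. mat_delete (shift_mat P (A x) s) j i $$ (k, l)) \<in> borel_measurable N"
      if "k < P - 1" "l < P - 1" for k l
    proof -
      have "mat_delete (shift_mat P (A x) s) j i $$ (k, l) =
          shift_mat P (A x) s $$ (if k < j then k else Suc k, if l < i then l else Suc l)" for x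
        using that by (simp add: mat_delete_def shift_mat_def)
      then show ?thesis using that by (simp only:) (intro entry, auto)
    qed
  qed
  moreover have "adj_mat (shift_mat P (A x) s) $$ (i, j) =
      (-1) ^ (j + i) * Determinant.det (mat_delete (shift_mat P (A x) s) j i)" for x
    using assms(2,3) by (simp add: adj_mat_def cofactor_def shift_mat_def)
  ultimately show ?thesis unfolding resolvent_def using det by simp
qed

context iid_entries
begin

text \<open>The joint law of the entries in \<open>K\<close> and in \<open>D\<close> is a product
  measure. By Tonelli the coefficients can be frozen while integrating over the entries in
  \<open>K\<close>, and the bound for constant coefficients applies.\<close>

lemma quad_form_variance_indep:
  fixes b :: "'i \<Rightarrow> 'i \<Rightarrow> ('i \<Rightarrow> complex) \<Rightarrow> complex"
  assumes K: "finite K" "K \<subseteq> I" and D: "D \<subseteq> I" "K \<inter> D = {}"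
    and b: "\<And>k k'. k \<in> K \<Longrightarrow> k' \<in> K \<Longrightarrow> b k k' \<in> borel_measurable (PiM D (\<lambda>_. borel))"
  shows "nn_mean (\<lambda>w. (cmod (\<Sum>k\<in>K. \<Sum>k'\<in>K. b k k' (restrict (\<lambda>i. X i w) D) * centered k k' w))^2)
    \<le> ennreal \<kappa> * nn_mean (\<lambda>w. \<Sum>k\<in>K. \<Sum>k'\<in>K. (cmod (b k k' (restrict (\<lambda>i. X i w) D)))^2)"
proof (cases "K = {}")
  case False
  then obtain k0 where "k0 \<in> I" using K by auto
  then have kappa0: "0 \<le> \<kappa>" using kappa_ge_1[of k0] by simp
  define R where "R A w = restrict (\<lambda>i. X i w) A" for A w
  let ?PK = "PiM K (\<lambda>_. borel :: complex measure)" and ?PD = "PiM D (\<lambda>_. borel :: complex measure)"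
  let ?B = "\<lambda>d. \<Sum>k\<in>K. \<Sum>k'\<in>K. (cmod (b k k' d))^2"
  define f where "f c d = ennreal ((cmod (\<Sum>k\<in>K. \<Sum>k'\<in>K. b k k' d * (cnj (c k) * c k' - (if k = k' then 1 else 0))))^2)" for c d
  have ind: "indep_var ?PK (R K) ?PD (R D)"
    unfolding R_def[abs_def] by (rule indep_var_restrict[OF indep D(2) K(2) D(1)])
  have rv[measurable]: "R K \<in> measurable M ?PK" "R D \<in> measurable M ?PD"
    using indep_var_rv1[OF ind] indep_var_rv2[OF ind] by auto
  have joint: "distr M ?PK (R K) \<Otimes>\<^sub>M distr M ?PD (R D) = distr M (?PK \<Otimes>\<^sub>M ?PD) (\<lambda>w. (R K w, R D w))"
    using ind unfolding indep_var_distribution_eq by auto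
  interpret PK: prob_space "distr M ?PK (R K)"
    by (rule prob_space_distr) (rule rv)
  interpret PD: prob_space "distr M ?PD (R D)"
    by (rule prob_space_distr) (rule rv)
  interpret PP: pair_sigma_finite "distr M ?PK (R K)" "distr M ?PD (R D)" ..
  have b2: "(\<lambda>x. b k k' (snd x)) \<in> borel_measurable (?PK \<Otimes>\<^sub>M ?PD)" if "k \<in> K" "k' \<in> K" for k k'
    by (rule measurable_compose[OF measurable_snd b[OF that]])
  have c2: "(\<lambda>x. fst x k) \<in> borel_measurable (?PK \<Otimes>\<^sub>M ?PD)" if "k \<in> K" for k
    by (rule measurable_compose[OF measurable_fst measurable_component_singleton[OF that]])
  have f_meas: "(\<lambda>x. f (fst x) (snd x)) \<in> borel_measurable (?PK \<Otimes>\<^sub>M ?PD)"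
    unfolding f_def using b2 c2
    by (intro measurable_compose[OF _ measurable_ennreal] borel_measurable_power borel_measurable_norm
      borel_measurable_sum borel_measurable_times borel_measurable_diff measurable_compose[OF _ measurable_cnj]) auto
  have fd_meas: "(\<lambda>c. f c d) \<in> borel_measurable ?PK" for d
    unfolding f_def
    by (intro measurable_compose[OF _ measurable_ennreal] borel_measurable_power borel_measurable_norm
      borel_measurable_sum borel_measurable_times borel_measurable_diff measurable_compose[OF _ measurable_cnj]
      measurable_component_singleton borel_measurable_const) auto
  have cen: "centered k k' w = cnj (R K w k) * R K w k' - (if k = k' then 1 else 0)" if "k \<in> K" "k' \<in> K" for k k' w
    using that by (simp add: centered_def R_def)
  have "nn_mean (\<lambda>w. (cmod (\<Sum>k\<in>K. \<Sum>k'\<in>K. b k k' (R D w) * centered k k' w))^2) =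
      (\<integral>\<^sup>+w. f (R K w) (R D w) \<partial>M)"
    unfolding f_def by (simp add: cen cong: sum.cong)
  also have "\<dots> = (\<integral>\<^sup>+x. f (fst x) (snd x) \<partial>distr M (?PK \<Otimes>\<^sub>M ?PD) (\<lambda>w. (R K w, R D w)))"
    by (subst nn_integral_distr) (use f_meas in auto)
  also have "\<dots> = (\<integral>\<^sup>+d. \<integral>\<^sup>+c. f c d \<partial>distr M ?PK (R K) \<partial>distr M ?PD (R D))"
    unfolding joint[symmetric] using f_meas by (subst PP.nn_integral_snd[symmetric]) (auto simp: case_prod_beta)
  also have "\<dots> \<le> (\<integral>\<^sup>+d. ennreal \<kappa> * ennreal (?B d) \<partial>distr M ?PD (R D))"
  proof (rule nn_integral_mono)
    fix d
    have "(\<integral>\<^sup>+c. f c d \<partial>distr M ?PK (R K)) = (\<integral>\<^sup>+w. f (R K w) d \<partial>M)"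
      by (rule nn_integral_distr) (use rv fd_meas in auto)
    also have "\<dots> = nn_mean (\<lambda>w. (cmod (\<Sum>k\<in>K. \<Sum>k'\<in>K. b k k' d * centered k k' w))^2)"
      unfolding f_def by (simp add: cen cong: sum.cong)
    also have "\<dots> = ennreal (expectation (\<lambda>w. (cmod (\<Sum>k\<in>K. \<Sum>k'\<in>K. b k k' d * centered k k' w))^2))"
      by (rule nn_integral_eq_integral[OF quad_form_variance(1)[OF K]]) simp
    also have "\<dots> \<le> ennreal (\<kappa> * (?B d))"
      by (rule ennreal_leI[OF quad_form_variance(2)[OF K]])
    also have "\<dots> = ennreal \<kappa> * ennreal (?B d)"
      using kappa0 by (intro ennreal_mult sum_nonneg) auto
    finally show "(\<integral>\<^sup>+c. f c d \<partial>distr M ?PK (R K)) \<le> ennreal \<kappa> * ennreal (?B d)" .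
  qed
  also have "\<dots> = (\<integral>\<^sup>+w. ennreal \<kappa> * ennreal (?B (R D w)) \<partial>M)"
    by (rule nn_integral_distr) (use rv b in auto)
  also have "\<dots> = ennreal \<kappa> * nn_mean (\<lambda>w. \<Sum>k\<in>K. \<Sum>k'\<in>K. (cmod (b k k' (R D w)))^2)"
  proof (intro nn_integral_cmult measurable_compose[OF _ measurable_ennreal] borel_measurable_sum borel_measurable_power)
    fix k k' assume "k \<in> K" "k' \<in> K"
    then show "(\<lambda>w. cmod (b k k' (R D w))) \<in> borel_measurable M"
      by (intro measurable_compose[OF _ borel_measurable_norm] measurable_compose[OF rv(2) b])
  qed
  finally show ?thesis
    unfolding R_def .
qed simp

end

text \<open>A series of nonnegative variables with summable means converges almost surely, so its
  terms tend to 0.\<close>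

lemma (in prob_space) AE_tendsto_0:
  fixes f :: "nat \<Rightarrow> 'a \<Rightarrow> real" and a :: "nat \<Rightarrow> real"
  assumes meas: "\<And>k. f k \<in> borel_measurable M" and nonneg: "\<And>k w. 0 \<le> f k w"
    and le: "\<And>k. nn_mean (\<lambda>w. f k w) \<le> ennreal (a k)" and "summable a" "\<And>k. 0 \<le> a k"
  shows "AE w in M. (\<lambda>k. f k w) \<longlonglongrightarrow> 0"
proof -
  have "(\<integral>\<^sup>+w. (\<Sum>k. ennreal (f k w)) \<partial>M) = (\<Sum>k. \<integral>\<^sup>+w. ennreal (f k w) \<partial>M)"
    using meas by (intro nn_integral_suminf) auto
  also have "\<dots> \<le> (\<Sum>k. ennreal (a k))" using le by (intro suminf_le) auto
  also have "\<dots> = ennreal (\<Sum>k. a k)" by (rule suminf_ennreal2) (use assms in auto)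
  finally have "(\<integral>\<^sup>+w. (\<Sum>k. ennreal (f k w)) \<partial>M) \<noteq> \<infinity>"
    by (auto simp: top_unique)
  then have "AE w in M. (\<Sum>k. ennreal (f k w)) \<noteq> \<infinity>"
    using meas by (intro nn_integral_noteq_infinite) auto
  then show ?thesis
  proof (rule AE_mp, intro AE_I2 impI)
    fix w assume "(\<Sum>k. ennreal (f k w)) \<noteq> \<infinity>"
    then have "summable (\<lambda>k. f k w)" using nonneg by (intro summable_suminf_not_top) auto
    then show "(\<lambda>k. f k w) \<longlonglongrightarrow> 0" by (rule summable_LIMSEQ_zero)
  qed
qed

section \<open>The infinite random array and its leave-one-out errors\<close>

locale random_matrix = iid_entries M "\<lambda>(i, m). Y i m" UNIV \<kappa>
  for M :: "'a measure" and Y :: "nat \<Rightarrow> nat \<Rightarrow> 'a \<Rightarrow> complex" and \<kappa> :: real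
begin

definition entries :: "'a \<Rightarrow> nat \<Rightarrow> nat \<Rightarrow> complex" where
  "entries w i m = Y i m w"

lemma Y_meas[measurable]: "Y i m \<in> borel_measurable M"
  using meas[of "(i, m)"] by simp

lemma entries_meas: "(\<lambda>w. entries w i m) \<in> borel_measurable M"
  unfolding entries_def by measurable

lemma kappa_1: "1 \<le> \<kappa>"
  by (rule kappa_ge_1[of undefined]) simp

lemma gram_meas[measurable]: "(\<lambda>w. gram (entries w) S i j) \<in> borel_measurable M"
  unfolding gram_def entries_def by measurable

text \<open>The coefficients are given as functions of the coordinates in
  \<open>UNIV \<times> S\<close>; their independence of column \<open>l\<close> is then just
  disjointness of index sets.\<close>

lemma column_quad_form_variance:
  fixes B :: "nat \<Rightarrow> nat \<Rightarrow> (nat \<times> nat \<Rightarrow> complex) \<Rightarrow> complex"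
  assumes "l \<notin> S"
    and B: "\<And>i j. i < P \<Longrightarrow> j < P \<Longrightarrow> B i j \<in> borel_measurable (PiM (UNIV \<times> S) (\<lambda>_. borel))"
  defines "\<beta> \<equiv> \<lambda>w i j. B i j (restrict (\<lambda>(i, m). entries w i m) (UNIV \<times> S))"
  shows "nn_mean (\<lambda>w. (quad_dev P (\<beta> w) (\<lambda>i. entries w i l))^2)
    \<le> ennreal \<kappa> * nn_mean (\<lambda>w. frobenius P (\<beta> w))"
proof -
  let ?r = "\<lambda>w. restrict (\<lambda>(i, m). entries w i m) (UNIV \<times> S)"
  let ?K = "(\<lambda>i. (i, l)) ` {..<P}"
  define b where "b k k' = B (fst k) (fst k')" for k k' :: "nat \<times> nat"
  have inj: "inj_on (\<lambda>i. (i, l)) {..<P}" by (auto simp: inj_on_def)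
  have rho: "restrict (\<lambda>i. (case i of (i, m) \<Rightarrow> Y i m) w) (UNIV \<times> S) = ?r w" for w
    by (auto simp: restrict_def entries_def)
  have cen: "centered (i, l) (j, l) w = cnj (entries w i l) * entries w j l - (if i = j then 1 else 0)" for i j w
    by (simp add: centered_def entries_def)
  have eq1: "quad_form P (\<beta> w) (\<lambda>i. entries w i l) - (\<Sum>i<P. \<beta> w i i) =
      (\<Sum>k\<in>?K. \<Sum>k'\<in>?K. b k k' (?r w) * centered k k' w)" for w
  proof -
    have "(\<Sum>k\<in>?K. \<Sum>k'\<in>?K. b k k' (?r w) * centered k k' w) =
        (\<Sum>i<P. \<Sum>j<P. cnj (entries w i l) * \<beta> w i j * entries w j l - (if i = j then \<beta> w i i else 0))"
      unfolding sum.reindex[OF inj] o_def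
      by (intro sum.cong refl) (simp add: b_def \<beta>_def cen algebra_simps)
    also have "\<dots> = quad_form P (\<beta> w) (\<lambda>i. entries w i l) - (\<Sum>i<P. \<beta> w i i)"
      unfolding quad_form_def by (simp add: sum_subtractf)
    finally show ?thesis by simp
  qed
  have eq2: "frobenius P (\<beta> w) =
      (\<Sum>k\<in>?K. \<Sum>k'\<in>?K. (cmod (b k k' (?r w)))^2)" for w
    unfolding sum.reindex[OF inj] o_def by (simp add: b_def \<beta>_def)
  have "b k k' \<in> borel_measurable (PiM (UNIV \<times> S) (\<lambda>_. borel))" if "k \<in> ?K" "k' \<in> ?K" for k k'
    using that by (auto simp: b_def intro: B)
  moreover have "?K \<inter> UNIV \<times> S = {}" using assms(1) by auto
  ultimately show ?thesis unfolding eq1 eq2 rho[symmetric] by (intro quad_form_variance_indep) auto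
qed

lemma gram_restrict:
  "gram (\<lambda>i m. restrict (\<lambda>(i, m). entries w i m) (UNIV \<times> S) (i, m)) S = gram (entries w) S"
  by (simp add: gram_def[abs_def])

lemma gram_coordinate_meas:
  "(\<lambda>d. gram (\<lambda>i m. d (i, m)) S i j) \<in> borel_measurable (PiM (UNIV \<times> S) (\<lambda>_. borel))"
  unfolding gram_def
  by (intro borel_measurable_sum borel_measurable_times measurable_compose[OF _ measurable_cnj]
      measurable_component_singleton) auto

text \<open>Cauchy--Schwarz, at the price of the factor \<open>N^2\<close>: the errors of different
  columns are not independent, as each one involves the other columns too.\<close>

lemma square_sum_bound:
  fixes f :: "nat \<Rightarrow> 'a \<Rightarrow> real"
  assumes meas: "\<And>l. l < N \<Longrightarrow> f l \<in> borel_measurable M"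
    and le: "\<And>l. l < N \<Longrightarrow> nn_mean (\<lambda>w. (f l w)^2) \<le> ennreal b" and "0 \<le> b"
  shows "nn_mean (\<lambda>w. (\<Sum>l<N. f l w)^2) \<le> ennreal ((real N)^2 * b)"
proof -
  have "nn_mean (\<lambda>w. (\<Sum>l<N. f l w)^2) \<le> (\<integral>\<^sup>+w. ennreal N * (\<Sum>l<N. ennreal ((f l w)^2)) \<partial>M)"
  proof (rule nn_integral_mono)
    fix w
    have "ennreal ((\<Sum>l<N. f l w)^2) \<le> ennreal (N * (\<Sum>l<N. (f l w)^2))"
      using sum_squared_le_sum_of_squares[of "\<lambda>l. f l w" "{..<N}"] by (intro ennreal_leI) (simp add: mult.commute)
    also have "\<dots> = ennreal N * (\<Sum>l<N. ennreal ((f l w)^2))" by (simp add: ennreal_mult sum_nonneg)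
    finally show "ennreal ((\<Sum>l<N. f l w)^2) \<le> ennreal N * (\<Sum>l<N. ennreal ((f l w)^2))" .
  qed
  also have "\<dots> = ennreal N * (\<integral>\<^sup>+w. (\<Sum>l<N. ennreal ((f l w)^2)) \<partial>M)"
    using meas by (intro nn_integral_cmult) auto
  also have "(\<integral>\<^sup>+w. (\<Sum>l<N. ennreal ((f l w)^2)) \<partial>M) = (\<Sum>l<N. \<integral>\<^sup>+w. ennreal ((f l w)^2) \<partial>M)"
    using meas by (intro nn_integral_sum) auto
  also have "ennreal N * \<dots> \<le> ennreal N * (\<Sum>l<N. ennreal b)"
    using le by (intro mult_left_mono sum_mono) auto
  also have "\<dots> = ennreal ((real N)^2 * b)"
    using assms(3) by (simp add: ennreal_mult power2_eq_square mult.assoc ennreal_of_nat_eq_real_of_nat)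
  finally show ?thesis .
qed

text \<open>Used twice: with \<open>F\<close> the resolvent for the limiting equation, and with
  \<open>F\<close> the identity to bound \<open>Tr A^2\<close>.\<close>

definition loo_error :: "((nat \<Rightarrow> nat \<Rightarrow> complex) \<Rightarrow> nat \<Rightarrow> nat \<Rightarrow> complex) \<Rightarrow> nat \<Rightarrow> nat \<Rightarrow> 'a \<Rightarrow> real" where
  "loo_error F P N w = (\<Sum>l<N. quad_dev P (F (gram (entries w) ({..<N} - {l}))) (\<lambda>i. entries w i l))"

lemma loo_error_second_moment:
  assumes F: "\<And>(S :: nat set) i j. i < P \<Longrightarrow> j < P \<Longrightarrow>
      (\<lambda>d. F (gram (\<lambda>i m. d (i, m)) S) i j) \<in> borel_measurable (PiM (UNIV \<times> S) (\<lambda>_. borel))"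
    and b: "\<And>l. nn_mean (\<lambda>w. frobenius P (F (gram (entries w) ({..<N} - {l})))) \<le> ennreal b" "0 \<le> b"
  shows "loo_error F P N \<in> borel_measurable M"
    and "nn_mean (\<lambda>w. (loo_error F P N w)^2) \<le> ennreal ((real N)^2 * (\<kappa> * b))"
proof -
  have F': "(\<lambda>w. F (gram (entries w) S) i j) \<in> borel_measurable M" if "i < P" "j < P" for S i j
  proof -
    have "(\<lambda>w. restrict (\<lambda>(i, m). entries w i m) (UNIV \<times> S)) \<in> measurable M (PiM (UNIV \<times> S) (\<lambda>_. borel))"
      by (intro measurable_restrict) (auto intro: entries_meas)
    from measurable_compose[OF this F[OF that]] show ?thesis
      unfolding gram_restrict .
  qed
  have dev: "(\<lambda>w. quad_dev P (F (gram (entries w) S)) (\<lambda>i. entries w i l)) \<in> borel_measurable M" for S l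
    unfolding quad_form_def
    by (intro borel_measurable_sum measurable_compose[OF _ borel_measurable_norm] borel_measurable_diff borel_measurable_times
      F' entries_meas measurable_compose[OF entries_meas measurable_cnj]) auto
  show "loo_error F P N \<in> borel_measurable M"
    unfolding loo_error_def[abs_def] by (intro borel_measurable_sum dev)
  show "nn_mean (\<lambda>w. (loo_error F P N w)^2) \<le> ennreal ((real N)^2 * (\<kappa> * b))"
    unfolding loo_error_def
  proof (rule square_sum_bound[OF dev])
    fix l
    have "nn_mean (\<lambda>w. (quad_dev P (F (gram (entries w) ({..<N} - {l}))) (\<lambda>i. entries w i l))^2) \<le>
        ennreal \<kappa> * nn_mean (\<lambda>w. frobenius P (F (gram (entries w) ({..<N} - {l}))))"
      using column_quad_form_variance[of l "{..<N} - {l}" P "\<lambda>i j d. F (gram (\<lambda>i m. d (i, m)) ({..<N} - {l})) i j", OF _ F]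
      unfolding gram_restrict by simp
    also have "\<dots> \<le> ennreal \<kappa> * ennreal b" by (intro mult_left_mono b) simp
    also have "\<dots> = ennreal (\<kappa> * b)" using kappa_1 b(2) by (intro ennreal_mult[symmetric]) auto
    finally show "nn_mean (\<lambda>w. (quad_dev P (F (gram (entries w) ({..<N} - {l}))) (\<lambda>i. entries w i l))^2) \<le> ennreal (\<kappa> * b)" .
  qed (use kappa_1 b in auto)
qed

definition resolvent_error :: "nat \<Rightarrow> nat \<Rightarrow> real \<Rightarrow> 'a \<Rightarrow> real" where
  "resolvent_error P N s = loo_error (\<lambda>A. resolvent P A s) P N"

text \<open>For \<open>s = N t\<close> and \<open>P\<close> of order \<open>N\<close> the bound is
  of order \<open>N\<close>. Divided by \<open>N\<close>, the error has second moment O(1 / N),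
  summable when \<open>N\<close> runs through the squares.\<close>

lemma resolvent_error_second_moment:
  assumes "0 < s"
  shows "resolvent_error P N s \<in> borel_measurable M"
    and "nn_mean (\<lambda>w. (resolvent_error P N s w)^2) \<le> ennreal ((real N)^2 * (\<kappa> * (P / s^2)))"
proof -
  have "nn_mean (\<lambda>w. frobenius P (resolvent P (gram (entries w) S) s)) \<le> nn_mean (\<lambda>w. P / s^2)" for S
    using resolvent_frobenius[OF psd_gram assms] by (intro nn_integral_mono ennreal_leI) (subst sum.swap)
  then have b: "nn_mean (\<lambda>w. frobenius P (resolvent P (gram (entries w) S) s)) \<le> ennreal (P / s^2)" for S
    by (simp add: emeasure_space_1)
  note loo = loo_error_second_moment[of P "\<lambda>A. resolvent P A s", OF borel_measurable_resolvent[OF gram_coordinate_meas] b]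
  show "resolvent_error P N s \<in> borel_measurable M"
    unfolding resolvent_error_def by (rule loo(1)) simp_all
  show "nn_mean (\<lambda>w. (resolvent_error P N s w)^2) \<le> ennreal ((real N)^2 * (\<kappa> * (P / s^2)))"
    unfolding resolvent_error_def by (rule loo(2)) simp_all
qed

text \<open>The case of the identity quadratic form in all the entries of the matrix.\<close>

lemma trace_gram_variance:
  assumes "finite S"
  shows "nn_mean (\<lambda>w. (cmod ((\<Sum>i<P. gram (entries w) S i i) - of_nat (P * card S)))^2) \<le>
    ennreal (\<kappa> * (P * card S))"
proof -
  let ?K = "{..<P} \<times> S"
  let ?b = "\<lambda>k k'. if k = k' then 1 else 0 :: complex"
  have K: "finite ?K" "?K \<subseteq> UNIV" using assms by auto
  have "(\<Sum>k\<in>?K. \<Sum>k'\<in>?K. ?b k k' * centered k k' w) = (\<Sum>k\<in>?K. centered k k w)" for w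
    using assms by (intro sum.cong refl) (simp add: if_distrib if_distribR cong: if_cong)
  also have "(\<Sum>k\<in>?K. centered k k w) = (\<Sum>i<P. gram (entries w) S i i) - of_nat (P * card S)" for w
    by (simp add: centered_def sum_subtractf sum.cartesian_product' card_cartesian_product gram_def entries_def mult.commute case_prod_beta)
  finally have eq: "(\<Sum>k\<in>?K. \<Sum>k'\<in>?K. ?b k k' * centered k k' w) = (\<Sum>i<P. gram (entries w) S i i) - of_nat (P * card S)" for w .
  have "(\<Sum>k\<in>?K. \<Sum>k'\<in>?K. (cmod (?b k k'))^2) = (\<Sum>k\<in>?K. 1)"
    using assms by (intro sum.cong refl) (simp add: if_distrib if_distribR cong: if_cong)
  then have s: "(\<Sum>k\<in>?K. \<Sum>k'\<in>?K. (cmod (?b k k'))^2) = P * card S"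
    by (simp add: card_cartesian_product)
  show ?thesis
    using quad_form_variance[OF K, of ?b] nn_integral_eq_integral[OF quad_form_variance(1)[OF K, of ?b]]
    unfolding eq s by (simp add: ennreal_leI)
qed

lemma gram_entry_variance:
  assumes "finite S"
  shows "nn_mean (\<lambda>w. (cmod (gram (entries w) S i j - (if i = j then of_nat (card S) else 0)))^2) \<le> ennreal (\<kappa> * card S)"
proof -
  let ?K = "{i, j} \<times> S"
  \<comment> \<open>These coefficients pick out entry \<open>(i, j)\<close>. The indices are swapped
    because \<open>gram\<close> conjugates its second factor and \<open>centered\<close> its
    first.\<close>
  let ?b = "\<lambda>k k'. if fst k = j \<and> fst k' = i \<and> snd k = snd k' then 1 else 0 :: complex"
  have K: "finite ?K" "?K \<subseteq> UNIV" using assms by auto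
  have red: "(\<Sum>k\<in>?K. \<Sum>k'\<in>?K. if fst k = j \<and> fst k' = i \<and> snd k = snd k' then f k k' else 0) =
      (\<Sum>m\<in>S. f (j, m) (i, m))" for f :: "nat \<times> nat \<Rightarrow> nat \<times> nat \<Rightarrow> 'c::comm_monoid_add"
  proof -
    have "(\<Sum>k\<in>?K. \<Sum>k'\<in>?K. if fst k = j \<and> fst k' = i \<and> snd k = snd k' then f k k' else 0) =
        (\<Sum>k\<in>?K. if fst k = j then f k (i, snd k) else 0)"
    proof (intro sum.cong refl)
      fix k assume k: "k \<in> ?K"
      have "(\<Sum>k'\<in>?K. if fst k = j \<and> fst k' = i \<and> snd k = snd k' then f k k' else 0) =
          (\<Sum>k'\<in>?K. if k' = (i, snd k) then (if fst k = j then f k k' else 0) else 0)"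
        by (intro sum.cong refl) (auto simp: prod_eq_iff)
      also have "\<dots> = (if fst k = j then f k (i, snd k) else 0)" using k assms by (subst sum.delta) auto
      finally show "(\<Sum>k'\<in>?K. if fst k = j \<and> fst k' = i \<and> snd k = snd k' then f k k' else 0) =
        (if fst k = j then f k (i, snd k) else 0)" .
    qed
    also have "\<dots> = (\<Sum>a\<in>{i, j}. \<Sum>m\<in>S. if a = j then f (a, m) (i, m) else 0)"
      unfolding sum.cartesian_product by (intro sum.cong refl) auto
    also have "\<dots> = (\<Sum>a\<in>{i, j}. if a = j then \<Sum>m\<in>S. f (a, m) (i, m) else 0)"
      by (intro sum.cong refl) simp
    also have "\<dots> = (\<Sum>m\<in>S. f (j, m) (i, m))" by (subst sum.delta) auto
    finally show ?thesis .
  qed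
  have "(\<Sum>k\<in>?K. \<Sum>k'\<in>?K. ?b k k' * centered k k' w) =
      (\<Sum>k\<in>?K. \<Sum>k'\<in>?K. if fst k = j \<and> fst k' = i \<and> snd k = snd k' then centered k k' w else 0)" for w
    by (intro sum.cong refl) simp
  also have "\<dots> w = gram (entries w) S i j - (if i = j then of_nat (card S) else 0)" for w
    unfolding red by (simp add: centered_def sum_subtractf gram_def entries_def mult.commute)
  finally have eq: "(\<Sum>k\<in>?K. \<Sum>k'\<in>?K. ?b k k' * centered k k' w) =
      gram (entries w) S i j - (if i = j then of_nat (card S) else 0)" for w .
  have "(\<Sum>k\<in>?K. \<Sum>k'\<in>?K. (cmod (?b k k'))^2) =
      (\<Sum>k\<in>?K. \<Sum>k'\<in>?K. if fst k = j \<and> fst k' = i \<and> snd k = snd k' then 1 else 0)"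
    by (intro sum.cong refl) simp
  also have "\<dots> = card S" unfolding red by simp
  finally have s: "(\<Sum>k\<in>?K. \<Sum>k'\<in>?K. (cmod (?b k k'))^2) = card S" .
  show ?thesis
    using quad_form_variance[OF K, of ?b] nn_integral_eq_integral[OF quad_form_variance(1)[OF K, of ?b]]
    unfolding eq s by (simp add: ennreal_leI)
qed

end

section \<open>Almost sure convergence\<close>

lemma trace_gram:
  fixes P :: nat
  shows "(\<Sum>i<P. gram Y S i i) = of_real (\<Sum>i<P. \<Sum>m\<in>S. (cmod (Y i m))^2)"
  unfolding gram_def of_real_sum complex_norm_square ..

lemma quad_form_gram_remove:
  assumes "finite S" "l \<in> S"
  shows "Re (quad_form P (gram Y S) (\<lambda>i. Y i l)) =
    Re (quad_form P (gram Y (S - {l})) (\<lambda>i. Y i l)) + (\<Sum>i<P. (cmod (Y i l))^2)^2"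
proof -
  have "(\<Sum>i<P. cnj (Y i l) * Y i l) = of_real (\<Sum>i<P. (cmod (Y i l))^2)"
    unfolding of_real_sum complex_norm_square by (simp add: mult.commute)
  then have "(cmod (\<Sum>i<P. cnj (Y i l) * Y i l))^2 = (\<Sum>i<P. (cmod (Y i l))^2)^2"
    by (simp only: norm_of_real power2_abs)
  moreover have "(\<Sum>m\<in>S. (cmod (\<Sum>i<P. cnj (Y i l) * Y i m))^2) =
      (cmod (\<Sum>i<P. cnj (Y i l) * Y i l))^2 + (\<Sum>m\<in>S - {l}. (cmod (\<Sum>i<P. cnj (Y i l) * Y i m))^2)"
    by (rule sum.remove[OF assms])
  ultimately show ?thesis unfolding quad_form_gram Re_complex_of_real by linarith
qed

text \<open>The traces of the squares of \<open>Y Y*\<close> and \<open>Y* Y\<close> agree. One form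
  is a nonnegative sum over pairs of rows, the other over pairs of columns, which makes the quantity
  monotone in both dimensions.\<close>

lemma gram_frobenius_eq:
  fixes P :: nat
  shows "frobenius P (gram Y S) = (\<Sum>l\<in>S. \<Sum>m\<in>S. (cmod (\<Sum>i<P. cnj (Y i l) * Y i m))^2)"
proof -
  have "complex_of_real (frobenius P (gram Y S)) = (\<Sum>i<P. \<Sum>j<P. gram Y S i j * gram Y S j i)"
    unfolding of_real_sum complex_norm_square by (intro sum.cong refl) (metis gram_cnj)
  also have "\<dots> = (\<Sum>i<P. \<Sum>j<P. \<Sum>l\<in>S. cnj (Y i l) * gram Y S i j * Y j l)"
    by (intro sum.cong refl) (simp add: gram_def[of Y S j i for j i] sum_distrib_left mult_ac)
  also have "\<dots> = (\<Sum>i<P. \<Sum>l\<in>S. \<Sum>j<P. cnj (Y i l) * gram Y S i j * Y j l)"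
    by (intro sum.cong refl sum.swap)
  also have "\<dots> = (\<Sum>l\<in>S. quad_form P (gram Y S) (\<lambda>i. Y i l))"
    unfolding quad_form_def by (rule sum.swap)
  also have "\<dots> = of_real (\<Sum>l\<in>S. \<Sum>m\<in>S. (cmod (\<Sum>i<P. cnj (Y i l) * Y i m))^2)"
    unfolding quad_form_gram of_real_sum ..
  finally show ?thesis
    unfolding of_real_eq_iff .
qed

text \<open>Carries the bound from a square dimension to all smaller ones.\<close>

lemma gram_frobenius_mono:
  fixes P P' :: nat
  assumes "P \<le> P'" "S \<subseteq> S'" "finite S'"
  shows "frobenius P (gram Y S) \<le> frobenius P' (gram Y S')"
proof -
  have "frobenius P (gram Y S) \<le> frobenius P (gram Y S')"
    unfolding gram_frobenius_eq unfolding sum.cartesian_product using assms(2,3) by (intro sum_mono2) auto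
  also have "\<dots> \<le> frobenius P' (gram Y S')"
    unfolding sum.cartesian_product using assms(1) by (intro sum_mono2) auto
  finally show ?thesis .
qed

text \<open>Leaving one column \<open>y\<close> out again: its quadratic form in \<open>A\<close> is
  the fourth power of its norm plus the form in the remaining Gram matrix. The latter is within
  \<open>quad_dev\<close> of a trace that is at most \<open>T\<close>, and the squared norm of
  \<open>y\<close> is compared with its mean \<open>P\<close>.\<close>

lemma gram_frobenius_bound:
  fixes P :: nat
  assumes "finite S" and T_def: "T = (\<Sum>i<P. \<Sum>m\<in>S. (cmod (Y i m))^2)"
  shows "frobenius P (gram Y S) \<le>
    2 * (\<Sum>l\<in>S. ((\<Sum>i<P. (cmod (Y i l))^2) - P)^2) + card S * (2 * (real P)^2 + T) +
    (\<Sum>l\<in>S. quad_dev P (gram Y (S - {l})) (\<lambda>i. Y i l))"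
proof -
  let ?c = "\<lambda>l. \<Sum>i<P. (cmod (Y i l))^2"
  let ?e = "\<lambda>l. quad_dev P (gram Y (S - {l})) (\<lambda>i. Y i l)"
  have "frobenius P (gram Y S) = (\<Sum>l\<in>S. Re (quad_form P (gram Y S) (\<lambda>i. Y i l)))"
    unfolding gram_frobenius_eq quad_form_gram Re_complex_of_real ..
  also have "\<dots> \<le> (\<Sum>l\<in>S. 2 * (?c l - P)^2 + (2 * (real P)^2 + T) + ?e l)"
  proof (rule sum_mono)
    fix l assume l: "l \<in> S"
    have "Re (quad_form P (gram Y (S - {l})) (\<lambda>i. Y i l) - (\<Sum>i<P. gram Y (S - {l}) i i)) \<le> ?e l"
      by (rule complex_Re_le_cmod)
    then have "Re (quad_form P (gram Y (S - {l})) (\<lambda>i. Y i l)) \<le> ?e l + (\<Sum>i<P. \<Sum>m\<in>S - {l}. (cmod (Y i m))^2)"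
      unfolding trace_gram minus_complex.sel Re_complex_of_real by linarith
    also have "(\<Sum>i<P. \<Sum>m\<in>S - {l}. (cmod (Y i m))^2) \<le> T"
      unfolding T_def using assms(1) by (intro sum_mono sum_mono2) auto
    finally have "Re (quad_form P (gram Y (S - {l})) (\<lambda>i. Y i l)) \<le> ?e l + T" by simp
    \<comment> \<open>The difference of the two sides is the square of
      \<open>?c l - 2 * P\<close>.\<close>
    moreover have "(?c l)^2 \<le> 2 * (?c l - P)^2 + 2 * (real P)^2"
      using zero_le_power2[of "?c l - 2 * P"] by (simp add: power2_eq_square algebra_simps)
    ultimately show "Re (quad_form P (gram Y S) (\<lambda>i. Y i l)) \<le> 2 * (?c l - P)^2 + (2 * (real P)^2 + T) + ?e l"
      unfolding quad_form_gram_remove[OF assms(1) l] by linarith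
  qed
  also have "\<dots> = 2 * (\<Sum>l\<in>S. (?c l - P)^2) + card S * (2 * (real P)^2 + T) + (\<Sum>l\<in>S. ?e l)"
    by (simp add: sum.distrib sum_distrib_left)
  finally show ?thesis .
qed

text \<open>The condition on \<open>b\<close> says that \<open>f k / r k\<close> has second moment
  at most \<open>K / (k + 1)^2\<close>.\<close>

lemma (in prob_space) AE_ratio_tendsto_0:
  fixes f :: "nat \<Rightarrow> 'a \<Rightarrow> real" and b r :: "nat \<Rightarrow> real"
  assumes meas: "\<And>k. f k \<in> borel_measurable M"
    and le: "\<And>k. nn_mean (\<lambda>w. (f k w)^2) \<le> ennreal (b k)"
    and r: "\<And>k. 0 < r k" and b: "\<And>k. b k * (real (Suc k))^2 \<le> K * (r k)^2" and K: "0 \<le> K"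
  shows "AE w in M. (\<lambda>k. f k w / r k) \<longlonglongrightarrow> 0"
proof -
  have "AE w in M. (\<lambda>k. (f k w / r k)^2) \<longlonglongrightarrow> 0"
  proof (rule AE_tendsto_0)
    show "(\<lambda>w. (f k w / r k)^2) \<in> borel_measurable M" for k using meas by simp
    show "summable (\<lambda>k. K * inverse ((real (Suc k))^2))"
      using summable_Suc_iff[of "\<lambda>k. inverse ((real k)^2)"] inverse_power_summable[of 2, where ?'a = real]
      by (intro summable_mult) simp
    show "nn_mean (\<lambda>w. (f k w / r k)^2) \<le> ennreal (K * inverse ((real (Suc k))^2))" for k
    proof -
      have "nn_mean (\<lambda>w. (f k w / r k)^2) = (\<integral>\<^sup>+w. ennreal (1 / (r k)^2) * ennreal ((f k w)^2) \<partial>M)"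
        by (intro nn_integral_cong) (simp add: power_divide flip: ennreal_mult)
      also have "\<dots> = ennreal (1 / (r k)^2) * nn_mean (\<lambda>w. (f k w)^2)"
        using meas by (intro nn_integral_cmult) simp
      also have "\<dots> \<le> ennreal (1 / (r k)^2) * ennreal (b k)" by (intro mult_left_mono le) simp
      also have "\<dots> = ennreal (b k / (r k)^2)" by (simp add: divide_ennreal_def ennreal_mult'[symmetric])
      also have "\<dots> \<le> ennreal (K * inverse ((real (Suc k))^2))"
        using r[of k] b[of k] by (intro ennreal_leI) (simp add: field_simps)
      finally show ?thesis .
    qed
  qed (use K in simp_all)
  then show ?thesis
  proof (rule AE_mp, intro AE_I2 impI)
    fix w assume "(\<lambda>k. (f k w / r k)^2) \<longlonglongrightarrow> 0"
    then have "(\<lambda>k. sqrt ((f k w / r k)^2)) \<longlonglongrightarrow> sqrt 0"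
      by (rule tendsto_real_sqrt)
    then have "(\<lambda>k. \<bar>f k w / r k\<bar>) \<longlonglongrightarrow> 0" by (simp del: abs_divide)
    then show "(\<lambda>k. f k w / r k) \<longlonglongrightarrow> 0" by (rule tendsto_rabs_zero_cancel)
  qed
qed

context random_matrix
begin

text \<open>With both dimensions of order \<open>N\<close> this is of order \<open>N^3\<close>. The
  squared \<open>gram_error\<close> then has mean of order \<open>N^5\<close>, against
  \<open>N^6\<close> after division of the error by \<open>N^3\<close>: again a gain of
  \<open>1 / N\<close>.\<close>

lemma gram_second_moment:
  assumes "finite S"
  shows "nn_mean (\<lambda>w. frobenius P (gram (entries w) S)) \<le>
    ennreal ((real P)^2 * (2 * (\<kappa> * card S)) + 2 * (P * (real (card S))^2))"
proof -
  let ?d = "\<lambda>i j. if i = j then of_nat (card S) else 0 :: complex"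
  let ?D = "\<lambda>w. \<Sum>i<P. \<Sum>j<P. 2 * ennreal ((cmod (gram (entries w) S i j - ?d i j))^2)" and ?E = "ennreal (2 * (P * (real (card S))^2))" and ?F = "\<lambda>w. frobenius P (gram (entries w) S)"
  have "nn_mean (\<lambda>w. ?F w) \<le>
      (\<integral>\<^sup>+w. ?D w +
        ?E \<partial>M)"
  proof (rule nn_integral_mono)
    fix w
    have "(cmod x)^2 \<le> 2 * (cmod (x - y))^2 + 2 * (cmod y)^2" for x y :: complex
    proof -
      have "(cmod x)^2 \<le> (cmod (x - y) + cmod y)^2"
        using norm_triangle_ineq[of "x - y" y] by (intro power_mono) auto
      also have "\<dots> \<le> 2 * (cmod (x - y))^2 + 2 * (cmod y)^2"
        using zero_le_power2[of "cmod (x - y) - cmod y"] by (simp add: power2_eq_square algebra_simps)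
      finally show ?thesis .
    qed
    then have "?F w \<le>
        (\<Sum>i<P. \<Sum>j<P. 2 * (cmod (gram (entries w) S i j - ?d i j))^2 + 2 * (cmod (?d i j))^2)"
      by (intro sum_mono) auto
    also have "\<dots> = (\<Sum>i<P. \<Sum>j<P. 2 * (cmod (gram (entries w) S i j - ?d i j))^2) + 2 * (P * (real (card S))^2)"
    proof -
      have "2 * (cmod (?d i j))^2 = (if j = i then 2 * (real (card S))^2 else 0)" for i j :: nat by auto
      then show ?thesis by (simp add: sum.distrib)
    qed
    finally have "ennreal (?F w) \<le>
        ennreal ((\<Sum>i<P. \<Sum>j<P. 2 * (cmod (gram (entries w) S i j - ?d i j))^2) + 2 * (P * (real (card S))^2))"
      by (rule ennreal_leI)
    also have "\<dots> = ?D w +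
        ?E"
      by (simp add: ennreal_plus sum_nonneg ennreal_mult flip: sum_ennreal)
    finally show "ennreal (?F w) \<le>
        ?D w +
        ?E" .
  qed
  also have "\<dots> = (\<Sum>i<P. \<Sum>j<P. 2 * nn_mean (\<lambda>w. (cmod (gram (entries w) S i j - ?d i j))^2)) +
      ?E"
    by (simp add: nn_integral_add nn_integral_sum nn_integral_cmult emeasure_space_1)
  also have "\<dots> \<le> (\<Sum>i<P. \<Sum>j<P. 2 * ennreal (\<kappa> * card S)) + ?E"
    by (intro add_mono sum_mono mult_left_mono gram_entry_variance assms order_refl) simp_all
  also have "\<dots> = ennreal ((real P)^2 * (2 * (\<kappa> * card S)) + 2 * (P * (real (card S))^2))"
  proof -
    have "(\<Sum>i<P. \<Sum>j<P. 2 * ennreal (\<kappa> * card S)) = ennreal (\<Sum>i<P. \<Sum>j<P. 2 * (\<kappa> * card S))"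
      using kappa_1 by (simp add: ennreal_mult sum_nonneg ennreal_of_nat_eq_real_of_nat flip: sum_ennreal)
    also have "(\<Sum>i<P. \<Sum>j<P. 2 * (\<kappa> * card S)) = (real P)^2 * (2 * (\<kappa> * card S))"
      by (simp add: power2_eq_square)
    finally show ?thesis using kappa_1 by (simp add: ennreal_plus)
  qed
  finally show ?thesis .
qed

definition gram_error :: "nat \<Rightarrow> nat \<Rightarrow> 'a \<Rightarrow> real" where
  "gram_error P N = loo_error (\<lambda>A. A) P N"

lemma gram_error_second_moment:
  shows "gram_error P N \<in> borel_measurable M"
    and "nn_mean (\<lambda>w. (gram_error P N w)^2) \<le>
    ennreal ((real N)^2 * (\<kappa> * ((real P)^2 * (2 * (\<kappa> * N)) + 2 * (P * (real N)^2))))"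
proof -
  let ?b = "\<lambda>n. (real P)^2 * (2 * (\<kappa> * real n)) + 2 * (P * (real n)^2)"
  have "nn_mean (\<lambda>w. frobenius P (gram (entries w) ({..<N} - {l}))) \<le> ennreal (?b N)" for l
  proof -
    have "card ({..<N} - {l}) \<le> N" using card_mono[of "{..<N}" "{..<N} - {l}"] by simp
    then have "?b (card ({..<N} - {l})) \<le> ?b N"
      using kappa_1 by (intro add_mono mult_left_mono power_mono) auto
    then show ?thesis using gram_second_moment[of "{..<N} - {l}" P] by (auto intro: order_trans ennreal_leI)
  qed
  note loo = loo_error_second_moment[of P "\<lambda>A. A", OF gram_coordinate_meas this]
  show "gram_error P N \<in> borel_measurable M"
    unfolding gram_error_def by (rule loo(1)) (use kappa_1 in simp)
  show "nn_mean (\<lambda>w. (gram_error P N w)^2) \<le> ennreal ((real N)^2 * (\<kappa> * ?b N))"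
    unfolding gram_error_def by (rule loo(2)) (use kappa_1 in simp)
qed

text \<open>The trace of the Gram matrix of the columns in \<open>S\<close>; for a singleton, the
  squared norm of one column.\<close>

definition energy :: "nat \<Rightarrow> nat set \<Rightarrow> 'a \<Rightarrow> real" where
  "energy P S w = (\<Sum>i<P. \<Sum>m\<in>S. (cmod (entries w i m))^2)"

lemma energy_meas: "energy P S \<in> borel_measurable M"
  unfolding energy_def[abs_def]
  by (intro borel_measurable_sum borel_measurable_power measurable_compose[OF _ borel_measurable_norm] entries_meas)

lemma energy_variance:
  assumes "finite S"
  shows "nn_mean (\<lambda>w. (energy P S w - P * card S)^2) \<le> ennreal (\<kappa> * (P * card S))"
proof -
  have "(cmod ((\<Sum>i<P. gram (entries w) S i i) - of_nat (P * card S)))^2 = (energy P S w - P * card S)^2" for w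
  proof -
    have "(\<Sum>i<P. gram (entries w) S i i) - of_nat (P * card S) = of_real (energy P S w - P * card S)"
      unfolding trace_gram energy_def by simp
    then show ?thesis by (simp only: norm_of_real power2_abs)
  qed
  then show ?thesis using trace_gram_variance[OF assms, of P] by simp
qed

end

context random_matrix
begin

lemma AE_resolvent_error:
  assumes "0 < t" "\<And>k. P k \<le> C * (Suc k)^2"
  shows "AE w in M. (\<lambda>k. resolvent_error (P k) ((Suc k)^2) (real ((Suc k)^2) * t) w / real ((Suc k)^2)) \<longlonglongrightarrow> 0"
proof (rule AE_ratio_tendsto_0)
  let ?N = "\<lambda>k. real ((Suc k)^2)"
  show "nn_mean (\<lambda>w. (resolvent_error (P k) ((Suc k)^2) (?N k * t) w)^2) \<le>
      ennreal ((?N k)^2 * (\<kappa> * (P k / (?N k * t)^2)))" for k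
    by (rule resolvent_error_second_moment(2)) (use assms(1) in simp)
  show "(?N k)^2 * (\<kappa> * (P k / (?N k * t)^2)) * (real (Suc k))^2 \<le> \<kappa> * C / t^2 * (?N k)^2" for k
  proof -
    have N: "0 < ?N k" by simp
    have P: "real (P k) \<le> C * ?N k" using assms(2)[of k] by (metis of_nat_le_iff of_nat_mult)
    have "(?N k)^2 * (\<kappa> * (P k / (?N k * t)^2)) * (real (Suc k))^2 = \<kappa> / t^2 * (P k * ?N k)"
      using N assms(1) by (simp add: power_mult_distrib)
    also have "\<dots> \<le> \<kappa> / t^2 * ((C * ?N k) * ?N k)"
      using P N kappa_1 by (intro mult_left_mono mult_right_mono) auto
    also have "\<dots> = \<kappa> * C / t^2 * (?N k)^2" by (simp add: power2_eq_square)
    finally show ?thesis .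
  qed
  show "0 \<le> \<kappa> * C / t^2" using kappa_1 by simp
qed (use resolvent_error_second_moment(1) assms(1) in auto)

text \<open>The variance is of order \<open>N^2\<close>, against a squared normalisation of order
  \<open>N^4\<close>. Hence \<open>N k = k + 1\<close> is admissible besides the squares, and the
  trace converges along all dimensions.\<close>

lemma AE_energy_ratio:
  assumes "\<And>k. P k \<le> C * N k" "\<And>k. Suc k \<le> N k"
  shows "AE w in M. (\<lambda>k. (energy (P k) {..<N k} w - real (P k) * real (N k)) / (real (N k))^2) \<longlonglongrightarrow> 0"
proof (rule AE_ratio_tendsto_0)
  show "nn_mean (\<lambda>w. (energy (P k) {..<N k} w - real (P k) * real (N k))^2) \<le> ennreal (\<kappa> * (P k * N k))" for k
    using energy_variance[of "{..<N k}" "P k"] by simp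
  show "\<kappa> * real (P k * N k) * (real (Suc k))^2 \<le> \<kappa> * C * ((real (N k))^2)^2" for k
  proof -
    have "P k * N k * (Suc k)^2 \<le> C * N k * N k * (N k)^2" by (intro mult_mono power_mono assms) auto
    then have "real (P k * N k * (Suc k)^2) \<le> real (C * N k * N k * (N k)^2)"
      by (simp only: of_nat_le_iff)
    then have "\<kappa> * real (P k * N k * (Suc k)^2) \<le> \<kappa> * real (C * N k * N k * (N k)^2)"
      using kappa_1 by (intro mult_left_mono) auto
    then show ?thesis by (simp only: of_nat_mult of_nat_power power2_eq_square mult.assoc)
  qed
  show "0 \<le> \<kappa> * C" using kappa_1 by simp
  show "0 < (real (N k))^2" for k using assms(2)[of k] by simp
qed (use energy_meas in auto)

lemma AE_energy:
  assumes "\<And>n. 0 < n \<Longrightarrow> p n \<le> C * n"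
  shows "AE w in M. (\<lambda>n. (energy (p n) {..<n} w - real (p n) * real n) / (real n)^2) \<longlonglongrightarrow> 0"
proof -
  have "AE w in M. (\<lambda>k. (energy (p (Suc k)) {..<Suc k} w - real (p (Suc k)) * real (Suc k)) / (real (Suc k))^2) \<longlonglongrightarrow> 0"
    by (rule AE_energy_ratio[of "\<lambda>k. p (Suc k)" C Suc]) (rule assms, simp_all)
  then show ?thesis by (rule AE_mp, intro AE_I2 impI) (rule LIMSEQ_imp_Suc)
qed

text \<open>The number of rows is \<open>C\<close> times the number of columns, so that this matrix
  contains the actual ones of smaller dimension even if \<open>p\<close> is not monotone. In the
  constant, \<open>2 C^2\<close> stems from the mean column norms, \<open>C\<close> from the trace,
  and 1 absorbs the errors that tend to 0.\<close>

lemma AE_frobenius_bounded: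
  fixes C :: nat
  shows "AE w in M. \<forall>\<^sub>F k in sequentially.
    (frobenius (C * (Suc k)^2) (gram (entries w) {..<(Suc k)^2})) \<le>
      (2 * (real C)^2 + C + 1) * (real ((Suc k)^2)) ^ 3"
proof -
  define N where "N k = (Suc k)^2" for k
  define P where "P k = C * N k" for k
  have N: "0 < N k" "1 \<le> real (N k)" "(real (Suc k))^2 = real (N k)" for k by (simp_all add: N_def)
  \<comment> \<open>\<open>V\<close> is itself quadratic in the deviations, so its first moment is
    used; a second moment would involve eighth moments of the entries.\<close>
  define V where "V k w = (\<Sum>l<N k. (energy (P k) {l} w - P k)^2)" for k w
  have V_meas: "V k \<in> borel_measurable M" for k
    unfolding V_def[abs_def] by (intro borel_measurable_sum borel_measurable_power borel_measurable_diff energy_meas borel_measurable_const)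
  have 1: "AE w in M. (\<lambda>k. V k w / (real (N k)) ^ 3) \<longlonglongrightarrow> 0"
  proof (rule AE_tendsto_0)
    show "summable (\<lambda>k. (\<kappa> * C) * inverse ((real (Suc k))^2))"
      using summable_Suc_iff[of "\<lambda>k. inverse ((real k)^2)"] inverse_power_summable[of 2, where ?'a = real]
      by (intro summable_mult) simp
    show "nn_mean (\<lambda>w. V k w / (real (N k)) ^ 3) \<le> ennreal ((\<kappa> * C) * inverse ((real (Suc k))^2))" for k
    proof -
      have "nn_mean (\<lambda>w. V k w / (real (N k)) ^ 3) = (\<integral>\<^sup>+w. ennreal (1 / (real (N k)) ^ 3) * (\<Sum>l<N k. ennreal ((energy (P k) {l} w - P k)^2)) \<partial>M)"
        by (intro nn_integral_cong) (simp add: V_def sum_nonneg flip: ennreal_mult)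
      also have "\<dots> = ennreal (1 / (real (N k)) ^ 3) * (\<Sum>l<N k. \<integral>\<^sup>+w. ennreal ((energy (P k) {l} w - P k)^2) \<partial>M)"
        using energy_meas[of "P k" "{l}" for l] by (subst nn_integral_cmult, measurable) (subst nn_integral_sum, auto)
      also have "\<dots> \<le> ennreal (1 / (real (N k)) ^ 3) * (\<Sum>l<N k. ennreal (\<kappa> * P k))"
        using energy_variance[of "{l}" "P k" for l] by (intro mult_left_mono sum_mono) simp_all
      also have "\<dots> = ennreal (1 / (real (N k)) ^ 3 * (N k * (\<kappa> * P k)))"
        using kappa_1 by (simp add: ennreal_of_nat_eq_real_of_nat flip: ennreal_mult)
      also have "1 / (real (N k)) ^ 3 * (N k * (\<kappa> * P k)) = (\<kappa> * C) * inverse (real (N k))"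
        using N(1)[of k] by (simp add: P_def power3_eq_cube field_simps)
      finally show ?thesis by (simp only: N(3))
    qed
    show "0 \<le> V k w / (real (N k)) ^ 3" for k w by (simp add: V_def sum_nonneg)
  qed (use kappa_1 V_meas in \<open>auto intro!: borel_measurable_divide borel_measurable_const\<close>)
  have 2: "AE w in M. (\<lambda>k. (energy (P k) {..<N k} w - real (P k) * real (N k)) / (real (N k))^2) \<longlonglongrightarrow> 0"
    by (rule AE_energy_ratio) (auto simp: P_def N_def power2_eq_square)
  have 3: "AE w in M. (\<lambda>k. gram_error (P k) (N k) w / (real (N k)) ^ 3) \<longlonglongrightarrow> 0"
  proof (rule AE_ratio_tendsto_0)
    show "nn_mean (\<lambda>w. (gram_error (P k) (N k) w)^2) \<le>
      ennreal ((real (N k))^2 * (\<kappa> * ((real (P k))^2 * (2 * (\<kappa> * N k)) + 2 * (P k * (real (N k))^2))))" for k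
      by (rule gram_error_second_moment(2))
    show "(real (N k))^2 * (\<kappa> * ((real (P k))^2 * (2 * (\<kappa> * N k)) + 2 * (P k * (real (N k))^2))) * (real (Suc k))^2 \<le>
        \<kappa> * (2 * \<kappa> * (real C)^2 + 2 * C) * ((real (N k)) ^ 3)^2" for k
      unfolding N(3) by (simp add: P_def power2_eq_square power3_eq_cube algebra_simps)
    show "0 \<le> \<kappa> * (2 * \<kappa> * (real C)^2 + 2 * C)" using kappa_1 by simp
  qed (use N gram_error_second_moment(1) in auto)
  show ?thesis
    using 1 2 3
  proof eventually_elim
    case (elim w)
    let ?x = "\<lambda>k. 2 * (V k w / (real (N k)) ^ 3) + (2 * (real C)^2 +
        ((energy (P k) {..<N k} w - real (P k) * real (N k)) / (real (N k))^2 + C)) + gram_error (P k) (N k) w / (real (N k)) ^ 3"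
    have "?x \<longlonglongrightarrow> 2 * 0 + (2 * (real C)^2 + (0 + real C)) + 0"
      by (intro tendsto_add tendsto_mult tendsto_const elim)
    then have "\<forall>\<^sub>F k in sequentially. ?x k < 2 * (real C)^2 + C + 1"
      by (rule order_tendstoD(2)) simp
    then show ?case
    proof eventually_elim
      case (elim k)
      have "frobenius (P k) (gram (entries w) {..<N k}) \<le>
          2 * V k w + N k * (2 * (real (P k))^2 + energy (P k) {..<N k} w) + gram_error (P k) (N k) w"
        using gram_frobenius_bound[where S = "{..<N k}" and Y = "entries w" and P = "P k", OF finite_lessThan refl]
        by (simp add: V_def energy_def gram_error_def loo_error_def)
      also have "\<dots> = ?x k * (real (N k)) ^ 3"
        using N(1)[of k] by (simp add: P_def field_simps power2_eq_square power3_eq_cube)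
      also have "\<dots> \<le> (2 * (real C)^2 + C + 1) * (real (N k)) ^ 3"
        using elim by (intro mult_right_mono) auto
      finally show ?case
        unfolding P_def N_def .
    qed
  qed
qed

end

section \<open>The limiting equation, and the passage from squares to all dimensions\<close>

lemma res_trace_lipschitz:
  assumes "psd P A" "0 < s" "s \<le> s'"
  shows "\<bar>res_trace P A s' - res_trace P A s\<bar> \<le> P * ((s' - s) / (s * s'))"
proof -
  obtain es where "eigenvalue_list P A es"
    using psd_spectrum[OF assms(1)] by blast
  note es = eigenvalue_listD[OF this]
  have pointwise: "\<bar>1 / (e + s') - 1 / (e + s)\<bar> \<le> (s' - s) / (s * s')" if "0 \<le> e" for e
  proof -
    have "1 / (e + s') - 1 / (e + s) = (s - s') / ((e + s) * (e + s'))"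
      using that assms by (simp add: field_simps)
    then have "\<bar>1 / (e + s') - 1 / (e + s)\<bar> = (s' - s) / ((e + s) * (e + s'))"
      using that assms by (simp add: abs_mult)
    also have "\<dots> \<le> (s' - s) / (s * s')" using that assms by (intro divide_left_mono mult_mono) auto
    finally show ?thesis .
  qed
  have "\<bar>(\<Sum>e\<leftarrow>l. 1 / (e + s')) - (\<Sum>e\<leftarrow>l. 1 / (e + s))\<bar> \<le> length l * ((s' - s) / (s * s'))"
    if "\<And>e. e \<in> set l \<Longrightarrow> \<bar>1 / (e + s') - 1 / (e + s)\<bar> \<le> (s' - s) / (s * s')" for l
    using that
  proof (induction l)
    case (Cons e l)
    have "\<bar>(\<Sum>e\<leftarrow>l. 1 / (e + s')) - (\<Sum>e\<leftarrow>l. 1 / (e + s))\<bar> \<le> length l * ((s' - s) / (s * s'))"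
      using Cons by simp
    moreover have "\<bar>1 / (e + s') - 1 / (e + s)\<bar> \<le> (s' - s) / (s * s')"
      using Cons.prems[of e] by simp
    moreover have "real (length (e # l)) * ((s' - s) / (s * s')) =
        (s' - s) / (s * s') + length l * ((s' - s) / (s * s'))"
      by (simp add: distrib_right add_divide_distrib)
    ultimately show ?case unfolding list.map sum_list.Cons by linarith
  qed simp
  from this[of es, OF pointwise[OF es(2)]] show ?thesis
    using es(1,4) assms(2,3) by simp
qed

lemma res_trace_gram_row_abs:
  fixes P P' :: nat
  assumes "0 < s"
  shows "\<bar>res_trace P' (gram Y S) s - res_trace P (gram Y S) s\<bar> \<le> \<bar>real P' - real P\<bar> / s"
proof (cases "P \<le> P'")
  case True
  then show ?thesis using res_trace_gram_row[OF assms, of P "P' - P" Y S] by (simp add: of_nat_diff)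
next
  case False
  then show ?thesis
    using res_trace_gram_row[OF assms, of P' "P - P'" Y S] by (simp add: of_nat_diff abs_minus_commute)
qed

text \<open>Dividing the leave-one-out estimate by \<open>N\<close>, with \<open>s = N t\<close>,
  shows that \<open>G\<close> solves the limiting equation up to \<open>e + 1 / (N t)\<close> and
  the error of the ratio; stability of the equation does the rest.\<close>

lemma mp_stieltjes_limit:
  fixes P N :: "nat \<Rightarrow> nat" and G e :: "nat \<Rightarrow> real" and c t :: real
  assumes "0 < c" "0 < t" "\<And>k. 0 < N k" "filterlim N at_top sequentially"
    and ratio: "(\<lambda>k. P k / N k) \<longlonglongrightarrow> c"
    and err: "e \<longlonglongrightarrow> 0"
    and "\<And>k. 0 \<le> G k"
    and le: "\<And>k. \<bar>P k - real (N k) * t * G k - N k * (G k / (1 + G k))\<bar> \<le> N k * e k + real (N k) / (real (N k) * t)"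
  shows "G \<longlonglongrightarrow> mp_stieltjes c t"
proof -
  define g where "g = mp_stieltjes c t"
  note g = mp_stieltjes[OF assms(1,2), folded g_def]
  have inv: "(\<lambda>k. 1 / real (N k)) \<longlonglongrightarrow> 0"
    using filterlim_compose[OF lim_inverse_n' assms(4)] by simp
  have "(\<lambda>k. (\<bar>P k / N k - c\<bar> + (e k + 1 / N k * (1 / t))) / t) \<longlonglongrightarrow> (\<bar>c - c\<bar> + (0 + 0 * (1 / t))) / t"
    using assms(2) by (intro tendsto_intros ratio err inv) auto
  then have lim: "(\<lambda>k. (\<bar>P k / N k - c\<bar> + (e k + 1 / N k * (1 / t))) / t) \<longlonglongrightarrow> 0" by simp
  have bound: "\<bar>G k - g\<bar> \<le> (\<bar>P k / N k - c\<bar> + (e k + 1 / N k * (1 / t))) / t" for k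
  proof -
    have N: "0 < real (N k)" using assms(3) by simp
    have "N k * \<bar>P k / N k - (t * G k + G k / (1 + G k))\<bar> = \<bar>N k * (P k / N k - (t * G k + G k / (1 + G k)))\<bar>"
      by (simp add: abs_mult)
    also have "N k * (P k / N k - (t * G k + G k / (1 + G k))) = P k - real (N k) * t * G k - N k * (G k / (1 + G k))"
      using N by (simp add: right_diff_distrib distrib_left)
    also have "\<bar>\<dots>\<bar> \<le> N k * (e k + 1 / N k * (1 / t))"
      using le[of k] by (simp add: distrib_left)
    finally have "\<bar>P k / N k - (t * G k + G k / (1 + G k))\<bar> \<le> e k + 1 / N k * (1 / t)"
      using N by (simp only: mult_le_cancel_left_pos)
    moreover have "t * \<bar>G k - g\<bar> \<le> \<bar>(t * G k + G k / (1 + G k)) - (t * g + g / (1 + g))\<bar>"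
      by (rule fixed_point_stability) (use assms g in auto)
    ultimately have "t * \<bar>G k - g\<bar> \<le> \<bar>P k / N k - c\<bar> + (e k + 1 / N k * (1 / t))"
      unfolding g(2) by linarith
    then show ?thesis using assms(2) by (simp add: pos_le_divide_eq mult.commute)
  qed
  have "(\<lambda>k. G k - g) \<longlonglongrightarrow> 0"
    by (rule Lim_null_comparison[OF _ lim]) (use bound in simp)
  then show ?thesis unfolding g_def by (simp add: LIM_zero_iff)
qed

lemma floor_sqrt_at_top: "filterlim floor_sqrt at_top sequentially"
  unfolding filterlim_at_top
proof
  fix Z
  have "Z \<le> floor_sqrt n" if "Z^2 \<le> n" for n using that by (simp add: le_floor_sqrt_iff)
  then show "\<forall>\<^sub>F n in sequentially. Z \<le> floor_sqrt n"
    by (auto intro!: eventually_sequentiallyI)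
qed

lemma floor_sqrt_square_ratio: "(\<lambda>n. real n / real ((floor_sqrt n)^2)) \<longlonglongrightarrow> 1"
proof -
  have inv: "(\<lambda>n. 1 / real (floor_sqrt n)) \<longlonglongrightarrow> 0"
    using filterlim_compose[OF lim_inverse_n' floor_sqrt_at_top] by simp
  have lim: "(\<lambda>n. 2 * (1 / real (floor_sqrt n))) \<longlonglongrightarrow> 0"
    using tendsto_mult[OF tendsto_const[of 2] inv] by simp
  have "(\<lambda>n. real n / real ((floor_sqrt n)^2) - 1) \<longlonglongrightarrow> 0"
  proof (rule Lim_null_comparison[OF _ lim])
    show "\<forall>\<^sub>F n in sequentially. norm (real n / real ((floor_sqrt n)^2) - 1) \<le> 2 * (1 / real (floor_sqrt n))"
      using eventually_gt_at_top[of 0]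
    proof eventually_elim
      case (elim n)
      define m where "m = floor_sqrt n"
      have m: "0 < m" using elim by (simp add: m_def)
      have "m^2 \<le> n" "n < (Suc m)^2"
        using floor_sqrt_power2_le[of n] Suc_floor_sqrt_power2_gt[of n] by (simp_all add: m_def)
      then have "m^2 \<le> n" "n \<le> m^2 + 2 * m" by (simp_all add: power2_eq_square)
      then have "real (m^2) \<le> real n" "real n \<le> real (m^2 + 2 * m)" by (simp_all only: of_nat_le_iff)
      then have "0 \<le> (real n - real (m^2)) / real (m^2)"
          "(real n - real (m^2)) / real (m^2) \<le> 2 * real m / real (m^2)"
        by (auto intro!: divide_right_mono)
      moreover have "2 * real m / real (m^2) = 2 * (1 / real m)" by (simp add: power2_eq_square)
      moreover have "(real n - real (m^2)) / real (m^2) = real n / real (m^2) - 1"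
        using m by (simp add: diff_divide_distrib)
      ultimately show ?case unfolding m_def[symmetric] real_norm_def by linarith
    qed
  qed
  then show ?thesis by (simp add: LIM_zero_iff)
qed

lemma res_trace_interpolation:
  fixes Y :: "nat \<Rightarrow> nat \<Rightarrow> complex" and p :: "nat \<Rightarrow> nat"
  assumes "0 < t" and ratio: "(\<lambda>n. p n / n) \<longlonglongrightarrow> c"
    and sub: "(\<lambda>k. res_trace (p ((Suc k)^2)) (gram Y {..<(Suc k)^2}) (real ((Suc k)^2) * t)) \<longlonglongrightarrow> g"
  shows "(\<lambda>n. res_trace (p n) (gram Y {..<n}) (real n * t)) \<longlonglongrightarrow> g"
proof -
  let ?G = "\<lambda>q m k. res_trace q (gram Y {..<m}) (real k * t)"
  define N where "N n = (floor_sqrt n)^2" for n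
  define b where "b n = ?G (p (N n)) (N n) (N n)" for n
  \<comment> \<open>The hypothesis \<open>sub\<close> enumerates the squares as
    \<open>(Suc k)^2\<close>, hence the index \<open>floor_sqrt n - 1\<close>.\<close>
  have sq: "filterlim (\<lambda>n. floor_sqrt n - 1) at_top sequentially"
    using floor_sqrt_at_top by (rule filterlim_compose[OF filterlim_minus_const_nat_at_top])
  have b: "b \<longlonglongrightarrow> g"
  proof (rule Lim_transform_eventually[OF filterlim_compose[OF sub sq]])
    show "\<forall>\<^sub>F n in sequentially. ?G (p ((Suc (floor_sqrt n - 1))^2)) ((Suc (floor_sqrt n - 1))^2) ((Suc (floor_sqrt n - 1))^2) = b n"
      using eventually_gt_at_top[of 0]
    proof eventually_elim
      case (elim n)
      then have "Suc (floor_sqrt n - 1) = floor_sqrt n" by simp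
      then show ?case unfolding b_def N_def by (simp only:)
    qed
  qed
  have Nn: "(\<lambda>n. real n / real (N n)) \<longlonglongrightarrow> 1"
    unfolding N_def by (rule floor_sqrt_square_ratio)
  have N_top: "filterlim N at_top sequentially"
    unfolding N_def by (rule filterlim_compose[OF _ floor_sqrt_at_top])
      (rule filterlim_at_top_mono[OF filterlim_ident], auto simp: power2_eq_square)
  have pN: "(\<lambda>n. real (p (N n)) / real (N n)) \<longlonglongrightarrow> c"
    by (rule filterlim_compose[OF ratio N_top])
  \<comment> \<open>The three summands are the costs of changing the shift from \<open>n t\<close>
    to \<open>N n * t\<close>, of dropping \<open>n - N n\<close> columns, and of changing
    \<open>p n\<close> rows to \<open>p (N n)\<close>.\<close>
  define B where "B n = (p n / n * (n / N n - 1) + (n / N n - 1) + \<bar>p n / n * (n / N n) - p (N n) / N n\<bar>) / t" for n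
  have "B \<longlonglongrightarrow> (c * (1 - 1) + (1 - 1) + \<bar>c * 1 - c\<bar>) / t"
    unfolding B_def using assms(1) by (intro tendsto_intros ratio Nn pN) auto
  then have B: "B \<longlonglongrightarrow> 0" by simp
  have "(\<lambda>n. ?G (p n) n n - b n) \<longlonglongrightarrow> 0"
  proof (rule Lim_null_comparison[OF _ B])
    show "\<forall>\<^sub>F n in sequentially. norm (?G (p n) n n - b n) \<le> B n"
      using eventually_gt_at_top[of 0]
    proof eventually_elim
      case (elim n)
      have N: "0 < N n" "N n \<le> n" using elim floor_sqrt_power2_le[of n] by (simp_all add: N_def)
      have s: "0 < real (N n) * t" using N assms(1) by simp
      have "\<bar>?G (p n) n n - ?G (p n) n (N n)\<bar>
          \<le> p n * ((real n * t - real (N n) * t) / (real (N n) * t * (real n * t)))"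
        using N assms(1) by (intro res_trace_lipschitz psd_gram s) auto
      also have "\<dots> = (p n / n * (n / N n - 1)) / t" using N elim assms(1) by (simp add: field_simps)
      finally have 1: "\<bar>?G (p n) n n - ?G (p n) n (N n)\<bar>
          \<le> (p n / n * (n / N n - 1)) / t" .
      have "\<bar>?G (p n) n (N n) - ?G (p n) (N n) (N n)\<bar>
          \<le> (n - N n) / (real (N n) * t)"
        using res_trace_gram_column[OF s, of "p n" Y "N n" "n - N n"] N by simp
      also have "\<dots> = (n / N n - 1) / t" using N assms(1) by (simp add: of_nat_diff field_simps)
      finally have 2: "\<bar>?G (p n) n (N n) - ?G (p n) (N n) (N n)\<bar>
          \<le> (n / N n - 1) / t" .
      have "\<bar>?G (p n) (N n) (N n) - b n\<bar> \<le> \<bar>real (p n) - real (p (N n))\<bar> / (real (N n) * t)"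
        unfolding b_def by (rule res_trace_gram_row_abs[OF s])
      also have "\<dots> = \<bar>p n / n * (n / N n) - p (N n) / N n\<bar> / t"
      proof -
        have "p n / n * (n / N n) - p (N n) / N n = (real (p n) - real (p (N n))) / N n"
          using elim by (simp add: diff_divide_distrib)
        then show ?thesis by simp
      qed
      finally have 3: "\<bar>?G (p n) (N n) (N n) - b n\<bar>
          \<le> \<bar>p n / n * (n / N n) - p (N n) / N n\<bar> / t" .
      show ?case unfolding B_def add_divide_distrib real_norm_def using 1 2 3 by linarith
    qed
  qed
  from tendsto_add[OF this b] show ?thesis by simp
qed

section \<open>Entropy of the normalised Gram matrix\<close>

lemma mat_adjoint_index:
  assumes "i < dim_col A" "j < dim_row A"
  shows "mat_adjoint A $$ (i, j) = conjugate (A $$ (j, i))"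
  using assms by (simp add: mat_adjoint_def mat_of_rows_index)

lemma mat_adjoint_dim: "dim_row (mat_adjoint A) = dim_col A" "dim_col (mat_adjoint A) = dim_row A"
  by (simp_all add: mat_adjoint_def)

lemma sample_mat_gram:
  "sample_mat x P N w * mat_adjoint (sample_mat x P N w) =
    to_mat P (gram (\<lambda>i m. x (Suc i) (Suc m) w) {..<N})"
  by (intro eq_matI)
    (auto simp: sample_mat_def mat_adjoint_dim mat_adjoint_index scalar_prod_def gram_def atLeast0LessThan intro!: sum.cong)

text \<open>Split \<open>ln (e / T)\<close> into \<open>ln (e / n) - ln (T / n)\<close>. As the
  eigenvalues sum to \<open>T\<close>, the second part contributes \<open>ln (T / n)\<close>, and
  subtracting \<open>ln n\<close> leaves \<open>ln (T / n^2)\<close>.\<close>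

lemma entropy_of_spectrum:
  fixes es :: "real list" and n T :: real
  assumes "\<And>e. e \<in> set es \<Longrightarrow> 0 \<le> e" "(\<Sum>e\<leftarrow>es. e) = T" "0 < T" "0 < n"
  shows "- (\<Sum>e\<leftarrow>es. (e / T) * ln (e / T)) - ln n =
    ln (T / n^2) - (\<Sum>e\<leftarrow>es. (e / n) * ln (e / n)) / n / (T / n^2)"
proof -
  have "(\<Sum>e\<leftarrow>l. (e / T) * ln (e / T)) = (\<Sum>e\<leftarrow>l. (e / n) * ln (e / n)) / n / (T / n^2) - ln (T / n) * ((\<Sum>e\<leftarrow>l. e) / T)"
    if "\<And>e. e \<in> set l \<Longrightarrow> 0 \<le> e" for l
    using that
  proof (induction l)
    case (Cons e l)
    have "(e / T) * ln (e / T) = (e / n) * ln (e / n) / n / (T / n^2) - ln (T / n) * (e / T)"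
    proof (cases "e = 0")
      case False
      then have "0 < e" using Cons.prems[of e] by simp
      then have "ln (e / T) = ln (e / n) - ln (T / n)" using assms(3,4) by (simp add: ln_div)
      moreover have "(e / n) * ln (e / n) / n / (T / n^2) = (e / T) * ln (e / n)"
        using assms(3,4) by (simp add: power2_eq_square)
      ultimately show ?thesis by (simp add: right_diff_distrib mult.commute)
    qed simp
    moreover have "(u + u') / n / K - L * ((v + v') / T) = (u / n / K - L * (v / T)) + (u' / n / K - L * (v' / T))"
      for u u' v v' K L :: real
      by (simp add: add_divide_distrib distrib_left)
    moreover have "(\<Sum>e\<leftarrow>l. (e / T) * ln (e / T)) = (\<Sum>e\<leftarrow>l. (e / n) * ln (e / n)) / n / (T / n^2) - ln (T / n) * ((\<Sum>e\<leftarrow>l. e) / T)"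
      using Cons by simp
    ultimately show ?case by (simp only: list.map sum_list.Cons)
  qed simp
  from this[OF assms(1)] have "(\<Sum>e\<leftarrow>es. (e / T) * ln (e / T)) =
      (\<Sum>e\<leftarrow>es. (e / n) * ln (e / n)) / n / (T / n^2) - ln (T / n)"
    using assms(2,3) by simp
  moreover have "ln (T / n^2) = ln (T / n) - ln n"
    using assms(3,4) by (simp add: ln_div ln_mult power2_eq_square)
  ultimately show ?thesis by simp
qed

lemma von_neumann_entropy_smult:
  assumes "length es = P"
    and "char_poly (of_real k \<cdot>\<^sub>m to_mat P A) = (\<Prod>e\<leftarrow>es. [:- (of_real k * of_real e), 1:])"
  shows "von_neumann_entropy (of_real k \<cdot>\<^sub>m to_mat P A) = - (\<Sum>e\<leftarrow>es. (k * e) * ln (k * e))"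
proof -
  have "(\<Sum>j = 1..P. eigval (of_real k \<cdot>\<^sub>m to_mat P A) j * ln (eigval (of_real k \<cdot>\<^sub>m to_mat P A) j)) =
      (\<Sum>e\<leftarrow>es. (k * e) * ln (k * e))"
    by (rule sum_eigval[where g = "\<lambda>x. x * ln x" and P = P]) (use assms in simp_all)
  then show ?thesis by (simp add: von_neumann_entropy_def)
qed

context random_matrix
begin

lemma AE_stieltjes:
  fixes p :: "nat \<Rightarrow> nat" and c t :: real
  assumes "0 < c" "(\<lambda>n. p n / n) \<longlonglongrightarrow> c" "\<And>n. 0 < n \<Longrightarrow> p n \<le> C * n" "0 < t"
  shows "AE w in M. (\<lambda>n. res_trace (p n) (gram (entries w) {..<n}) (real n * t)) \<longlonglongrightarrow> mp_stieltjes c t"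
proof -
  let ?N = "\<lambda>k. (Suc k)^2"
  have sq: "filterlim ?N at_top sequentially"
    by (rule filterlim_at_top_mono[OF filterlim_ident]) (auto simp: power2_eq_square)
  have "p (?N k) \<le> C * ?N k" for k by (rule assms(3)) simp
  then have "AE w in M. (\<lambda>k. resolvent_error (p (?N k)) (?N k) (real (?N k) * t) w / real (?N k)) \<longlonglongrightarrow> 0"
    by (rule AE_resolvent_error[OF assms(4)])
  then show ?thesis
  proof eventually_elim
    case (elim w)
    let ?G = "\<lambda>k. res_trace (p (?N k)) (gram (entries w) {..<?N k}) (real (?N k) * t)"
    show ?case
    proof (rule res_trace_interpolation[OF assms(4,2)], rule mp_stieltjes_limit[OF assms(1,4) _ sq _ elim])
      show "(\<lambda>k. p (?N k) / ?N k) \<longlonglongrightarrow> c"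
        by (rule filterlim_compose[OF assms(2) sq])
      fix k
      have s: "0 < real (?N k) * t" using assms(4) by simp
      show "0 \<le> ?G k" by (rule res_trace_bounds(1)[OF psd_gram s])
      show "\<bar>p (?N k) - real (?N k) * t * ?G k -
          ?N k * (?G k /
          (1 + ?G k))\<bar> \<le>
          ?N k * (resolvent_error (p (?N k)) (?N k) (real (?N k) * t) w / real (?N k)) + real (?N k) / (real (?N k) * t)"
        using leave_one_out[where S = "{..<?N k}" and Y = "entries w" and P = "p (?N k)", OF finite_lessThan s refl]
        by (simp add: resolvent_error_def loo_error_def del: power_Suc of_nat_power)
    qed simp
  qed
qed

text \<open>\<open>I\<close> is the limit of the normalised sum of x ln x. The term
  \<open>ln c\<close> and the division by \<open>c\<close> both come from the limit of the trace
  over \<open>n^2\<close>.\<close>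

lemma AE_sum_xlnx:
  fixes p :: "nat \<Rightarrow> nat" and c :: real
  assumes "0 < c" "(\<lambda>n. p n / n) \<longlonglongrightarrow> c" "\<And>n. 0 < n \<Longrightarrow> p n \<le> C * n"
  defines "I \<equiv> 1 / (2 * pi) *
    mp_log_integral c"
  shows "AE w in M. (\<lambda>n. energy (p n) {..<n} w / (real n)^2) \<longlonglongrightarrow> c \<and>
    (\<lambda>n. von_neumann_entropy (of_real (1 / energy (p n) {..<n} w) \<cdot>\<^sub>m
      to_mat (p n) (gram (entries w) {..<n})) - ln (real n)) \<longlonglongrightarrow> ln c - I / c"
proof -
  \<comment> \<open>The exceptional null set depends on the argument, so only countably many
    arguments are treated together; \<open>sum_xlnx_tendsto\<close> asks for no more.\<close>
  have "AE w in M. \<forall>q\<in>{q \<in> \<rat>. 0 < q}.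
      (\<lambda>n. res_trace (p n) (gram (entries w) {..<n}) (real n * q)) \<longlonglongrightarrow> mp_stieltjes c q"
    by (intro AE_ball_countable' AE_stieltjes[OF assms(1-3)]) (auto intro: countable_subset[OF _ countable_rat])
  moreover have "AE w in M. (\<lambda>n. (energy (p n) {..<n} w - real (p n) * real n) / (real n)^2) \<longlonglongrightarrow> 0"
    by (rule AE_energy) (rule assms(3))
  moreover note AE_frobenius_bounded[of C]
  ultimately show ?thesis
  proof eventually_elim
    case (elim w)
    define A where "A n = gram (entries w) {..<n}" for n
    define T where "T n = energy (p n) {..<n} w" for n
    have "\<exists>es. \<forall>n. eigenvalue_list (p n) (A n) (es n)"
      unfolding A_def by (intro choice allI psd_spectrum psd_gram)
    then obtain es where "\<And>n. eigenvalue_list (p n) (A n) (es n)" by blast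
    note es = eigenvalue_listD[OF this]
    have T: "(\<Sum>e\<leftarrow>es n. e) = T n" for n
    proof -
      have "complex_of_real (\<Sum>e\<leftarrow>es n. e) = of_real (T n)"
        unfolding es(5)[symmetric] A_def trace_gram T_def energy_def ..
      then show ?thesis unfolding of_real_eq_iff .
    qed
    have T_lim: "(\<lambda>n. T n / (real n)^2) \<longlonglongrightarrow> c"
    proof (rule Lim_transform_eventually)
      show "(\<lambda>n. (T n - real (p n) * real n) / (real n)^2 + p n / n) \<longlonglongrightarrow> c"
        using tendsto_add[OF elim(2) assms(2)] by (simp add: T_def)
      show "\<forall>\<^sub>F n in sequentially. (T n - real (p n) * real n) / (real n)^2 + p n / n = T n / (real n)^2"
        using eventually_gt_at_top[of 0] by eventually_elim (simp add: diff_divide_distrib power2_eq_square)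
    qed
    have h: "(\<lambda>n. (\<Sum>e\<leftarrow>es n. (e / n) * ln (e / n)) / n) \<longlonglongrightarrow> I"
      unfolding I_def
    proof (rule sum_xlnx_tendsto[OF assms(1) es(2)])
      show "(\<lambda>n. length (es n) / n) \<longlonglongrightarrow> c" using assms(2) by (simp add: es(1))
      show "(\<lambda>n. (\<Sum>e\<leftarrow>es n. e) / (real n)^2) \<longlonglongrightarrow> c"
        unfolding T by (rule T_lim)
      show "(\<lambda>n. \<Sum>e\<leftarrow>es n. 1 / (e + real n * q)) \<longlonglongrightarrow> mp_stieltjes c q" if "q \<in> \<rat>" "0 < q" for q
      proof (rule Lim_transform_eventually)
        show "(\<lambda>n. res_trace (p n) (A n) (real n * q)) \<longlonglongrightarrow> mp_stieltjes c q"
          using elim(1) that by (simp add: A_def)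
        show "\<forall>\<^sub>F n in sequentially. res_trace (p n) (A n) (real n * q) = (\<Sum>e\<leftarrow>es n. 1 / (e + real n * q))"
          using eventually_gt_at_top[of 0] by eventually_elim (simp add: es(4) that)
      qed
      \<comment> \<open>The bound is taken at the first square above n. That square is at most
        \<open>4 n\<close>, and the cube of 4 gives the factor 64.\<close>
      define B where "B = 2 * (real C)^2 + C + 1"
      have "\<forall>\<^sub>F n in sequentially. (frobenius (C * (Suc (floor_sqrt n))^2) (gram (entries w) {..<(Suc (floor_sqrt n))^2})) \<le> B * (real ((Suc (floor_sqrt n))^2)) ^ 3"
        unfolding B_def by (rule eventually_compose_filterlim[OF elim(3) floor_sqrt_at_top])
      then show "\<forall>\<^sub>F n in sequentially. (\<Sum>e\<leftarrow>es n. e^2) / real n ^ 3 \<le> 64 * B"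
        using eventually_gt_at_top[of 0]
      proof eventually_elim
        case (elim n)
        define m where "m = floor_sqrt n"
        have m: "1 \<le> m" "m^2 \<le> n" "n < (Suc m)^2"
          using elim(2) floor_sqrt_power2_le[of n] Suc_floor_sqrt_power2_gt[of n] by (simp_all add: m_def Suc_le_eq)
        have "(Suc m)^2 \<le> (2 * m)^2" using m(1) by (intro power_mono) auto
        then have "(Suc m)^2 \<le> 4 * n" using m(2) by (simp add: power_mult_distrib)
        then have N4: "real ((Suc m)^2) \<le> real (4 * n)" by (simp only: of_nat_le_iff)
        have "(\<Sum>e\<leftarrow>es n. e^2) \<le> frobenius (C * (Suc m)^2) (gram (entries w) {..<(Suc m)^2})"
          unfolding es(6)[symmetric] A_def
        proof (rule gram_frobenius_mono)
          have "p n \<le> C * n" using assms(3) elim(2) by simp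
          also have "\<dots> \<le> C * (Suc m)^2" using m(3) by (intro mult_left_mono) auto
          finally show "p n \<le> C * (Suc m)^2" .
        qed (use m(3) in auto)
        also have "\<dots> \<le> B * (real ((Suc m)^2)) ^ 3"
          using elim(1) unfolding m_def .
        also have "\<dots> \<le> B * (real (4 * n)) ^ 3"
          by (intro mult_left_mono power_mono N4) (simp_all add: B_def)
        also have "\<dots> = 64 * B * real n ^ 3" by (simp add: power_mult_distrib)
        finally show ?case using elim(2) by (simp add: pos_divide_le_eq)
      qed
    qed
    have T_pos: "\<forall>\<^sub>F n in sequentially. 0 < T n \<and> 0 < n"
      using order_tendstoD(1)[OF T_lim assms(1)] eventually_gt_at_top[of 0]
      by eventually_elim (simp add: zero_less_divide_iff)
    have "(\<lambda>n. von_neumann_entropy (of_real (1 / T n) \<cdot>\<^sub>m to_mat (p n) (A n)) - ln (real n)) \<longlonglongrightarrow> ln c - I / c"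
    proof (rule Lim_transform_eventually)
      show "(\<lambda>n. ln (T n / (real n)^2) - (\<Sum>e\<leftarrow>es n. (e / n) * ln (e / n)) / n / (T n / (real n)^2)) \<longlonglongrightarrow> ln c - I / c"
        using assms(1) by (intro tendsto_intros T_lim h) auto
      show "\<forall>\<^sub>F n in sequentially. ln (T n / (real n)^2) - (\<Sum>e\<leftarrow>es n. (e / n) * ln (e / n)) / n / (T n / (real n)^2) =
          von_neumann_entropy (of_real (1 / T n) \<cdot>\<^sub>m to_mat (p n) (A n)) - ln (real n)"
        using T_pos
      proof eventually_elim
        case (elim n)
        have "von_neumann_entropy (of_real (1 / T n) \<cdot>\<^sub>m to_mat (p n) (A n)) =
            - (\<Sum>e\<leftarrow>es n. (1 / T n * e) * ln (1 / T n * e))"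
          by (rule von_neumann_entropy_smult[OF es(1,3)])
        then show ?case using entropy_of_spectrum[of "es n" "T n" "real n"] es(2) T elim by simp
      qed
    qed
    then show ?case using T_lim unfolding T_def A_def by blast
  qed
qed

end

theorem proposition1:
  fixes M :: "'a measure"
    and x :: "nat \<Rightarrow> nat \<Rightarrow> 'a \<Rightarrow> complex"
    and c :: real
    and p :: "nat \<Rightarrow> nat"
    and X \<rho> :: "nat \<Rightarrow> 'a \<Rightarrow> complex mat"
  assumes "prob_space M"
    and indep: "prob_space.indep_vars M (\<lambda>_. borel) (\<lambda>(k, l). x k l) ({1..} \<times> {1..})"
    and ident: "\<And>k l. k \<ge> 1 \<Longrightarrow> l \<ge> 1 \<Longrightarrow> distr M borel (x k l) = distr M borel (x 1 1)"
    and mean: "\<And>k l. k \<ge> 1 \<Longrightarrow> l \<ge> 1 \<Longrightarrow> (LINT \<omega>|M. x k l \<omega>) = 0"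
    and pseudo_var: "\<And>k l. k \<ge> 1 \<Longrightarrow> l \<ge> 1 \<Longrightarrow> (LINT \<omega>|M. (x k l \<omega>)\<^sup>2) = 0"
    and var: "\<And>k l. k \<ge> 1 \<Longrightarrow> l \<ge> 1 \<Longrightarrow> (LINT \<omega>|M. (cmod (x k l \<omega>))\<^sup>2) = 1"
    and fourth: "integrable M (\<lambda>\<omega>. (cmod (x 1 1 \<omega>)) ^ 4)"
    and c_pos: "c > 0"
    and p_pos: "\<And>n. n \<ge> 1 \<Longrightarrow> p n > 0"
    and p_lim: "(\<lambda>n. real (p n) / real n) \<longlonglongrightarrow> c"
    and X_eq: "\<And>n \<omega>. X n \<omega> = sample_mat x (p n) n \<omega>"
    and rho_eq: "\<And>n \<omega>. \<rho> n \<omega> = normalized_gram (X n \<omega>)"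
  shows "AE \<omega> in M.
      (\<lambda>n. von_neumann_entropy (\<rho> n \<omega>) - ln (real n)) \<longlonglongrightarrow>
        ln c - 1 / (2 * pi * c) *
          (LBINT t:{(1 - sqrt c)\<^sup>2..(1 + sqrt c)\<^sup>2}.
             ln t * sqrt (((1 + sqrt c)\<^sup>2 - t) * (t - (1 - sqrt c)\<^sup>2)))
      \<and> (\<lambda>n. von_neumann_entropy (\<rho> n \<omega>) / ln (real n)) \<longlonglongrightarrow> 1"
proof -
  interpret prob_space M by fact
  have x_meas: "x k l \<in> borel_measurable M" if "1 \<le> k" "1 \<le> l" for k l
    using indep that by (auto simp: indep_vars_def)
  have fourth_distr: "integrable (distr M borel (x k l)) (\<lambda>z. cmod z ^ 4) \<longleftrightarrow> integrable M (\<lambda>w. cmod (x k l w) ^ 4)"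
    "integral\<^sup>L (distr M borel (x k l)) (\<lambda>z. cmod z ^ 4) = expectation (\<lambda>w. cmod (x k l w) ^ 4)"
    if "1 \<le> k" "1 \<le> l" for k l
    using x_meas[OF that] by (simp_all add: integrable_distr_eq integral_distr)
  define Y where "Y i m = x (Suc i) (Suc m)" for i m
  define \<kappa> where "\<kappa> = expectation (\<lambda>w. cmod (x 1 1 w) ^ 4)"
  have ind: "indep_vars (\<lambda>_. borel) (\<lambda>(i, m). Y i m) UNIV"
  proof -
    have "indep_vars (\<lambda>_. borel) (\<lambda>j. (\<lambda>(k, l). x k l) ((\<lambda>(i, m). (Suc i, Suc m)) j)) UNIV"
      by (rule indep_vars_reindex_inj[OF indep]) (auto simp: inj_on_def)
    moreover have "(\<lambda>j. (\<lambda>(k, l). x k l) ((\<lambda>(i, m). (Suc i, Suc m)) j)) = (\<lambda>(i, m). Y i m)"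
      by (simp add: Y_def fun_eq_iff)
    ultimately show ?thesis by (simp only:)
  qed
  have "iid_entries M (\<lambda>(i, m). Y i m) UNIV \<kappa>"
  proof (intro iid_entries.intro iid_entries_axioms.intro)
    show "prob_space M" by fact
    show "indep_vars (\<lambda>_. borel) (\<lambda>(i, m). Y i m) UNIV" by (rule ind)
    fix im :: "nat \<times> nat"
    obtain i m where im: "im = (i, m)" by fastforce
    have eq: "distr M borel (x (Suc i) (Suc m)) = distr M borel (x 1 1)" by (rule ident) auto
    show "expectation (case im of (i, m) \<Rightarrow> Y i m) = 0" using mean by (simp add: im Y_def)
    show "expectation (\<lambda>w. ((case im of (i, m) \<Rightarrow> Y i m) w)^2) = 0"
      using pseudo_var by (simp add: im Y_def)
    show "expectation (\<lambda>w. (cmod ((case im of (i, m) \<Rightarrow> Y i m) w))^2) = 1"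
      using var by (simp add: im Y_def)
    show "integrable M (\<lambda>w. cmod ((case im of (i, m) \<Rightarrow> Y i m) w) ^ 4)"
      using fourth_distr(1)[of "Suc i" "Suc m"] fourth_distr(1)[of 1 1] fourth eq by (simp add: im Y_def)
    show "expectation (\<lambda>w. cmod ((case im of (i, m) \<Rightarrow> Y i m) w) ^ 4) \<le> \<kappa>"
      using fourth_distr(2)[of "Suc i" "Suc m"] fourth_distr(2)[of 1 1] eq by (simp add: im Y_def \<kappa>_def)
  qed
  then interpret random_matrix M Y \<kappa> by (rule random_matrix.intro)
  \<comment> \<open>A convergent sequence of ratios is bounded. The index 0 is excluded because
    \<open>p 0\<close> is arbitrary.\<close>
  obtain C :: nat where C: "p n \<le> C * n" if "0 < n" for n
  proof -
    obtain K where K: "\<And>n. norm (real (p n) / real n) \<le> K"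
      using convergent_imp_Bseq[OF convergentI[OF p_lim]] by (auto simp: Bseq_def)
    have "p n \<le> nat \<lceil>K\<rceil> * n" if "0 < n" for n
    proof -
      have "real (p n) \<le> K * n" using K[of n] that by (simp add: pos_divide_le_eq)
      also have "\<dots> \<le> real (nat \<lceil>K\<rceil>) * n"
        by (intro mult_right_mono real_nat_ceiling_ge) simp
      finally show ?thesis by (metis of_nat_le_iff of_nat_mult)
    qed
    then show thesis using that by blast
  qed
  let ?a = "(1 - sqrt c)^2" and ?b = "(1 + sqrt c)^2"
  \<comment> \<open>Closed and open interval agree pointwise under the integral, since the half
    circle vanishes at both edges.\<close>
  have integral_eq: "(LBINT t:{?a..?b}. ln t * sqrt ((?b - t) * (t - ?a))) = (LBINT t:{?a<..<?b}. semicircle ?a ?b t * ln t)"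
    unfolding set_lebesgue_integral_def
    by (intro Bochner_Integration.integral_cong refl) (auto simp: semicircle_def indicator_def)
  \<comment> \<open>This also covers a vanishing trace, where both scalar factors are 0 by the
    convention for division.\<close>
  have rho: "\<rho> n w = of_real (1 / energy (p n) {..<n} w) \<cdot>\<^sub>m
      to_mat (p n) (gram (entries w) {..<n})" for n w
  proof -
    have "(\<lambda>i m. x (Suc i) (Suc m) w) = entries w" by (simp add: entries_def[abs_def] Y_def)
    then have g: "X n w * mat_adjoint (X n w) = to_mat (p n) (gram (entries w) {..<n})"
      unfolding X_eq sample_mat_gram by simp
    have "mat_trace (X n w * mat_adjoint (X n w)) = of_real (energy (p n) {..<n} w)"
      unfolding g energy_def trace_gram[symmetric] by (simp add: mat_trace_def)
    then show ?thesis unfolding rho_eq normalized_gram_def by (simp add: g)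
  qed
  have "AE w in M. (\<lambda>n. von_neumann_entropy (\<rho> n w) - ln (real n)) \<longlonglongrightarrow>
      ln c - 1 / (2 * pi) * (LBINT t:{?a<..<?b}. semicircle ?a ?b t * ln t) / c"
    using AE_sum_xlnx[of c p C, OF c_pos p_lim C] unfolding rho by (auto elim: eventually_mono)
  then show ?thesis
  proof eventually_elim
    case lim: (elim w)
    \<comment> \<open>A convergent sequence divided by \<open>ln n\<close> tends to 0; adding 1
      restores the entropy over \<open>ln n\<close> as soon as \<open>n > 1\<close>.\<close>
    have "(\<lambda>n. (von_neumann_entropy (\<rho> n w) - ln (real n)) / ln (real n) + 1) \<longlonglongrightarrow> 0 + 1"
      by (intro tendsto_add tendsto_const tendsto_divide_0[OF lim] filterlim_at_top_imp_at_infinity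
        filterlim_compose[OF ln_at_top] filterlim_real_sequentially)
    moreover have "\<forall>\<^sub>F n in sequentially. (von_neumann_entropy (\<rho> n w) - ln (real n)) / ln (real n) + 1 =
        von_neumann_entropy (\<rho> n w) / ln (real n)"
      using eventually_gt_at_top[of 1] by eventually_elim (simp add: diff_divide_distrib)
    ultimately have "(\<lambda>n. von_neumann_entropy (\<rho> n w) / ln (real n)) \<longlonglongrightarrow> 1"
      using Lim_transform_eventually by fastforce
    then show ?case using lim unfolding integral_eq by simp
  qed
qed

end
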